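(* Let $\mathcal{V}$ be a variety in a finite language with a $\mathsf{d}$-cube term ($\mathsf{d}>1$), let $P$ be a $(1,\mathsf{d}-1)$-parallelogram term for $\mathcal{V}$, and let $\mathcal{K}$ be a finite set of finite algebras in $\mathcal{V}$. The problems $\mathrm{SMP}(\mathcal{K})$ and $\mathrm{CompactRep}(\mathcal{K})$ are polynomial time reducible to one another. More precisely, $\mathrm{CompactRep}(\mathcal{K})$ can be solved in polynomial time by an algorithm making repeated calls to $\mathrm{SMP}(\mathcal{K})$, and $\mathrm{SMP}(\mathcal{K})$ restricted to inputs with $n\ge\mathsf{d}$ can be solved in polynomial time by an algorithm making a single call to $\mathrm{CompactRep}(\mathcal{K})$.
   Context: $[m]=\{1,\dots,m\}$, $\binom{S}{k}$ is the set of $k$-element subsets of $S$, and $b|_I$, $B|_I$ denote projections onto the coordinates in $I$. A $\mathsf{d}$-cube term is a term $t$ satisfying identities $t(M)=(y,\dots,y)^T$ with $M$ a matrix with $\mathsf{d}$ rows, entries among the variables $x,y$, each column containing at least one $x$. A $(1,\mathsf{d}-1)$-parallelogram term is a $(\mathsf{d}+3)$-ary term $P$ with $P(x,x,y,z,y,\dots,y)=y$ and, for $j=2,\dots,\mathsf{d}$, $P(y,x,x,y,\dots,y,z,y,\dots,y)=y$ ($z$ in the $j$-th of the last $\mathsf{d}$ positions); such a term exists in $\mathcal{V}$. Let $p(x,u,y):=P(x,u,y,x,y,\dots,y)$ and $x^y:=p(x,y,y)$. For $B\subseteq A_1\times\dots\times A_n$ and $i\in[n]$, $(\gamma,\delta)$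 is a fork in coordinate $i$ of $B$, witnessed by $b,\hat b\in B$, if $b|_{[i-1]}=\hat b|_{[i-1]}$, $b|_i=\gamma$, $\hat b|_i=\delta$; $\operatorname{fork}_i(B)$ is the set of forks and $\operatorname{fork}'_i(B)=\{(\gamma,\delta^\gamma):(\gamma,\delta)\in\operatorname{fork}_i(B)\}$. For a subalgebra $\mathbf{B}$ of $\mathbf{A}_1\times\dots\times\mathbf{A}_n$ ($\mathbf{A}_i\in\mathcal{K}$, $n\ge\mathsf{d}$), a standardized representation for $\mathbf{B}$ is a set $R\subseteq B$ together with designations such that: (1) for every $I\in\binom{[n]}{\mathsf{d}-1}$ and every $\bar b\in B|_I$ an element $r_{I,\bar b}\in R$ with $r_{I,\bar b}|_I=\bar b$ is designated; (2) for every $m$ with $\mathsf{d}\le m\le n$ there is a set $F_m$ with $\operatorname{fork}'_m(B)\subseteq F_m\subseteq\operatorname{fork}_m(R)$, and for every $(\gamma,\delta)\in F_m$ a pair $(u_{m,\gamma,\delta},\hat u_{m,\gamma,\delta})\in R^2$ witnessing $(\gamma,\delta)\in\operatorname{fork}_m(R)$ is designated; (3) every element of $R$ has at least one designation. $\mathrm{CompactRep}(\mathcal{K})$: given $a_1,\dots,a_k\in\mathbf{A}_1\times\dots\times\mathbf{A}_n$ with $\mathbf{A}_i\in\mathcal{K}$ and $n\ge\mathsf{d}$, output a standardized representation (with its designations) for the subalgebra generated by $\{a_1,\dots,a_k\}$. $\mathrm{SMP}(\mathcal{K})$: given $a_1,\dots,a_k,b\in\mathbf{A}_1\times\dots\times\mathbf{A}_n$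 with $\mathbf{A}_i\in\mathcal{K}$, decide whether $b$ is in the subalgebra generated by $\{a_1,\dots,a_k\}$. *)

theory Defs
  imports Main "HOL-Computational_Algebra.Polynomial"
begin

section \<open>Universal algebra\<close>

record 'f language =
  syms :: "'f set"
  arity :: "'f \<Rightarrow> nat"

record ('f, 'a) alg =
  univ :: "'a set"
  interp :: "'f \<Rightarrow> 'a list \<Rightarrow> 'a"

definition is_algebra :: "'f language \<Rightarrow> ('f, 'a) alg \<Rightarrow> bool" where
  "is_algebra L A \<longleftrightarrow> univ A \<noteq> {} \<and>
     (\<forall>f\<in>syms L. \<forall>xs. length xs = arity L f \<and> set xs \<subseteq> univ A \<longrightarrow> interp A f xs \<in> univ A)"

datatype 'f trm = Var nat | Fn 'f "'f trm list"

fun wf_term :: "'f language \<Rightarrow> 'f trm \<Rightarrow> bool" where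
  "wf_term L (Var i) \<longleftrightarrow> True"
| "wf_term L (Fn f ts) \<longleftrightarrow> f \<in> syms L \<and> length ts = arity L f \<and> (\<forall>t\<in>set ts. wf_term L t)"

fun vars :: "'f trm \<Rightarrow> nat set" where
  "vars (Var i) = {i}"
| "vars (Fn f ts) = (\<Union>t\<in>set ts. vars t)"

definition nary_term :: "'f language \<Rightarrow> nat \<Rightarrow> 'f trm \<Rightarrow> bool" where
  "nary_term L k t \<longleftrightarrow> wf_term L t \<and> vars t \<subseteq> {..<k}"

fun eval :: "('f, 'a) alg \<Rightarrow> (nat \<Rightarrow> 'a) \<Rightarrow> 'f trm \<Rightarrow> 'a" where
  "eval A \<sigma> (Var i) = \<sigma> i"
| "eval A \<sigma> (Fn f ts) = interp A f (map (eval A \<sigma>) ts)"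

definition term_op :: "('f, 'a) alg \<Rightarrow> 'f trm \<Rightarrow> 'a list \<Rightarrow> 'a" where
  "term_op A t xs = eval A (\<lambda>i. xs ! i) t"

definition satisfies :: "('f, 'a) alg \<Rightarrow> 'f trm \<times> 'f trm \<Rightarrow> bool" where
  "satisfies A e \<longleftrightarrow> (\<forall>\<sigma>. range \<sigma> \<subseteq> univ A \<longrightarrow> eval A \<sigma> (fst e) = eval A \<sigma> (snd e))"

text \<open>A variety is an equational class; here, the algebras of the class whose universe is a
  subset of the type \<open>'a\<close>. An identity valid in the whole class is in particular valid in these.\<close>

definition variety :: "'f language \<Rightarrow> ('f, 'a) alg set \<Rightarrow> bool" where
  "variety L V \<longleftrightarrow> (\<exists>E. (\<forall>(s, t)\<in>E. wf_term L s \<and> wf_term L t) \<and>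
     V = {A. is_algebra L A \<and> (\<forall>e\<in>E. satisfies A e)})"

text \<open>In the \<open>d\<close> by \<open>k\<close> matrix \<open>M\<close> of variables, \<open>True\<close> stands for \<open>x\<close> and \<open>False\<close> for \<open>y\<close>.\<close>

definition cube_term :: "'f language \<Rightarrow> ('f, 'a) alg set \<Rightarrow> nat \<Rightarrow> 'f trm \<Rightarrow> bool" where
  "cube_term L V d t \<longleftrightarrow> (\<exists>k (M :: nat \<Rightarrow> nat \<Rightarrow> bool).
     nary_term L k t \<and>
     (\<forall>j<k. \<exists>i<d. M i j) \<and>
     (\<forall>A\<in>V. \<forall>x\<in>univ A. \<forall>y\<in>univ A. \<forall>i<d.
        term_op A t (map (\<lambda>j. if M i j then x else y) [0..<k]) = y))"

definition parallelogram_term :: "'f language \<Rightarrow> ('f, 'a) alg set \<Rightarrow> nat \<Rightarrow> 'f trm \<Rightarrow> bool" where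
  "parallelogram_term L V d P \<longleftrightarrow> nary_term L (d + 3) P \<and>
     (\<forall>A\<in>V. \<forall>x\<in>univ A. \<forall>y\<in>univ A. \<forall>z\<in>univ A.
        term_op A P ([x, x, y] @ (replicate d y)[0 := z]) = y \<and>
        (\<forall>j\<in>{2..d}. term_op A P ([y, x, x] @ (replicate d y)[j - 1 := z]) = y))"

definition p_op :: "nat \<Rightarrow> 'f trm \<Rightarrow> ('f, 'a) alg \<Rightarrow> 'a \<Rightarrow> 'a \<Rightarrow> 'a \<Rightarrow> 'a" where
  "p_op d P A x u y = term_op A P ([x, u, y] @ (replicate d y)[0 := x])"

definition pow_op :: "nat \<Rightarrow> 'f trm \<Rightarrow> ('f, 'a) alg \<Rightarrow> 'a \<Rightarrow> 'a \<Rightarrow> 'a" where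
  "pow_op d P A x y = p_op d P A x y y"

definition prod_alg :: "('f, 'a) alg list \<Rightarrow> ('f, 'a list) alg" where
  "prod_alg As =
     \<lparr>univ = {xs. length xs = length As \<and> (\<forall>i<length As. xs ! i \<in> univ (As ! i))},
      interp = (\<lambda>f xss. map (\<lambda>i. interp (As ! i) f (map (\<lambda>xs. xs ! i) xss)) [0..<length As])\<rparr>"

inductive_set Sg :: "'f language \<Rightarrow> ('f, 'a) alg \<Rightarrow> 'a set \<Rightarrow> 'a set"
  for L :: "'f language" and A :: "('f, 'a) alg" and X :: "'a set" where
  gen: "x \<in> X \<Longrightarrow> x \<in> Sg L A X"
| op: "f \<in> syms L \<Longrightarrow> length xs = arity L f \<Longrightarrow> (\<And>x. x \<in> set xs \<Longrightarrow> x \<in> Sg L A X) \<Longrightarrow>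
       interp A f xs \<in> Sg L A X"


section \<open>Standardized representations\<close>

text \<open>Coordinates are numbered from 1, so coordinate \<open>i\<close> of a tuple \<open>b\<close> is \<open>b ! (i - 1)\<close>.\<close>

definition proj :: "nat set \<Rightarrow> 'a list \<Rightarrow> 'a list" where
  "proj I b = map (\<lambda>i. b ! (i - 1)) (sorted_list_of_set I)"

definition witnesses_fork :: "nat \<Rightarrow> 'a list \<times> 'a list \<Rightarrow> 'a \<times> 'a \<Rightarrow> bool" where
  "witnesses_fork i w g \<longleftrightarrow>
     take (i - 1) (fst w) = take (i - 1) (snd w) \<and>
     fst w ! (i - 1) = fst g \<and> snd w ! (i - 1) = snd g"

definition fork :: "nat \<Rightarrow> 'a list set \<Rightarrow> ('a \<times> 'a) set" where
  "fork i B = {g. \<exists>b\<in>B. \<exists>b'\<in>B. witnesses_fork i (b, b') g}"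

definition fork' ::
  "nat \<Rightarrow> 'f trm \<Rightarrow> ('f, 'a) alg list \<Rightarrow> nat \<Rightarrow> 'a list set \<Rightarrow> ('a \<times> 'a) set" where
  "fork' d P As i B = {(\<gamma>, pow_op d P (As ! (i - 1)) \<delta> \<gamma>) | \<gamma> \<delta>. (\<gamma>, \<delta>) \<in> fork i B}"

definition local_indices :: "nat \<Rightarrow> nat \<Rightarrow> 'a list set \<Rightarrow> (nat set \<times> 'a list) set" where
  "local_indices d n B = {(I, c). I \<subseteq> {1..n} \<and> card I = d - 1 \<and> c \<in> proj I ` B}"

definition fork_indices :: "nat \<Rightarrow> nat \<Rightarrow> (nat \<Rightarrow> ('a \<times> 'a) set) \<Rightarrow> (nat \<times> 'a \<times> 'a) set" where
  "fork_indices d n F = {(m, \<gamma>, \<delta>). d \<le> m \<and> m \<le> n \<and> (\<gamma>, \<delta>) \<in> F m}"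

definition standardized_rep ::
  "nat \<Rightarrow> 'f trm \<Rightarrow> ('f, 'a) alg list \<Rightarrow> 'a list set \<Rightarrow> 'a list set \<Rightarrow>
   (nat set \<times> 'a list \<Rightarrow> 'a list) \<Rightarrow> (nat \<Rightarrow> ('a \<times> 'a) set) \<Rightarrow>
   (nat \<times> 'a \<times> 'a \<Rightarrow> 'a list \<times> 'a list) \<Rightarrow> bool" where
  "standardized_rep d P As B R r F u \<longleftrightarrow>
     R \<subseteq> B \<and>
     (\<forall>(I, c)\<in>local_indices d (length As) B. r (I, c) \<in> R \<and> proj I (r (I, c)) = c) \<and>
     (\<forall>m. d \<le> m \<and> m \<le> length As \<longrightarrow> fork' d P As m B \<subseteq> F m \<and> F m \<subseteq> fork m R) \<and>
     (\<forall>(m, g)\<in>fork_indices d (length As) F. u (m, g) \<in> R \<times> R \<and> witnesses_fork m (u (m, g)) g) \<and>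
     (\<forall>e\<in>R. (\<exists>l\<in>local_indices d (length As) B. e = r l) \<or>
            (\<exists>h\<in>fork_indices d (length As) F. e = fst (u h) \<or> e = snd (u h)))"


section \<open>Oracle algorithms and polynomial time\<close>

text \<open>Algorithms are deterministic while programs over binary trees. The size of every tree that is
  read, built, sent to the oracle or received from the oracle is charged to the running time, so
  trees of superpolynomial size cannot be produced in polynomial time by sharing, and polynomial
  time means the same as for (oracle) Turing machines.\<close>

datatype val = Leaf | Node val val

fun vsize :: "val \<Rightarrow> nat" where
  "vsize Leaf = 1"
| "vsize (Node a b) = vsize a + vsize b + 1"

fun left :: "val \<Rightarrow> val" where
  "left Leaf = Leaf"
| "left (Node a b) = a"

fun right :: "val \<Rightarrow> val" where
  "right Leaf = Leaf"
| "right (Node a b) = b"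

fun enc_bool :: "bool \<Rightarrow> val" where
  "enc_bool False = Leaf"
| "enc_bool True = Node Leaf Leaf"

fun enc_list :: "val list \<Rightarrow> val" where
  "enc_list [] = Leaf"
| "enc_list (x # xs) = Node x (enc_list xs)"

text \<open>Natural numbers are encoded in unary; they only occur as coordinate numbers.\<close>

definition enc_nat :: "nat \<Rightarrow> val" where
  "enc_nat n = enc_list (replicate n Leaf)"

type_synonym state = "nat \<Rightarrow> val"

datatype exp = EVar nat | ELeaf | ENode exp exp | ELeft exp | ERight exp | EEq exp exp

fun aval :: "exp \<Rightarrow> state \<Rightarrow> val" where
  "aval (EVar x) s = s x"
| "aval ELeaf s = Leaf"
| "aval (ENode e1 e2) s = Node (aval e1 s) (aval e2 s)"
| "aval (ELeft e) s = left (aval e s)"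
| "aval (ERight e) s = right (aval e s)"
| "aval (EEq e1 e2) s = enc_bool (aval e1 s = aval e2 s)"

fun acost :: "exp \<Rightarrow> state \<Rightarrow> nat" where
  "acost (EVar x) s = vsize (s x)"
| "acost ELeaf s = 1"
| "acost (ENode e1 e2) s = acost e1 s + acost e2 s + 1"
| "acost (ELeft e) s = acost e s + 1"
| "acost (ERight e) s = acost e s + 1"
| "acost (EEq e1 e2) s = acost e1 s + acost e2 s + 1"

datatype com =
    Skip
  | Assign nat exp
  | Query nat exp
  | Seq com com
  | If exp com com
  | While exp com

text \<open>\<open>exec f c s t qs s'\<close>: started in state \<open>s\<close> with oracle \<open>f\<close>, the program \<open>c\<close> halts in state \<open>s'\<close>
  after time \<open>t\<close>, and \<open>qs\<close> is the list of the oracle queries it made.\<close>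

inductive exec :: "(val \<Rightarrow> val) \<Rightarrow> com \<Rightarrow> state \<Rightarrow> nat \<Rightarrow> val list \<Rightarrow> state \<Rightarrow> bool"
  for f :: "val \<Rightarrow> val" where
  Skip: "exec f Skip s 1 [] s"
| Assign: "exec f (Assign x e) s (acost e s + 1) [] (s(x := aval e s))"
| Query: "exec f (Query x e) s (acost e s + vsize (f (aval e s)) + 1) [aval e s]
            (s(x := f (aval e s)))"
| Seq: "exec f c1 s t1 qs1 s1 \<Longrightarrow> exec f c2 s1 t2 qs2 s2 \<Longrightarrow>
        exec f (Seq c1 c2) s (t1 + t2 + 1) (qs1 @ qs2) s2"
| IfTrue: "aval e s \<noteq> Leaf \<Longrightarrow> exec f c1 s t qs s' \<Longrightarrow>
        exec f (If e c1 c2) s (acost e s + t + 1) qs s'"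
| IfFalse: "aval e s = Leaf \<Longrightarrow> exec f c2 s t qs s' \<Longrightarrow>
        exec f (If e c1 c2) s (acost e s + t + 1) qs s'"
| WhileFalse: "aval e s = Leaf \<Longrightarrow> exec f (While e c) s (acost e s + 1) [] s"
| WhileTrue: "aval e s \<noteq> Leaf \<Longrightarrow> exec f c s t1 qs1 s1 \<Longrightarrow> exec f (While e c) s1 t2 qs2 s2 \<Longrightarrow>
        exec f (While e c) s (acost e s + t1 + t2 + 1) (qs1 @ qs2) s2"

record problem =
  instances :: "val set"
  solutions :: "val \<Rightarrow> val set"

text \<open>An oracle for a problem may return any solution, and is unconstrained off the instances.\<close>

definition solves :: "(val \<Rightarrow> val) \<Rightarrow> problem \<Rightarrow> bool" where
  "solves f Q \<longleftrightarrow> (\<forall>x\<in>instances Q. f x \<in> solutions Q x)"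

text \<open>Input and output are held in variable 0. \<open>C\<close> is the set of admissible numbers of oracle calls.\<close>

definition poly_time_solvable_with_calls :: "nat set \<Rightarrow> problem \<Rightarrow> problem \<Rightarrow> bool" where
  "poly_time_solvable_with_calls C S Q \<longleftrightarrow> (\<exists>(c :: com) (q :: nat poly).
     \<forall>f. solves f Q \<longrightarrow> (\<forall>x\<in>instances S. \<exists>t qs s'.
       exec f c ((\<lambda>_. Leaf)(0 := x)) t qs s' \<and>
       s' 0 \<in> solutions S x \<and>
       t \<le> poly q (vsize x) \<and>
       set qs \<subseteq> instances Q \<and>
       length qs \<in> C))"

abbreviation poly_time_reducible :: "problem \<Rightarrow> problem \<Rightarrow> bool" where
  "poly_time_reducible S Q \<equiv> poly_time_solvable_with_calls UNIV S Q"


section \<open>The two problems\<close>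

text \<open>Since \<open>K\<close> is a fixed finite set of finite algebras, its members and their elements are encoded
  by arbitrary fixed codes \<open>ca\<close> and \<open>ce\<close>.\<close>

definition enc_tuple :: "('a \<Rightarrow> val) \<Rightarrow> 'a list \<Rightarrow> val" where
  "enc_tuple ce xs = enc_list (map ce xs)"

definition enc_gens ::
  "(('f, 'a) alg \<Rightarrow> val) \<Rightarrow> ('a \<Rightarrow> val) \<Rightarrow> ('f, 'a) alg list \<Rightarrow> 'a list list \<Rightarrow> val" where
  "enc_gens ca ce As as = Node (enc_list (map ca As)) (enc_list (map (enc_tuple ce) as))"

definition valid_gens :: "('f, 'a) alg set \<Rightarrow> ('f, 'a) alg list \<Rightarrow> 'a list list \<Rightarrow> bool" where
  "valid_gens K As as \<longleftrightarrow>
     As \<noteq> [] \<and> set As \<subseteq> K \<and> as \<noteq> [] \<and> set as \<subseteq> univ (prod_alg As)"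

definition SMP_from ::
  "nat \<Rightarrow> 'f language \<Rightarrow> ('f, 'a) alg set \<Rightarrow> (('f, 'a) alg \<Rightarrow> val) \<Rightarrow> ('a \<Rightarrow> val) \<Rightarrow> problem" where
  "SMP_from n0 L K ca ce =
     \<lparr>instances = {Node (enc_gens ca ce As as) (enc_tuple ce b) | As as b.
        valid_gens K As as \<and> b \<in> univ (prod_alg As) \<and> n0 \<le> length As},
      solutions = (\<lambda>x. {enc_bool (b \<in> Sg L (prod_alg As) (set as)) | As as b.
        x = Node (enc_gens ca ce As as) (enc_tuple ce b) \<and>
        valid_gens K As as \<and> b \<in> univ (prod_alg As) \<and> n0 \<le> length As})\<rparr>"

abbreviation SMP ::
  "'f language \<Rightarrow> ('f, 'a) alg set \<Rightarrow> (('f, 'a) alg \<Rightarrow> val) \<Rightarrow> ('a \<Rightarrow> val) \<Rightarrow> problem" where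
  "SMP \<equiv> SMP_from 1"

text \<open>A standardized representation is written down as the two lists (in any order, without
  repetition) of its designations; \<open>R\<close> is the set of all designated elements.\<close>

definition encodes_rep ::
  "('a \<Rightarrow> val) \<Rightarrow> nat \<Rightarrow> nat \<Rightarrow> 'a list set \<Rightarrow> (nat set \<times> 'a list \<Rightarrow> 'a list) \<Rightarrow>
   (nat \<Rightarrow> ('a \<times> 'a) set) \<Rightarrow> (nat \<times> 'a \<times> 'a \<Rightarrow> 'a list \<times> 'a list) \<Rightarrow> val \<Rightarrow> bool" where
  "encodes_rep ce d n B r F u v \<longleftrightarrow> (\<exists>ls fs.
     distinct ls \<and> set ls = local_indices d n B \<and>
     distinct fs \<and> set fs = fork_indices d n F \<and>
     v = Node
       (enc_list (map (\<lambda>(I, c). enc_list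
          [enc_list (map enc_nat (sorted_list_of_set I)), enc_tuple ce c, enc_tuple ce (r (I, c))]) ls))
       (enc_list (map (\<lambda>(m, \<gamma>, \<delta>). enc_list
          [enc_nat m, ce \<gamma>, ce \<delta>,
           enc_tuple ce (fst (u (m, \<gamma>, \<delta>))), enc_tuple ce (snd (u (m, \<gamma>, \<delta>)))]) fs)))"

definition CompactRep ::
  "nat \<Rightarrow> 'f trm \<Rightarrow> 'f language \<Rightarrow> ('f, 'a) alg set \<Rightarrow> (('f, 'a) alg \<Rightarrow> val) \<Rightarrow> ('a \<Rightarrow> val) \<Rightarrow>
   problem" where
  "CompactRep d P L K ca ce =
     \<lparr>instances = {enc_gens ca ce As as | As as. valid_gens K As as \<and> d \<le> length As},
      solutions = (\<lambda>x. {v. \<exists>As as R r F u.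
        x = enc_gens ca ce As as \<and> valid_gens K As as \<and> d \<le> length As \<and>
        standardized_rep d P As (Sg L (prod_alg As) (set as)) R r F u \<and>
        encodes_rep ce d (length As) (Sg L (prod_alg As) (set as)) r F u v})\<rparr>"

end

theory Submission imports Defs begin

text \<open>Programs are obtained from a class of functions on trees that is closed under pairing, case
  distinction and size-bounded iteration along lists.

  To decide \<open>b \<in> B\<close> from a standardized representation, one builds for \<open>m = d, \<dots>, n\<close> an element of
  \<open>B\<close> that agrees with \<open>b\<close> on the first \<open>m\<close> coordinates. Suppose that \<open>c \<in> B\<close> agrees with \<open>b\<close> on the
  coordinates before \<open>m\<close>, and let \<open>v\<^sub>2, \<dots>, v\<^sub>d \<in> B\<close> agree with \<open>b\<close> on \<open>I\<close> and \<open>m\<close>, where \<open>v\<^sub>j\<close> may differ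
  from \<open>b\<close> in the coordinate \<open>i\<^sub>j \<in> I\<close>. With \<open>\<gamma>\<close>, \<open>\<delta>\<close> the entries of \<open>c\<close>, \<open>b\<close> at \<open>m\<close>, let \<open>(u, u')\<close> be the
  designated witnesses of the fork \<open>(\<delta>, \<gamma>\<^sup>\<delta>)\<close>. Writing \<open>q(x) = P(x, v\<^sub>2, v\<^sub>2, x, v\<^sub>2, \<dots>, v\<^sub>d)\<close>, the element
  \<open>P(q(q(c)), p(u', u, v\<^sub>2), v\<^sub>2, c, v\<^sub>2, \<dots>, v\<^sub>d)\<close> agrees with \<open>b\<close> on \<open>I\<close> and \<open>m\<close>. It suffices to run
  through the polynomially many sets \<open>I\<close> that consist of \<open>d - 2\<close> arbitrary coordinates and an interval
  ending before \<open>m\<close>; inputs with few coordinates are padded by repeating the first one.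

  Conversely, membership queries on projections extend a partial tuple coordinate by coordinate to an
  element of \<open>B\<close>. If \<open>r \<in> B\<close> has entry \<open>\<gamma>\<close> at \<open>m\<close> and \<open>(b, b')\<close> witnesses a fork \<open>(\<gamma>, \<delta>)\<close>, then
  \<open>p(b', b, r)\<close> agrees with \<open>r\<close> before \<open>m\<close> and has entry \<open>\<delta>\<^sup>\<gamma>\<close> at \<open>m\<close>; so it is enough to record, for
  one such \<open>r\<close> per \<open>\<gamma>\<close>, all possible entries at \<open>m\<close> after the prefix of \<open>r\<close>.\<close>

section \<open>Register shifts and polynomial bounds\<close>

text \<open>The double \<open>q\<close> and the exponent in the fork match. At \<open>m\<close> all
  \<open>v\<^sub>j\<close> equal \<delta>, so both \<open>q(q(c))\<close> and
  \<open>p(u', u, v\<^sub>2)\<close> become \<open>(\<gamma>\<^sup>\<delta>)\<^sup>\<delta>\<close>,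
  and the first identity of \<open>P\<close> returns \<delta>. At a coordinate of \<open>I\<close>
  the witnesses cancel to \<open>v\<^sub>2\<close>, and the other identities return the entry of
  \<open>b\<close> although one \<open>v\<^sub>j\<close> is wrong; even \<open>v\<^sub>2\<close> may
  be wrong, because it fills both middle places. The obstacle is the number of sets
  \<open>I\<close>. A coordinate \<open>i\<close> joins the interval by gluing the
  \<open>d - 1\<close> approximations that belong to the tuple \<open>i # S\<close> with one entry
  left out: every coordinate is wrong in at most one of them, and only \<open>n ^ (d - 2)\<close>
  tuples \<open>S\<close> are kept at a time. On the machine side all bounds must hold for arbitrary
  trees. Hence operations are finite tables with a default, their outputs have a size independent of
  their arguments, and queries are guarded by a test for being an instance. Answers of SMP are
  unique, so they fit a calculus of functions; answers of CompactRep are not, so there a single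
  query is composed by hand, with a bound on the size of every possible answer.\<close>

fun shift_exp :: "nat \<Rightarrow> exp \<Rightarrow> exp" where
  "shift_exp k (EVar x) = EVar (x + k)"
| "shift_exp k ELeaf = ELeaf"
| "shift_exp k (ENode a b) = ENode (shift_exp k a) (shift_exp k b)"
| "shift_exp k (ELeft a) = ELeft (shift_exp k a)"
| "shift_exp k (ERight a) = ERight (shift_exp k a)"
| "shift_exp k (EEq a b) = EEq (shift_exp k a) (shift_exp k b)"

fun shift :: "nat \<Rightarrow> com \<Rightarrow> com" where
  "shift k Skip = Skip"
| "shift k (Assign x e) = Assign (x + k) (shift_exp k e)"
| "shift k (Query x e) = Query (x + k) (shift_exp k e)"
| "shift k (Seq c1 c2) = Seq (shift k c1) (shift k c2)"
| "shift k (If e c1 c2) = If (shift_exp k e) (shift k c1) (shift k c2)"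
| "shift k (While e c) = While (shift_exp k e) (shift k c)"

text \<open>A program shifted by \<open>k\<close> sees only the variables from \<open>k\<close> on;
  those below \<open>k\<close> form a frame that its run leaves untouched. This allows composition
  although every program uses variable 0.\<close>

definition merge_state :: "nat \<Rightarrow> state \<Rightarrow> state \<Rightarrow> state" where
  "merge_state k s0 s = (\<lambda>v. if v < k then s0 v else s (v - k))"

lemma aval_shift [simp]: "aval (shift_exp k e) (merge_state k s0 s) = aval e s"
  by (induction e) (auto simp: merge_state_def)

lemma acost_shift [simp]: "acost (shift_exp k e) (merge_state k s0 s) = acost e s"
  by (induction e) (auto simp: merge_state_def)

lemma merge_state_upd [simp]:
  "(merge_state k s0 s)(x + k := v) = merge_state k s0 (s(x := v))"
  by (auto simp: merge_state_def fun_eq_iff)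

lemma exec_shift:
  "exec f c s t qs s' \<Longrightarrow> exec f (shift k c) (merge_state k s0 s) t qs (merge_state k s0 s')"
proof (induction rule: exec.induct)
  case (Assign x e s)
  show ?case using exec.Assign[of f "x + k" "shift_exp k e" "merge_state k s0 s"]
    by (simp del: fun_upd_apply)
next
  case (Query x e s)
  show ?case using exec.Query[of f "x + k" "shift_exp k e" "merge_state k s0 s"]
    by (simp del: fun_upd_apply)
next
  case (IfTrue e s c1 t qs s' c2)
  then show ?case using exec.IfTrue[of "shift_exp k e" "merge_state k s0 s" f "shift k c1"] by simp
next
  case (IfFalse e s c2 t qs s' c1)
  then show ?case using exec.IfFalse[of "shift_exp k e" "merge_state k s0 s" f "shift k c2"] by simp
next
  case (WhileFalse e s c)
  then show ?case using exec.WhileFalse[of "shift_exp k e" "merge_state k s0 s" f "shift k c"] by simp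
next
  case (WhileTrue e s c t1 qs1 s1 t2 qs2 s2)
  then show ?case
    using exec.WhileTrue[of "shift_exp k e" "merge_state k s0 s" f "shift k c"] by simp
next
  case (Skip s)
  show ?case using exec.Skip by simp
next
  case (Seq c1 s t1 qs1 s1 c2 t2 qs2 s2)
  then show ?case using exec.Seq by simp
qed

lemma vsize_pos: "vsize v > 0"
  by (cases v) auto

lemma vsize_aval_le: "vsize (aval e s) \<le> acost e s"
proof (induction e)
  case (ELeft e) then show ?case by (cases "aval e s") auto
next
  case (ERight e) then show ?case by (cases "aval e s") auto
next
  case (EEq e1 e2)
  have "acost e s \<ge> 1" for e by (induction e) (auto simp: Suc_le_eq vsize_pos)
  from this[of e1] this[of e2] show ?case by (cases "aval e1 s = aval e2 s") auto
qed auto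

text \<open>The cost of an assignment or query dominates the size of the value written, so a time
  bound is also a bound on the output.\<close>

lemma exec_output_size: "exec f c s t qs s' \<Longrightarrow> vsize (s' v) \<le> vsize (s v) + t"
proof (induction rule: exec.induct)
  case (Assign x e s)
  then show ?case using vsize_aval_le[of e s] by auto
qed auto

lemma poly_nat_mono: "a \<le> b \<Longrightarrow> poly (q :: nat poly) a \<le> poly q b"
  by (induction q) (auto intro!: mult_le_mono)

definition poly_bounded :: "(val \<Rightarrow> nat) \<Rightarrow> bool" where
  "poly_bounded B \<longleftrightarrow> (\<exists>q :: nat poly. \<forall>x. B x \<le> poly q (vsize x))"

named_theorems pb

lemma poly_boundedI_le: "poly_bounded B \<Longrightarrow> (\<And>x. A x \<le> B x) \<Longrightarrow> poly_bounded A"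
  unfolding poly_bounded_def using le_trans by metis

lemma poly_bounded_const [pb]: "poly_bounded (\<lambda>x. c)"
  unfolding poly_bounded_def by (rule exI[of _ "[:c:]"]) auto

lemma poly_bounded_vsize [pb]: "poly_bounded vsize" "poly_bounded (\<lambda>x. vsize x)"
  unfolding poly_bounded_def by (rule exI[of _ "[:0,1:]"], auto)+

lemma poly_bounded_add [pb]:
  "poly_bounded A \<Longrightarrow> poly_bounded B \<Longrightarrow> poly_bounded (\<lambda>x. A x + B x)"
  unfolding poly_bounded_def by (metis add_le_mono poly_add)

lemma poly_bounded_mult [pb]:
  "poly_bounded A \<Longrightarrow> poly_bounded B \<Longrightarrow> poly_bounded (\<lambda>x. A x * B x)"
  unfolding poly_bounded_def by (metis mult_le_mono poly_mult)

lemma poly_bounded_Suc [pb]: "poly_bounded A \<Longrightarrow> poly_bounded (\<lambda>x. Suc (A x))"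
  using poly_bounded_add[OF _ poly_bounded_const[of 1]] by simp

lemma poly_bounded_poly [pb]: "poly_bounded B \<Longrightarrow> poly_bounded (\<lambda>x. poly q (B x))"
  unfolding poly_bounded_def by (metis poly_nat_mono poly_pcompose)

lemma poly_bounded_power [pb]: "poly_bounded B \<Longrightarrow> poly_bounded (\<lambda>x. B x ^ k)"
  by (induction k) (auto intro: pb)

lemma poly_bounded_comp:
  assumes "poly_bounded B" and "poly_bounded (\<lambda>x. vsize (g x))"
  shows "poly_bounded (\<lambda>x. B (g x))"
proof -
  obtain q where "\<And>x. B x \<le> poly q (vsize x)" using assms(1) by (auto simp: poly_bounded_def)
  then show ?thesis by (intro poly_boundedI_le[OF poly_bounded_poly[OF assms(2)]])
qed

section \<open>Functions computable in polynomial time\<close>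

text \<open>The initial contents of all variables other than 0 are arbitrary, so that programs can be
  run one after the other.\<close>

definition runs :: "(val \<Rightarrow> val) set \<Rightarrow> val set \<Rightarrow> com \<Rightarrow> (val \<Rightarrow> nat) \<Rightarrow> (val \<Rightarrow> val) \<Rightarrow> bool" where
  "runs Or Qs c T g \<longleftrightarrow> (\<forall>f\<in>Or. \<forall>s. \<exists>t qs s'. exec f c s t qs s' \<and> s' 0 = g (s 0) \<and>
     t \<le> T (s 0) \<and> set qs \<subseteq> Qs)"

text \<open>One \<open>g\<close> serves all oracles in \<open>Or\<close>, so only answers that the
  problem determines uniquely can enter the class. The bound holds on every tree, so constructions
  must also behave on malformed input.\<close>

definition fp :: "(val \<Rightarrow> val) set \<Rightarrow> val set \<Rightarrow> (val \<Rightarrow> val) \<Rightarrow> bool" where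
  "fp Or Qs g \<longleftrightarrow> (\<exists>c T. poly_bounded T \<and> runs Or Qs c T g)"

lemma runsE:
  assumes "runs Or Qs c T g" and "f \<in> Or"
  obtains t qs s' where "exec f c s t qs s'" "s' 0 = g (s 0)" "t \<le> T (s 0)" "set qs \<subseteq> Qs"
  using assms unfolding runs_def by meson

text \<open>Only variables 0, 1 and 2 are tracked: the combinators below keep nothing else across
  the run of a subprogram.\<close>

lemma runs_shiftE:
  assumes "runs Or Qs c T g" and "f \<in> Or"
  obtains t qs s' where "exec f (shift k c) s t qs s'" "s' k = g (s k)" "k > 0 \<Longrightarrow> s' 0 = s 0"
    "k > 1 \<Longrightarrow> s' 1 = s 1" "k > 2 \<Longrightarrow> s' 2 = s 2" "t \<le> T (s k)" "set qs \<subseteq> Qs"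
proof -
  define s2 where "s2 = (\<lambda>v. s (v + k))"
  have s: "merge_state k s s2 = s" by (auto simp: merge_state_def s2_def fun_eq_iff)
  obtain t qs s' where *: "exec f c s2 t qs s'" "s' 0 = g (s2 0)" "t \<le> T (s2 0)" "set qs \<subseteq> Qs"
    using runsE[OF assms] .
  show ?thesis
  proof (rule that)
    show "exec f (shift k c) s t qs (merge_state k s s')"
      using exec_shift[OF *(1), of k s] by (simp add: s)
  qed (use * in \<open>auto simp: merge_state_def s2_def\<close>)
qed

lemma runs_witness:
  "exec f c s t qs s' \<Longrightarrow> s' v = y \<Longrightarrow> t \<le> n \<Longrightarrow> set qs \<subseteq> Qs \<Longrightarrow>
   \<exists>t qs s'. exec f c s t qs s' \<and> s' v = y \<and> t \<le> n \<and> set qs \<subseteq> Qs"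
  by blast

lemma fpI: "poly_bounded T \<Longrightarrow> runs Or Qs c T g \<Longrightarrow> fp Or Qs g"
  unfolding fp_def by blast

lemma fp_poly_bounded:
  assumes "fp Or Qs g" and "Or \<noteq> {}"
  shows "poly_bounded (\<lambda>x. vsize (g x))"
proof -
  obtain c T where T: "poly_bounded T" and c: "runs Or Qs c T g" using assms by (auto simp: fp_def)
  obtain f where f: "f \<in> Or" using assms by auto
  have "vsize (g x) \<le> vsize x + T x" for x
  proof -
    obtain t qs s' where "exec f c (\<lambda>_. x) t qs s'" "s' 0 = g x" "t \<le> T x"
      by (rule runsE[OF c f, of "\<lambda>_. x"]) (erule that; simp)
    then show ?thesis using exec_output_size[of f c "\<lambda>_. x" t qs s' 0] by auto
  qed
  then show ?thesis
    by (rule poly_boundedI_le[rotated, of "\<lambda>x. vsize (g x)" "\<lambda>x. vsize x + T x"]) (intro pb T)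
qed

text \<open>Output bounds are read off from an actual run and so need some oracle in
  \<open>Or\<close>. For empty \<open>Or\<close> everything is vacuous; the closure proofs split
  this case off.\<close>

lemma fp_empty: "fp {} Qs g"
  by (rule fpI[of "\<lambda>_. 0" _ _ Skip]) (auto simp: runs_def intro: pb)

named_theorems fps

lemma fp_id [fps]: "fp Or Qs (\<lambda>x. x)"
proof (rule fpI)
  show "runs Or Qs Skip (\<lambda>_. 1) (\<lambda>x. x)"
    unfolding runs_def by (metis (no_types) exec.Skip empty_subsetI le_refl list.set(1))
qed (rule pb)

lemma fp_exp:
  assumes "\<And>s. aval e s = g (s 0)" and "\<And>s. acost e s \<le> T (s 0)" and "poly_bounded T"
  shows "fp Or Qs g"
proof (rule fpI)
  show "runs Or Qs (Assign 0 e) (\<lambda>x. T x + 1) g"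
    unfolding runs_def
  proof (intro ballI allI exI conjI)
    fix f s
    show "exec f (Assign 0 e) s (acost e s + 1) [] (s(0 := aval e s))" by (rule exec.Assign)
  qed (use assms in auto)
  show "poly_bounded (\<lambda>x. T x + 1)" using assms(3) by (intro pb)
qed

lemma fp_const [fps]: "fp Or Qs (\<lambda>x. c)"
proof -
  have "\<exists>e. (\<forall>s. aval e s = c \<and> acost e s \<le> vsize c)"
  proof (induction c)
    case Leaf show ?case by (rule exI[of _ ELeaf]) auto
  next
    case (Node c1 c2)
    then obtain e1 e2 where "\<forall>s. aval e1 s = c1 \<and> acost e1 s \<le> vsize c1"
      "\<forall>s. aval e2 s = c2 \<and> acost e2 s \<le> vsize c2" by auto
    then show ?case by (intro exI[of _ "ENode e1 e2"]) (auto intro: add_le_mono)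
  qed
  then obtain e where "\<And>s. aval e s = c" "\<And>s. acost e s \<le> vsize c" by auto
  then show ?thesis by (intro fp_exp[of e _ "\<lambda>_. vsize c"] pb) auto
qed

lemma fp_comp:
  assumes "fp Or Qs g" and "fp Or Qs h"
  shows "fp Or Qs (\<lambda>x. h (g x))"
proof (cases "Or = {}")
  case False
  obtain c1 T1 c2 T2 where T: "poly_bounded T1" "poly_bounded T2"
    and c: "runs Or Qs c1 T1 g" "runs Or Qs c2 T2 h"
    using assms by (auto simp: fp_def)
  show ?thesis
  proof (rule fpI)
    show "poly_bounded (\<lambda>x. T1 x + T2 (g x) + 1)"
      by (intro pb T poly_bounded_comp[OF T(2)] fp_poly_bounded[OF assms(1) False])
    show "runs Or Qs (Seq c1 c2) (\<lambda>x. T1 x + T2 (g x) + 1) (\<lambda>x. h (g x))"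
      unfolding runs_def
    proof (intro ballI allI)
      fix f s assume f: "f \<in> Or"
      obtain t1 qs1 s1 where 1: "exec f c1 s t1 qs1 s1" "s1 0 = g (s 0)" "t1 \<le> T1 (s 0)"
        "set qs1 \<subseteq> Qs" using runsE[OF c(1) f] .
      obtain t2 qs2 s2 where 2: "exec f c2 s1 t2 qs2 s2" "s2 0 = h (s1 0)" "t2 \<le> T2 (s1 0)"
        "set qs2 \<subseteq> Qs" using runsE[OF c(2) f] .
      show "\<exists>t qs s'. exec f (Seq c1 c2) s t qs s' \<and> s' 0 = h (g (s 0)) \<and>
          t \<le> T1 (s 0) + T2 (g (s 0)) + 1 \<and> set qs \<subseteq> Qs"
        by (rule runs_witness[OF exec.Seq[OF 1(1) 2(1)]]) (use 1 2 in auto)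
    qed
  qed
qed (simp add: fp_empty)

lemma fp_left [fps]: "fp Or Qs g \<Longrightarrow> fp Or Qs (\<lambda>x. left (g x))"
  by (rule fp_comp[of _ _ g left], assumption,
      rule fp_exp[of "ELeft (EVar 0)" _ "\<lambda>x. vsize x + 1"]) (auto intro!: pb)

lemma fp_right [fps]: "fp Or Qs g \<Longrightarrow> fp Or Qs (\<lambda>x. right (g x))"
  by (rule fp_comp[of _ _ g right], assumption,
      rule fp_exp[of "ERight (EVar 0)" _ "\<lambda>x. vsize x + 1"]) (auto intro!: pb)

lemma fp_Node [fps]:
  assumes "fp Or Qs g" and "fp Or Qs h"
  shows "fp Or Qs (\<lambda>x. Node (g x) (h x))"
proof (cases "Or = {}")
  case False
  obtain c1 T1 c2 T2 where T: "poly_bounded T1" "poly_bounded T2"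
    and c: "runs Or Qs c1 T1 g" "runs Or Qs c2 T2 h"
    using assms by (auto simp: fp_def)
  let ?c = "Seq (Seq (Assign 1 (EVar 0)) (shift 1 c1)) (Seq (Seq (Assign 2 (EVar 0)) (shift 2 c2))
       (Assign 0 (ENode (EVar 1) (EVar 2))))"
  let ?T = "\<lambda>x. 2 * vsize x + T1 x + T2 x + vsize (g x) + vsize (h x) + 8"
  show ?thesis
  proof (rule fpI)
    show "poly_bounded ?T"
      by (intro pb T fp_poly_bounded[OF assms(1) False] fp_poly_bounded[OF assms(2) False])
    show "runs Or Qs ?c ?T (\<lambda>x. Node (g x) (h x))"
      unfolding runs_def
    proof (intro ballI allI)
      fix f s assume f: "f \<in> Or"
      obtain t1 qs1 s1 where 1: "exec f (shift 1 c1) (s(1 := s 0)) t1 qs1 s1" "s1 1 = g (s 0)"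
        "s1 0 = s 0" "t1 \<le> T1 (s 0)" "set qs1 \<subseteq> Qs"
        by (rule runs_shiftE[OF c(1) f, of 1 "s(1 := s 0)"]) (erule that; simp)
      obtain t2 qs2 s2 where 2: "exec f (shift 2 c2) (s1(2 := s1 0)) t2 qs2 s2" "s2 2 = h (s 0)"
        "s2 1 = g (s 0)" "t2 \<le> T2 (s 0)" "set qs2 \<subseteq> Qs"
        by (rule runs_shiftE[OF c(2) f, of 2 "s1(2 := s1 0)"]) (erule that; use 1 in simp)
      have a: "exec f (Assign 1 (EVar 0)) s (vsize (s 0) + 1) [] (s(1 := s 0))"
        using exec.Assign[of f 1 "EVar 0" s] by simp
      have b: "exec f (Assign 2 (EVar 0)) s1 (vsize (s 0) + 1) [] (s1(2 := s1 0))"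
        using exec.Assign[of f 2 "EVar 0" s1] 1 by simp
      note e = exec.Seq[OF exec.Seq[OF a 1(1)] exec.Seq[OF exec.Seq[OF b 2(1)]
          exec.Assign[of f 0 "ENode (EVar 1) (EVar 2)" s2]]]
      show "\<exists>t qs s'. exec f ?c s t qs s' \<and> s' 0 = Node (g (s 0)) (h (s 0)) \<and>
          t \<le> ?T (s 0) \<and> set qs \<subseteq> Qs"
        by (rule runs_witness[OF e]) (use 1 2 in auto)
    qed
  qed
qed (simp add: fp_empty)

lemma fp_eq [fps]:
  assumes "fp Or Qs g" and "fp Or Qs h"
  shows "fp Or Qs (\<lambda>x. enc_bool (g x = h x))"
proof -
  have "fp Or Qs (\<lambda>z. enc_bool (left z = right z))"
    by (rule fp_exp[of "EEq (ELeft (EVar 0)) (ERight (EVar 0))" _ "\<lambda>x. 2 * vsize x + 3"])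
      (auto intro!: pb)
  from fp_comp[OF fp_Node[OF assms] this] show ?thesis by simp
qed

lemma enc_bool_Leaf [simp]: "enc_bool b = Leaf \<longleftrightarrow> \<not> b"
  by (cases b) auto

lemma fp_if [fps]:
  assumes "fp Or Qs (\<lambda>x. enc_bool (b x))" and "fp Or Qs g" and "fp Or Qs h"
  shows "fp Or Qs (\<lambda>x. if b x then g x else h x)"
proof (cases "Or = {}")
  case False
  obtain c0 T0 c1 T1 c2 T2 where T: "poly_bounded T0" "poly_bounded T1" "poly_bounded T2"
    and c: "runs Or Qs c0 T0 (\<lambda>x. enc_bool (b x))" "runs Or Qs c1 T1 g" "runs Or Qs c2 T2 h"
    using assms unfolding fp_def by (elim exE conjE) (rule that)
  let ?c = "Seq (Seq (Assign 1 (EVar 0)) (shift 1 c0)) (If (EVar 1) c1 c2)"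
  let ?T = "\<lambda>x. vsize x + T0 x + T1 x + T2 x + 8"
  show ?thesis
  proof (rule fpI)
    show "poly_bounded ?T" by (intro pb T)
    show "runs Or Qs ?c ?T (\<lambda>x. if b x then g x else h x)"
      unfolding runs_def
    proof (intro ballI allI)
      fix f s assume f: "f \<in> Or"
      obtain t0 qs0 s1 where 1: "exec f (shift 1 c0) (s(1 := s 0)) t0 qs0 s1"
        "s1 1 = enc_bool (b (s 0))" "s1 0 = s 0" "t0 \<le> T0 (s 0)" "set qs0 \<subseteq> Qs"
        by (rule runs_shiftE[OF c(1) f, of 1 "s(1 := s 0)"]) (erule that; simp)
      have a: "exec f (Assign 1 (EVar 0)) s (vsize (s 0) + 1) [] (s(1 := s 0))"
        using exec.Assign[of f 1 "EVar 0" s] by simp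
      have sz: "vsize (enc_bool v) \<le> 3" for v by (cases v) auto
      show "\<exists>t qs s'. exec f ?c s t qs s' \<and> s' 0 = (if b (s 0) then g (s 0) else h (s 0)) \<and>
          t \<le> ?T (s 0) \<and> set qs \<subseteq> Qs"
      proof (cases "b (s 0)")
        case True
        obtain t qs s' where 2: "exec f c1 s1 t qs s'" "s' 0 = g (s1 0)" "t \<le> T1 (s1 0)"
          "set qs \<subseteq> Qs" using runsE[OF c(2) f] .
        have i: "exec f (If (EVar 1) c1 c2) s1 (acost (EVar 1) s1 + t + 1) qs s'"
          by (rule exec.IfTrue[OF _ 2(1)]) (use 1 True in auto)
        show ?thesis by (rule runs_witness[OF exec.Seq[OF exec.Seq[OF a 1(1)] i]]) (use 1 2 True sz[of True] in auto)
      next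
        case False
        obtain t qs s' where 2: "exec f c2 s1 t qs s'" "s' 0 = h (s1 0)" "t \<le> T2 (s1 0)"
          "set qs \<subseteq> Qs" using runsE[OF c(3) f] .
        have i: "exec f (If (EVar 1) c1 c2) s1 (acost (EVar 1) s1 + t + 1) qs s'"
          by (rule exec.IfFalse[OF _ 2(1)]) (use 1 False in auto)
        show ?thesis by (rule runs_witness[OF exec.Seq[OF exec.Seq[OF a 1(1)] i]]) (use 1 2 False sz[of False] in auto)
      qed
    qed
  qed
qed (simp add: fp_empty)

text \<open>The test \<open>v\<close> keeps every query inside \<open>Qs\<close>, even on arguments
  that no intended computation produces; \<open>m\<close> is the answer common to all
  oracles.\<close>

lemma fp_query:
  assumes "fp Or Qs (\<lambda>x. enc_bool (v x))" and "\<And>x. v x \<Longrightarrow> x \<in> Qs"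
    and "\<And>f x. f \<in> Or \<Longrightarrow> v x \<Longrightarrow> f x = m x" and "poly_bounded (\<lambda>x. vsize (m x))"
  shows "fp Or Qs (\<lambda>x. if v x then m x else Leaf)"
proof -
  obtain c0 T0 where T: "poly_bounded T0" and c: "runs Or Qs c0 T0 (\<lambda>x. enc_bool (v x))"
    using assms(1) unfolding fp_def by (elim exE conjE) (rule that)
  let ?c = "Seq (Seq (Assign 1 (EVar 0)) (shift 1 c0))
     (If (EVar 1) (Query 0 (EVar 0)) (Assign 0 ELeaf))"
  let ?T = "\<lambda>x. 2 * vsize x + T0 x + vsize (m x) + 9"
  show ?thesis
  proof (rule fpI)
    show "poly_bounded ?T" by (intro pb T assms(4))
    show "runs Or Qs ?c ?T (\<lambda>x. if v x then m x else Leaf)"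
      unfolding runs_def
    proof (intro ballI allI)
      fix f s assume f: "f \<in> Or"
      obtain t0 qs0 s1 where 1: "exec f (shift 1 c0) (s(1 := s 0)) t0 qs0 s1"
        "s1 1 = enc_bool (v (s 0))" "s1 0 = s 0" "t0 \<le> T0 (s 0)" "set qs0 \<subseteq> Qs"
        by (rule runs_shiftE[OF c(1) f, of 1 "s(1 := s 0)"]) (erule that; simp)
      have a: "exec f (Assign 1 (EVar 0)) s (vsize (s 0) + 1) [] (s(1 := s 0))"
        using exec.Assign[of f 1 "EVar 0" s] by simp
      show "\<exists>t qs s'. exec f ?c s t qs s' \<and> s' 0 = (if v (s 0) then m (s 0) else Leaf) \<and>
          t \<le> ?T (s 0) \<and> set qs \<subseteq> Qs"
      proof (cases "v (s 0)")
        case True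
        have i: "exec f (If (EVar 1) (Query 0 (EVar 0)) (Assign 0 ELeaf)) s1
            (acost (EVar 1) s1 + (vsize (s 0) + vsize (m (s 0)) + 1) + 1) [s 0] (s1(0 := m (s 0)))"
          using exec.Query[of f 0 "EVar 0" s1] assms(3)[OF f True] 1 True
          by (intro exec.IfTrue) auto
        show ?thesis by (rule runs_witness[OF exec.Seq[OF exec.Seq[OF a 1(1)] i]]) (use 1 True assms(2)[OF True] in auto)
      next
        case False
        have i: "exec f (If (EVar 1) (Query 0 (EVar 0)) (Assign 0 ELeaf)) s1
            (acost (EVar 1) s1 + (acost ELeaf s1 + 1) + 1) [] (s1(0 := Leaf))"
          using exec.Assign[of f 0 ELeaf s1] 1 False by (intro exec.IfFalse) auto
        show ?thesis by (rule runs_witness[OF exec.Seq[OF exec.Seq[OF a 1(1)] i]]) (use 1 False in auto)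
      qed
    qed
  qed
qed

section \<open>Lists, searches and unary indices on trees\<close>

fun dec_list :: "val \<Rightarrow> val list" where
  "dec_list Leaf = []"
| "dec_list (Node a b) = a # dec_list b"

lemma dec_enc_list [simp]: "dec_list (enc_list xs) = xs"
  by (induction xs) auto

text \<open>Every tree is the list of left children along its right spine, so there are no malformed
  lists and \<open>dec_list\<close> needs no guard.\<close>

lemma enc_dec_list [simp]: "enc_list (dec_list v) = v"
  by (induction v) auto

lemma vsize_in_dec_list: "e \<in> set (dec_list v) \<Longrightarrow> vsize e < vsize v"
  by (induction v) auto

lemma length_dec_list: "length (dec_list v) < vsize v"
proof (induction v)
  case (Node a b) then show ?case using vsize_pos[of a] by auto
qed simp

text \<open>The loop keeps the input in variable 0, the accumulator in 1 and the remaining list in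
  2; the body runs from variable 3 on. The bound \<open>B\<close> on all intermediate accumulators
  is essential, since polynomial steps alone may compose to exponential growth.\<close>

lemma fp_foldl:
  assumes i: "fp Or Qs i" and l: "fp Or Qs l"
    and h: "fp Or Qs (\<lambda>z. h (left z) (left (right z)) (right (right z)))"
    and B: "poly_bounded B"
      "\<And>x k. vsize (foldl (\<lambda>a e. h a e x) (i x) (take k (dec_list (l x)))) \<le> B x"
  shows "fp Or Qs (\<lambda>x. foldl (\<lambda>a e. h a e x) (i x) (dec_list (l x)))"
proof (cases "Or = {}")
  case False
  obtain c0 T0 c1 T1 c2 T2 where T: "poly_bounded T0" "poly_bounded T1" "poly_bounded T2"
    and c: "runs Or Qs c0 T0 i" "runs Or Qs c1 T1 l"
      "runs Or Qs c2 T2 (\<lambda>z. h (left z) (left (right z)) (right (right z)))"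
    using i l h unfolding fp_def by (elim exE conjE) (rule that)
  obtain q where q: "\<And>x. T2 x \<le> poly q (vsize x)" using T(3) by (auto simp: poly_bounded_def)
  let ?b = "Seq (Seq (Assign 3 (ENode (EVar 1) (ENode (ELeft (EVar 2)) (EVar 0)))) (shift 3 c2))
      (Seq (Assign 1 (EVar 3)) (Assign 2 (ERight (EVar 2))))"
  let ?c = "Seq (Seq (Seq (Assign 1 (EVar 0)) (shift 1 c0)) (Seq (Assign 2 (EVar 0)) (shift 2 c1)))
     (Seq (While (EVar 2) ?b) (Assign 0 (EVar 1)))"
  \<comment> \<open>The cost of one round. The polynomial is taken at the largest possible argument
    of the body, so the same bound serves in every round.\<close>
  let ?I = "\<lambda>x. 3 * vsize (l x) + 2 * B x + vsize x + poly q (B x + vsize (l x) + vsize x + 2) + 13"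
  let ?T = "\<lambda>x. 2 * vsize x + T0 x + T1 x + ?I x * vsize (l x) + vsize (l x) + B x + 12"
  have loop: "\<exists>t qs s'. exec f (While (EVar 2) ?b) s t qs s' \<and>
      s' 1 = foldl (\<lambda>a e. h a e x) (s 1) (dec_list (s 2)) \<and>
      t \<le> ?I x * length (dec_list (s 2)) + 2 \<and> set qs \<subseteq> Qs"
    if f: "f \<in> Or" and "s 0 = x" "vsize (s 2) \<le> vsize (l x)"
      "\<And>k. vsize (foldl (\<lambda>a e. h a e x) (s 1) (take k (dec_list (s 2)))) \<le> B x" for f s x
    using that(2-)
  proof (induction "s 2" arbitrary: s)
    case Leaf
    have "exec f (While (EVar 2) ?b) s (acost (EVar 2) s + 1) [] s"
      using Leaf by (intro exec.WhileFalse) auto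
    then show ?case by (rule runs_witness) (use Leaf(1)[symmetric] in auto)
  next
    case (Node e es)
    note s2 = Node(3)[symmetric]
    let ?z = "Node (s 1) (Node e x)"
    obtain t qs s1 where 1: "exec f (shift 3 c2) (s(3 := ?z)) t qs s1" "s1 3 = h (s 1) e x"
        "s1 0 = s 0" "s1 2 = s 2" "t \<le> T2 ?z" "set qs \<subseteq> Qs"
      by (rule runs_shiftE[OF c(3) f, of 3 "s(3 := ?z)"]) (erule that; simp)
    have a: "exec f (Assign 3 (ENode (EVar 1) (ENode (ELeft (EVar 2)) (EVar 0)))) s
        (acost (ENode (EVar 1) (ENode (ELeft (EVar 2)) (EVar 0))) s + 1) [] (s(3 := ?z))"
      using exec.Assign[of f 3 "ENode (EVar 1) (ENode (ELeft (EVar 2)) (EVar 0))" s] Node(4) s2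
      by simp
    have b: "exec f (Assign 1 (EVar 3)) s1 (vsize (h (s 1) e x) + 1) [] (s1(1 := h (s 1) e x))"
      using exec.Assign[of f 1 "EVar 3" s1] 1 by simp
    let ?s = "s1(1 := h (s 1) e x, 2 := es)"
    have c: "exec f (Assign 2 (ERight (EVar 2))) (s1(1 := h (s 1) e x)) (vsize (s 2) + 2) [] ?s"
      using exec.Assign[of f 2 "ERight (EVar 2)" "s1(1 := h (s 1) e x)"] 1 s2 by simp
    note body = exec.Seq[OF exec.Seq[OF a 1(1)] exec.Seq[OF b c]]
    have "\<exists>t qs s'. exec f (While (EVar 2) ?b) ?s t qs s' \<and>
      s' 1 = foldl (\<lambda>a e. h a e x) (?s 1) (dec_list (?s 2)) \<and>
      t \<le> ?I x * length (dec_list (?s 2)) + 2 \<and> set qs \<subseteq> Qs"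
    proof (rule Node.hyps(2))
      fix k show "vsize (foldl (\<lambda>a e. h a e x) (?s 1) (take k (dec_list (?s 2)))) \<le> B x"
        using Node(6)[of "Suc k"] s2 by simp
    qed (use Node 1 s2 in auto)
    then obtain t' qs' s' where 2: "exec f (While (EVar 2) ?b) ?s t' qs' s'"
      "s' 1 = foldl (\<lambda>a e. h a e x) (h (s 1) e x) (dec_list es)"
      "t' \<le> ?I x * length (dec_list es) + 2" "set qs' \<subseteq> Qs" by auto
    have ne: "aval (EVar 2) s \<noteq> Leaf" using s2 by simp
    have b1: "vsize (s 1) \<le> B x" using Node(6)[of 0] by simp
    have b2: "vsize (h (s 1) e x) \<le> B x" using Node(6)[of 1] s2 by simp
    have "T2 ?z \<le> poly q (vsize ?z)" by (rule q)
    also have "\<dots> \<le> poly q (B x + vsize (l x) + vsize x + 2)"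
      using b1 Node(5) s2 by (intro poly_nat_mono) simp
    finally have t: "t \<le> poly q (B x + vsize (l x) + vsize x + 2)" using 1 by simp
    have "?I x * length (dec_list (s 2)) = ?I x + ?I x * length (dec_list es)" using s2 by simp
    then show ?case
      by (intro runs_witness[OF exec.WhileTrue[OF ne body 2(1)]]) (use 1 2 s2 t b1 b2 Node(4,5) in auto)
  qed
  show ?thesis
  proof (rule fpI)
    show "poly_bounded ?T"
      by (intro pb T B fp_poly_bounded[OF l False])
    show "runs Or Qs ?c ?T (\<lambda>x. foldl (\<lambda>a e. h a e x) (i x) (dec_list (l x)))"
      unfolding runs_def
    proof (intro ballI allI)
      fix f s assume f: "f \<in> Or"
      obtain t1 qs1 s1 where 1: "exec f (shift 1 c0) (s(1 := s 0)) t1 qs1 s1" "s1 1 = i (s 0)"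
        "s1 0 = s 0" "t1 \<le> T0 (s 0)" "set qs1 \<subseteq> Qs"
        by (rule runs_shiftE[OF c(1) f, of 1 "s(1 := s 0)"]) (erule that; simp)
      obtain t2 qs2 s2 where 2: "exec f (shift 2 c1) (s1(2 := s1 0)) t2 qs2 s2" "s2 2 = l (s 0)"
        "s2 1 = i (s 0)" "s2 0 = s 0" "t2 \<le> T1 (s 0)" "set qs2 \<subseteq> Qs"
        by (rule runs_shiftE[OF c(2) f, of 2 "s1(2 := s1 0)"]) (erule that; use 1 in simp)
      have a: "exec f (Assign 1 (EVar 0)) s (vsize (s 0) + 1) [] (s(1 := s 0))"
        using exec.Assign[of f 1 "EVar 0" s] by simp
      have b: "exec f (Assign 2 (EVar 0)) s1 (vsize (s 0) + 1) [] (s1(2 := s1 0))"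
        using exec.Assign[of f 2 "EVar 0" s1] 1 by simp
      obtain t3 qs3 s3 where 3: "exec f (While (EVar 2) ?b) s2 t3 qs3 s3"
          "s3 1 = foldl (\<lambda>a e. h a e (s 0)) (i (s 0)) (dec_list (l (s 0)))"
          "t3 \<le> ?I (s 0) * length (dec_list (l (s 0))) + 2" "set qs3 \<subseteq> Qs"
        using loop[OF f, of s2 "s 0"] 2 B(2)[of "s 0"] by auto
      have d: "exec f (Assign 0 (EVar 1)) s3 (vsize (s3 1) + 1) [] (s3(0 := s3 1))"
        using exec.Assign[of f 0 "EVar 1" s3] by simp
      have "vsize (s3 1) \<le> B (s 0)"
        using B(2)[of "s 0" "length (dec_list (l (s 0)))"] 3 by simp
      moreover have "?I (s 0) * length (dec_list (l (s 0))) \<le> ?I (s 0) * vsize (l (s 0))"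
        using length_dec_list[of "l (s 0)"] by (intro mult_le_mono) auto
      ultimately have "vsize (s 0) + 1 + t1 + 1 + (vsize (s 0) + 1 + t2 + 1) + 1 +
          (t3 + (vsize (s3 1) + 1) + 1) + 1 \<le> ?T (s 0)"
        using 1 2 3 by linarith
      then show "\<exists>t qs s'. exec f ?c s t qs s' \<and>
          s' 0 = foldl (\<lambda>a e. h a e (s 0)) (i (s 0)) (dec_list (l (s 0))) \<and>
          t \<le> ?T (s 0) \<and> set qs \<subseteq> Qs"
        by (intro runs_witness[OF exec.Seq[OF exec.Seq[OF exec.Seq[OF a 1(1)] exec.Seq[OF b 2(1)]]
            exec.Seq[OF 3(1) d]]]) (use 1 2 3 in auto)
    qed
  qed
qed (simp add: fp_empty)

text \<open>If each round adds at most \<open>B x\<close>, whatever the accumulator, the total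
  growth is at most the number of rounds times \<open>B x\<close>. Growth by a constant factor per
  round would not be enough.\<close>

lemma fp_foldl_additive:
  assumes "fp Or Qs i" and "fp Or Qs l"
    and "fp Or Qs (\<lambda>z. h (left z) (left (right z)) (right (right z)))"
    and "poly_bounded B"
    and "\<And>x a e. e \<in> set (dec_list (l x)) \<Longrightarrow> vsize (h a e x) \<le> vsize a + B x"
  shows "fp Or Qs (\<lambda>x. foldl (\<lambda>a e. h a e x) (i x) (dec_list (l x)))"
proof (cases "Or = {}")
  case False
  have *: "vsize (foldl (\<lambda>a e. h a e x) a es) \<le> vsize a + length es * B x"
    if "set es \<subseteq> set (dec_list (l x))" for x a es
    using that
  proof (induction es arbitrary: a)
    case (Cons e es)
    then have "vsize (foldl (\<lambda>a e. h a e x) (h a e x) es) \<le> vsize (h a e x) + length es * B x"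
      "vsize (h a e x) \<le> vsize a + B x" using assms(5)[of e x a] by auto
    then show ?case by simp
  qed simp
  show ?thesis
  proof (rule fp_foldl[OF assms(1-3)])
    show "poly_bounded (\<lambda>x. vsize (i x) + vsize (l x) * B x)"
      by (intro pb assms fp_poly_bounded[OF assms(1) False] fp_poly_bounded[OF assms(2) False])
    show "vsize (foldl (\<lambda>a e. h a e x) (i x) (take k (dec_list (l x))))
        \<le> vsize (i x) + vsize (l x) * B x" for x k
    proof -
      have "vsize (foldl (\<lambda>a e. h a e x) (i x) (take k (dec_list (l x))))
        \<le> vsize (i x) + length (take k (dec_list (l x))) * B x"
        by (rule *) (rule set_take_subset)
      also have "length (take k (dec_list (l x))) * B x \<le> vsize (l x) * B x"
        using length_dec_list[of "l x"] by (intro mult_le_mono) auto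
      finally show ?thesis by simp
    qed
  qed
qed (simp add: fp_empty)

lemma fp_foldl_list:
  assumes "fp Or Qs i" and "fp Or Qs (\<lambda>x. enc_list (l x))"
    and "fp Or Qs (\<lambda>z. h (left z) (left (right z)) (right (right z)))"
    and "poly_bounded B"
    and "\<And>x a e. e \<in> set (l x) \<Longrightarrow> vsize (h a e x) \<le> vsize a + B x"
  shows "fp Or Qs (\<lambda>x. foldl (\<lambda>a e. h a e x) (i x) (l x))"
  using fp_foldl_additive[OF assms(1-4)] assms(5) by simp

lemma fp_dec_list [fps]: "fp Or Qs g \<Longrightarrow> fp Or Qs (\<lambda>x. enc_list (dec_list (g x)))"
  by simp

lemma fp_Nil [fps]: "fp Or Qs (\<lambda>x. enc_list [])"
  by (rule fp_const)

lemma fp_Cons [fps]: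
  "fp Or Qs g \<Longrightarrow> fp Or Qs (\<lambda>x. enc_list (l x)) \<Longrightarrow> fp Or Qs (\<lambda>x. enc_list (g x # l x))"
  by (simp add: fp_Node)

lemma vsize_enc_list_in: "e \<in> set l \<Longrightarrow> vsize e < vsize (enc_list l)"
  using vsize_in_dec_list[of e "enc_list l"] by simp

lemma vsize_enc_list_append:
  "vsize (enc_list (xs @ ys)) + 1 = vsize (enc_list xs) + vsize (enc_list ys)"
  by (induction xs) auto

lemma vsize_enc_list_le: "(\<And>e. e \<in> set l \<Longrightarrow> vsize e \<le> C) \<Longrightarrow> vsize (enc_list l) \<le> length l * (C + 1) + 1"
proof (induction l)
  case (Cons a l)
  then have "vsize a \<le> C" "vsize (enc_list l) \<le> length l * (C + 1) + 1" by auto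
  then show ?case by simp
qed simp

lemma foldl_Node_enc_list: "foldl (\<lambda>a e. Node e a) a l = enc_list (rev l @ dec_list a)"
  by (induction l arbitrary: a) auto

lemma fp_rev_append:
  assumes "fp Or Qs (\<lambda>x. enc_list (l x))" and "fp Or Qs (\<lambda>x. enc_list (k x))"
  shows "fp Or Qs (\<lambda>x. enc_list (rev (l x) @ k x))"
proof (cases "Or = {}")
  case False
  have "fp Or Qs (\<lambda>x. foldl (\<lambda>a e. Node e a) (enc_list (k x)) (l x))"
    by (rule fp_foldl_list[OF assms(2,1), where B = "\<lambda>x. vsize (enc_list (l x))"])
      (auto intro!: fps fp_poly_bounded[OF assms(1) False] simp: Suc_le_eq vsize_enc_list_in)
  then show ?thesis by (simp add: foldl_Node_enc_list)
qed (simp add: fp_empty)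

lemma fp_rev [fps]: "fp Or Qs (\<lambda>x. enc_list (l x)) \<Longrightarrow> fp Or Qs (\<lambda>x. enc_list (rev (l x)))"
  using fp_rev_append[of Or Qs l "\<lambda>_. []", OF _ fp_Nil] by simp

lemma fp_append [fps]:
  "fp Or Qs (\<lambda>x. enc_list (l x)) \<Longrightarrow> fp Or Qs (\<lambda>x. enc_list (k x)) \<Longrightarrow>
   fp Or Qs (\<lambda>x. enc_list (l x @ k x))"
  using fp_rev_append[of Or Qs "\<lambda>x. rev (l x)" k] fp_rev[of Or Qs l] by simp

lemma foldl_append_enc_list:
  "foldl (\<lambda>a e. enc_list (dec_list a @ h e)) a l = enc_list (dec_list a @ concat (map h l))"
  by (induction l arbitrary: a) auto

text \<open>The body is a function of one tree, with the list element on the left and the whole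
  input on the right. So it can refer to the context, and bodies can be nested.\<close>

lemma fp_concat_map [fps]:
  assumes l: "fp Or Qs (\<lambda>x. enc_list (l x))"
    and h: "fp Or Qs (\<lambda>z. enc_list (h (left z) (right z)))"
  shows "fp Or Qs (\<lambda>x. enc_list (concat (map (\<lambda>e. h e x) (l x))))"
proof (cases "Or = {}")
  case False
  obtain q where q: "\<And>z. vsize (enc_list (h (left z) (right z))) \<le> poly q (vsize z)"
    using fp_poly_bounded[OF h False] by (auto simp: poly_bounded_def)
  have "fp Or Qs (\<lambda>x. foldl (\<lambda>a e. enc_list (dec_list a @ h e x)) Leaf (l x))"
  proof (rule fp_foldl_list[OF fp_const l,
        where B = "\<lambda>x. poly q (vsize (enc_list (l x)) + vsize x + 1)"])
    show "fp Or Qs (\<lambda>z. enc_list (dec_list (left z) @ h (left (right z)) (right (right z))))"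
      by (intro fps fp_comp[OF _ h])
    show "poly_bounded (\<lambda>x. poly q (vsize (enc_list (l x)) + vsize x + 1))"
      by (intro pb fp_poly_bounded[OF l False])
    fix x a e assume e: "e \<in> set (l x)"
    have "vsize (enc_list (h e x)) \<le> poly q (vsize (Node e x))" using q[of "Node e x"] by simp
    also have "\<dots> \<le> poly q (vsize (enc_list (l x)) + vsize x + 1)"
      using vsize_enc_list_in[OF e] by (intro poly_nat_mono) simp
    finally show "vsize (enc_list (dec_list a @ h e x))
        \<le> vsize a + poly q (vsize (enc_list (l x)) + vsize x + 1)"
      using vsize_enc_list_append[of "dec_list a" "h e x"] by simp
  qed
  then show ?thesis by (simp add: foldl_append_enc_list)
qed (simp add: fp_empty)

lemma fp_map [fps]:
  assumes "fp Or Qs (\<lambda>x. enc_list (l x))" and "fp Or Qs (\<lambda>z. h (left z) (right z))"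
  shows "fp Or Qs (\<lambda>x. enc_list (map (\<lambda>e. h e x) (l x)))"
proof -
  have "concat (map (\<lambda>e. [h e x]) ys) = map (\<lambda>e. h e x) ys" for x ys by (induction ys) auto
  then show ?thesis
    using fp_concat_map[OF assms(1), of "\<lambda>e x. [h e x]"] fp_Cons[OF assms(2) fp_Nil] by simp
qed

lemma fp_if_list [fps]:
  assumes "fp Or Qs (\<lambda>x. enc_bool (b x))" and "fp Or Qs (\<lambda>x. enc_list (g x))"
    and "fp Or Qs (\<lambda>x. enc_list (h x))"
  shows "fp Or Qs (\<lambda>x. enc_list (if b x then g x else h x))"
  using fp_if[OF assms] by (simp add: if_distrib)

lemma fp_filter [fps]:
  assumes "fp Or Qs (\<lambda>x. enc_list (l x))" and "fp Or Qs (\<lambda>z. enc_bool (p (left z) (right z)))"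
  shows "fp Or Qs (\<lambda>x. enc_list (filter (\<lambda>e. p e x) (l x)))"
proof -
  have "concat (map (\<lambda>e. if p e x then [e] else []) ys) = filter (\<lambda>e. p e x) ys" for x ys
    by (induction ys) auto
  moreover have "fp Or Qs (\<lambda>x. enc_list (concat (map (\<lambda>e. if p e x then [e] else []) (l x))))"
    by (intro fps assms)
  ultimately show ?thesis by simp
qed

lemma fp_conj [fps]:
  assumes "fp Or Qs (\<lambda>x. enc_bool (p x))" and "fp Or Qs (\<lambda>x. enc_bool (q x))"
  shows "fp Or Qs (\<lambda>x. enc_bool (p x \<and> q x))"
proof -
  have "enc_bool (a \<and> b) = (if a then enc_bool b else Leaf)" for a b by simp
  then show ?thesis using fp_if[OF assms fp_const[of _ _ Leaf]] by simp
qed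

lemma fp_not [fps]:
  assumes "fp Or Qs (\<lambda>x. enc_bool (p x))"
  shows "fp Or Qs (\<lambda>x. enc_bool (\<not> p x))"
  using fp_eq[OF assms fp_const[of _ _ Leaf]] by simp

lemma fp_disj [fps]:
  assumes "fp Or Qs (\<lambda>x. enc_bool (p x))" and "fp Or Qs (\<lambda>x. enc_bool (q x))"
  shows "fp Or Qs (\<lambda>x. enc_bool (p x \<or> q x))"
  using fp_not[OF fp_conj[OF fp_not[OF assms(1)] fp_not[OF assms(2)]]] by simp

lemma fp_list_all [fps]:
  assumes "fp Or Qs (\<lambda>x. enc_list (l x))" and "fp Or Qs (\<lambda>z. enc_bool (p (left z) (right z)))"
  shows "fp Or Qs (\<lambda>x. enc_bool (list_all (\<lambda>e. p e x) (l x)))"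
proof -
  have "(enc_list (filter (\<lambda>e. \<not> p e x) (l x)) = Leaf) = list_all (\<lambda>e. p e x) (l x)" for x
    by (induction "l x") (auto simp: list_all_iff filter_empty_conv enc_list.simps(1)[symmetric]
        simp del: enc_list.simps dest!: arg_cong[of _ _ dec_list])
  moreover have "fp Or Qs (\<lambda>x. enc_bool (enc_list (filter (\<lambda>e. \<not> p e x) (l x)) = Leaf))"
    by (intro fps assms)
  ultimately show ?thesis by simp
qed

definition find_default :: "('b \<Rightarrow> bool) \<Rightarrow> 'b \<Rightarrow> 'b list \<Rightarrow> 'b" where
  "find_default p z l = (case filter p l of [] \<Rightarrow> z | y # _ \<Rightarrow> y)"

lemma find_default_cases:
  "(find_default p z l = z \<and> (\<forall>y\<in>set l. \<not> p y)) \<or> (find_default p z l \<in> set l \<and> p (find_default p z l))"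
proof (cases "filter p l")
  case Nil then show ?thesis by (auto simp: find_default_def filter_empty_conv)
next
  case (Cons y ys)
  then have "y \<in> set (filter p l)" by simp
  then have "y \<in> set l \<and> p y" by (simp only: set_filter mem_Collect_eq)
  then show ?thesis using Cons by (simp add: find_default_def)
qed

lemma fp_find_default [fps]:
  assumes "fp Or Qs (\<lambda>x. enc_list (l x))" and "fp Or Qs (\<lambda>z. enc_bool (p (left z) (right z)))"
    and "fp Or Qs d"
  shows "fp Or Qs (\<lambda>x. find_default (\<lambda>e. p e x) (d x) (l x))"
proof -
  have "find_default (\<lambda>e. p e x) (d x) (l x) =
      (if enc_list (filter (\<lambda>e. p e x) (l x)) = Leaf then d x
       else left (enc_list (filter (\<lambda>e. p e x) (l x))))" for x
    by (auto simp: find_default_def split: list.splits)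
  moreover have "fp Or Qs (\<lambda>x. if enc_list (filter (\<lambda>e. p e x) (l x)) = Leaf then d x
       else left (enc_list (filter (\<lambda>e. p e x) (l x))))"
    by (intro fps assms)
  ultimately show ?thesis by simp
qed

definition vdrop :: "val \<Rightarrow> val \<Rightarrow> val" where
  "vdrop i a = foldl (\<lambda>t _. right t) a (dec_list i)"

definition vnth :: "val \<Rightarrow> val \<Rightarrow> val" where
  "vnth a i = left (vdrop i a)"

lemma dec_enc_nat [simp]: "dec_list (enc_nat i) = replicate i Leaf"
  by (simp add: enc_nat_def)

lemma enc_nat_simps [simp]: "enc_nat 0 = Leaf" "enc_nat (Suc i) = Node Leaf (enc_nat i)"
  by (auto simp: enc_nat_def)

lemma enc_nat_inject [simp]: "enc_nat i = enc_nat j \<longleftrightarrow> i = j"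
  by (metis dec_enc_nat length_replicate)

lemma vsize_enc_nat [simp]: "vsize (enc_nat i) = 2 * i + 1"
  by (induction i) auto

lemma vdrop_enc [simp]: "vdrop (enc_nat i) (enc_list l) = enc_list (drop i l)"
proof -
  have "foldl (\<lambda>t _. right t) (enc_list l) (replicate i Leaf) = enc_list (drop i l)" for l
  proof (induction i arbitrary: l)
    case (Suc i) then show ?case by (cases l) (auto, metis drop_Nil enc_list.simps(1))
  qed simp
  then show ?thesis by (simp add: vdrop_def)
qed

lemma vnth_enc [simp]: "i < length l \<Longrightarrow> vnth (enc_list l) (enc_nat i) = l ! i"
  by (simp add: vnth_def Cons_nth_drop_Suc[symmetric])

lemma fp_vdrop [fps]:
  assumes "fp Or Qs i" and "fp Or Qs a"
  shows "fp Or Qs (\<lambda>x. vdrop (i x) (a x))"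
proof -
  have le: "vsize (right a) \<le> vsize a" for a by (cases a) auto
  show ?thesis unfolding vdrop_def
    by (rule fp_foldl_additive[OF assms(2,1), where B = "\<lambda>_. 0"]) (auto intro!: fps pb le)
qed

lemma fp_vnth [fps]:
  assumes "fp Or Qs a" and "fp Or Qs i"
  shows "fp Or Qs (\<lambda>x. vnth (a x) (i x))"
  unfolding vnth_def by (intro fps assms)

text \<open>The head of the accumulator supplies the next unary number. The head of an arbitrary
  tree is bounded only by that tree, so \<open>fp_foldl_additive\<close> does not apply; the closed
  form of the list gives a quadratic bound instead.\<close>

lemma fp_downto [fps]:
  assumes "fp Or Qs (\<lambda>x. enc_list (l x))"
  shows "fp Or Qs (\<lambda>x. enc_list (map enc_nat (rev [0..<length (l x)])))"
proof (cases "Or = {}")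
  case False
  let ?h = "\<lambda>(a :: val) (e :: val) (x :: val). Node (if a = Leaf then Leaf else Node Leaf (left a)) a"
  have *: "foldl (\<lambda>a e. ?h a e x) Leaf l = enc_list (map enc_nat (rev [0..<length l]))" for x l
  proof (induction l rule: rev_induct)
    case (snoc e l)
    then show ?case by (cases "length l") auto
  qed simp
  have "fp Or Qs (\<lambda>x. foldl (\<lambda>a e. ?h a e x) Leaf (dec_list (enc_list (l x))))"
  proof (rule fp_foldl[OF fp_const assms,
        where B = "\<lambda>x. vsize (enc_list (l x)) * (2 * vsize (enc_list (l x)) + 1 + 1) + 1"])
    show "poly_bounded (\<lambda>x. vsize (enc_list (l x)) * (2 * vsize (enc_list (l x)) + 1 + 1) + 1)"
      by (intro pb fp_poly_bounded[OF assms False])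
    show "vsize (foldl (\<lambda>a e. ?h a e x) Leaf (take k (dec_list (enc_list (l x))))) \<le>
        vsize (enc_list (l x)) * (2 * vsize (enc_list (l x)) + 1 + 1) + 1" for x k
    proof -
      let ?k = "length (take k (l x))"
      have k: "?k \<le> vsize (enc_list (l x))" using length_dec_list[of "enc_list (l x)"] by simp
      have "vsize (foldl (\<lambda>a e. ?h a e x) Leaf (take k (l x))) \<le> ?k * (2 * ?k + 1 + 1) + 1"
        unfolding * by (rule order_trans[OF vsize_enc_list_le[where C = "2 * ?k + 1"]]) auto
      also have "\<dots> \<le> vsize (enc_list (l x)) * (2 * vsize (enc_list (l x)) + 1 + 1) + 1"
        using k by (intro add_mono mult_mono) auto
      finally show ?thesis by simp
    qed
  qed (intro fps)
  then show ?thesis by (simp add: *)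
qed (simp add: fp_empty)

lemma fp_upto [fps]:
  assumes "fp Or Qs (\<lambda>x. enc_list (l x))"
  shows "fp Or Qs (\<lambda>x. enc_list (map enc_nat [0..<length (l x)]))"
  using fp_rev[OF fp_downto[OF assms]] by (simp add: rev_map)

text \<open>A function that is constant off a finite set is a nest of comparisons. The operations of
  the algebras in \<open>K\<close> and membership in finite sets of codes enter the class in this
  way.\<close>

lemma fp_finite_table:
  assumes "finite {z. g z \<noteq> (c :: val)}" and "fp Or Qs h"
  shows "fp Or Qs (\<lambda>x. g (h x))"
proof -
  have "fp Or Qs g" if "finite S" "{z. g z \<noteq> c} \<subseteq> S" for g S
    using that
  proof (induction S arbitrary: g rule: finite_induct)
    case empty
    then have "g = (\<lambda>_. c)" by auto
    then show ?case by (simp add: fp_const)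
  next
    case (insert a S)
    have "fp Or Qs (g(a := c))" by (rule insert.IH) (use insert.prems in auto)
    then have "fp Or Qs (\<lambda>x. if x = a then g a else (g(a := c)) x)" by (intro fps)
    moreover have "(\<lambda>x. if x = a then g a else (g(a := c)) x) = g" by auto
    ultimately show ?case by simp
  qed
  from fp_comp[OF assms(2) this[OF assms(1) subset_refl]] show ?thesis .
qed

lemma fp_mem_finite [fps]:
  assumes "finite S" and "fp Or Qs h"
  shows "fp Or Qs (\<lambda>x. enc_bool (h x \<in> S))"
proof (rule fp_finite_table[OF _ assms(2), where c = Leaf])
  show "finite {z. enc_bool (z \<in> S) \<noteq> Leaf}" using assms(1) by simp
qed

lemma fp_runE:
  assumes "fp Or Qs g"
  obtains c T where "poly_bounded T" "runs Or Qs c T g"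
  using assms unfolding fp_def by blast

lemma poly_time_solvable_if_fp:
  assumes "fp {f. solves f Q} (instances Q) g" and "\<And>x. x \<in> instances S \<Longrightarrow> g x \<in> solutions S x"
  shows "poly_time_reducible S Q"
proof -
  obtain c T where T: "poly_bounded T" and c: "runs {f. solves f Q} (instances Q) c T g"
    using fp_runE[OF assms(1)] .
  obtain q where q: "\<And>x. T x \<le> poly q (vsize x)" using T by (auto simp: poly_bounded_def)
  show ?thesis unfolding poly_time_solvable_with_calls_def
  proof (intro exI[of _ c] exI[of _ q] allI impI ballI)
    fix f x assume f: "solves f Q" and x: "x \<in> instances S"
    obtain t qs s' where "exec f c ((\<lambda>_. Leaf)(0 := x)) t qs s'" "s' 0 = g x" "t \<le> T x"
      "set qs \<subseteq> instances Q"
      by (rule runsE[OF c, of f "(\<lambda>_. Leaf)(0 := x)"]) (use f in simp, erule that, simp_all)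
    then show "\<exists>t qs s'. exec f c ((\<lambda>_. Leaf)(0 := x)) t qs s' \<and> s' 0 \<in> solutions S x \<and>
        t \<le> poly q (vsize x) \<and> set qs \<subseteq> instances Q \<and> length qs \<in> UNIV"
      using assms(2)[OF x] q[of x] by (metis UNIV_I le_trans)
  qed
qed

text \<open>Answers that are not unique do not fit into \<open>fp\<close>. So query-free code, one
  query and query-free code are run in sequence; \<open>size\<close> is needed because the answer is
  charged when received and is part of the input of \<open>post\<close>.\<close>

lemma poly_time_solvable_one_call:
  assumes pre: "fp UNIV {} pre" and post: "fp UNIV {} post"
    and inst: "\<And>x. x \<in> instances S \<Longrightarrow> pre x \<in> instances Q"
    and sol: "\<And>x y. x \<in> instances S \<Longrightarrow> y \<in> solutions Q (pre x) \<Longrightarrow> post (Node x y) \<in> solutions S x"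
    and size: "\<And>x y. x \<in> instances Q \<Longrightarrow> y \<in> solutions Q x \<Longrightarrow> vsize y \<le> poly b (vsize x)"
  shows "poly_time_solvable_with_calls {1} S Q"
proof -
  obtain c1 T1 where T1: "poly_bounded T1" and c1: "runs UNIV {} c1 T1 pre"
    using fp_runE[OF pre] .
  obtain c2 T2 where T2: "poly_bounded T2" and c2: "runs UNIV {} c2 T2 post"
    using fp_runE[OF post] .
  obtain q2 where q2: "\<And>x. T2 x \<le> poly q2 (vsize x)" using T2 by (auto simp: poly_bounded_def)
  let ?c = "Seq (Seq (Seq (Assign 1 (EVar 0)) (shift 1 c1)) (Query 1 (EVar 1)))
     (Seq (Assign 0 (ENode (EVar 0) (EVar 1))) c2)"
  let ?b = "\<lambda>x. poly b (vsize (pre x))"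
  let ?T = "\<lambda>x. 2 * vsize x + T1 x + vsize (pre x) + 2 * ?b x + poly q2 (vsize x + ?b x + 1) + 10"
  have "poly_bounded ?T" by (intro pb T1 fp_poly_bounded[OF pre]) simp_all
  then obtain q where q: "\<And>x. ?T x \<le> poly q (vsize x)" by (auto simp: poly_bounded_def)
  show ?thesis unfolding poly_time_solvable_with_calls_def
  proof (intro exI[of _ ?c] exI[of _ q] allI impI ballI)
    fix f x assume f: "solves f Q" and x: "x \<in> instances S"
    define s where "s = (\<lambda>_ :: nat. Leaf)(0 := x)"
    have s0: "s 0 = x" by (simp add: s_def)
    obtain t1 qs1 s1 where 1: "exec f (shift 1 c1) (s(1 := s 0)) t1 qs1 s1" "s1 1 = pre x"
        "s1 0 = x" "t1 \<le> T1 x" "qs1 = []"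
      by (rule runs_shiftE[OF c1, of f 1 "s(1 := s 0)"]) (simp, erule that, simp_all add: s0)
    have a: "exec f (Assign 1 (EVar 0)) s (vsize x + 1) [] (s(1 := s 0))"
      using exec.Assign[of f 1 "EVar 0" s] by (simp add: s0)
    define y where "y = f (pre x)"
    have y: "y \<in> solutions Q (pre x)" using f inst[OF x] by (auto simp: solves_def y_def)
    have ysz: "vsize y \<le> ?b x" using size[OF inst[OF x] y] .
    have qu: "exec f (Query 1 (EVar 1)) s1 (vsize (pre x) + vsize y + 1) [pre x] (s1(1 := y))"
      using exec.Query[of f 1 "EVar 1" s1] 1 by (simp add: y_def)
    have d: "exec f (Assign 0 (ENode (EVar 0) (EVar 1))) (s1(1 := y)) (vsize x + vsize y + 1 + 1) []
        (s1(1 := y, 0 := Node x y))"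
      using exec.Assign[of f 0 "ENode (EVar 0) (EVar 1)" "s1(1 := y)"] 1 by simp
    obtain t2 qs2 s2 where 2: "exec f c2 (s1(1 := y, 0 := Node x y)) t2 qs2 s2"
        "s2 0 = post (Node x y)" "t2 \<le> T2 (Node x y)" "qs2 = []"
      by (rule runsE[OF c2, of f "s1(1 := y, 0 := Node x y)"]) (simp, erule that, simp_all)
    have "T2 (Node x y) \<le> poly q2 (vsize (Node x y))" by (rule q2)
    also have "\<dots> \<le> poly q2 (vsize x + ?b x + 1)" using ysz by (intro poly_nat_mono) simp
    finally have t2: "t2 \<le> poly q2 (vsize x + ?b x + 1)" using 2 by simp
    note e = exec.Seq[OF exec.Seq[OF exec.Seq[OF a 1(1)] qu] exec.Seq[OF d 2(1)]]
    have "vsize x + 1 + t1 + 1 + (vsize (pre x) + vsize y + 1) + 1 +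
        (vsize x + vsize y + 1 + 1 + t2 + 1) + 1 \<le> ?T x"
      using t2 ysz 1 by linarith
    also note q[of x]
    finally show "\<exists>t qs s'. exec f ?c ((\<lambda>_. Leaf)(0 := x)) t qs s' \<and> s' 0 \<in> solutions S x \<and>
        t \<le> poly q (vsize x) \<and> set qs \<subseteq> instances Q \<and> length qs \<in> {1}"
      using e sol[OF x y] 1(5) 2(2,4) inst[OF x] unfolding s_def
      by (intro exI[of _ "vsize x + 1 + t1 + 1 + (vsize (pre x) + vsize y + 1) + 1 +
        (vsize x + vsize y + 1 + 1 + t2 + 1) + 1"] exI[of _ "[pre x]"] exI[of _ s2]) simp
  qed
qed

section \<open>Subalgebras of products\<close>

lemma interp_prod_nth:
  "i < length As \<Longrightarrow> interp (prod_alg As) f xss ! i = interp (As ! i) f (map (\<lambda>xs. xs ! i) xss)"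
  by (simp add: prod_alg_def)

lemma eval_prod_nth:
  "i < length As \<Longrightarrow> eval (prod_alg As) \<sigma> t ! i = eval (As ! i) (\<lambda>v. \<sigma> v ! i) t"
proof (induction t)
  case (Fn f ts)
  then have "map (\<lambda>xs. xs ! i) (map (eval (prod_alg As) \<sigma>) ts) = map (eval (As ! i) (\<lambda>v. \<sigma> v ! i)) ts"
    by simp
  then show ?case using Fn.prems by (simp only: eval.simps interp_prod_nth)
qed simp

lemma eval_cong_vars: "(\<And>v. v \<in> vars t \<Longrightarrow> \<sigma> v = \<tau> v) \<Longrightarrow> eval A \<sigma> t = eval A \<tau> t"
proof (induction t)
  case (Fn f ts)
  then have "map (eval A \<sigma>) ts = map (eval A \<tau>) ts" by auto
  then show ?case by (simp only: eval.simps)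
qed simp

lemma eval_in_Sg: "wf_term L t \<Longrightarrow> (\<And>v. v \<in> vars t \<Longrightarrow> \<sigma> v \<in> Sg L A X) \<Longrightarrow> eval A \<sigma> t \<in> Sg L A X"
proof (induction t)
  case (Fn f ts)
  have "eval A \<sigma> t \<in> Sg L A X" if "t \<in> set ts" for t
    using Fn.IH[OF that] Fn.prems that by auto
  then show ?case using Fn.prems by (auto intro!: Sg.op)
qed simp

lemma eval_in_univ:
  "is_algebra L A \<Longrightarrow> wf_term L t \<Longrightarrow> (\<And>v. v \<in> vars t \<Longrightarrow> \<sigma> v \<in> univ A) \<Longrightarrow> eval A \<sigma> t \<in> univ A"
proof (induction t)
  case (Fn f ts)
  then have "set (map (eval A \<sigma>) ts) \<subseteq> univ A" by auto
  then show ?case using Fn.prems unfolding is_algebra_def by simp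
qed simp

lemma term_op_in_univ:
  "is_algebra L A \<Longrightarrow> nary_term L k t \<Longrightarrow> length ts = k \<Longrightarrow> set ts \<subseteq> univ A \<Longrightarrow> term_op A t ts \<in> univ A"
  unfolding term_op_def nary_term_def
  by (rule eval_in_univ) (auto intro!: subsetD[OF _ nth_mem])

lemma term_op_in_Sg:
  "nary_term L k t \<Longrightarrow> length ts = k \<Longrightarrow> set ts \<subseteq> Sg L A X \<Longrightarrow> term_op A t ts \<in> Sg L A X"
  unfolding term_op_def nary_term_def
  by (rule eval_in_Sg) (auto intro!: subsetD[OF _ nth_mem])

lemma term_op_prod_nth:
  assumes "nary_term L k t" and "length ts = k" and "i < length As"
  shows "term_op (prod_alg As) t ts ! i = term_op (As ! i) t (map (\<lambda>x. x ! i) ts)"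
  unfolding term_op_def eval_prod_nth[OF assms(3)]
  by (rule eval_cong_vars) (use assms in \<open>auto simp: nary_term_def\<close>)

lemma is_algebra_prod:
  assumes "\<And>A. A \<in> set As \<Longrightarrow> is_algebra L A"
  shows "is_algebra L (prod_alg As)"
proof -
  have "\<exists>a. a \<in> univ (As ! i)" if "i < length As" for i
    using assms[OF nth_mem[OF that]] by (auto simp: is_algebra_def)
  then have "\<exists>a. \<forall>i<length As. a i \<in> univ (As ! i)" by metis
  then obtain a where a: "\<forall>i<length As. a i \<in> univ (As ! i)" ..
  have "map a [0..<length As] \<in> univ (prod_alg As)" using a by (simp add: prod_alg_def)
  then have "univ (prod_alg As) \<noteq> {}" by blast
  moreover have "interp (prod_alg As) f xs \<in> univ (prod_alg As)"
    if "f \<in> syms L" "length xs = arity L f" "set xs \<subseteq> univ (prod_alg As)" for f xs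
  proof -
    have "interp (As ! i) f (map (\<lambda>x. x ! i) xs) \<in> univ (As ! i)" if i: "i < length As" for i
    proof -
      have "set (map (\<lambda>x. x ! i) xs) \<subseteq> univ (As ! i)"
        using \<open>set xs \<subseteq> _\<close> i by (auto simp: prod_alg_def)
      then show ?thesis using assms[OF nth_mem[OF i]] \<open>f \<in> _\<close> \<open>length xs = _\<close>
        by (simp add: is_algebra_def)
    qed
    then show ?thesis by (simp add: prod_alg_def)
  qed
  ultimately show ?thesis by (simp add: is_algebra_def)
qed

lemma Sg_subset_univ: "is_algebra L A \<Longrightarrow> X \<subseteq> univ A \<Longrightarrow> Sg L A X \<subseteq> univ A"
proof
  fix x assume "is_algebra L A" "X \<subseteq> univ A" and "x \<in> Sg L A X"
  from this(3,1,2) show "x \<in> univ A"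
    by (induction rule: Sg.induct) (auto simp: is_algebra_def subset_iff)
qed

text \<open>Indices count from 0, unlike in \<open>proj\<close>. Repetition and reordering are
  allowed; padding and queries both exploit this.\<close>

definition select :: "nat list \<Rightarrow> 'b list \<Rightarrow> 'b list" where
  "select js xs = map (\<lambda>j. xs ! j) js"

lemma length_select [simp]: "length (select js xs) = length js"
  by (simp add: select_def)

lemma select_nth [simp]: "i < length js \<Longrightarrow> select js xs ! i = xs ! (js ! i)"
  by (simp add: select_def)

lemma select_interp:
  assumes "set js \<subseteq> {..<length As}"
  shows "select js (interp (prod_alg As) f xss) =
    interp (prod_alg (select js As)) f (map (select js) xss)"
proof (rule nth_equalityI)
  fix i assume i: "i < length (select js (interp (prod_alg As) f xss))"
  then have "js ! i < length As" using assms by (auto simp: subset_iff)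
  then show "select js (interp (prod_alg As) f xss) ! i =
      interp (prod_alg (select js As)) f (map (select js) xss) ! i"
    using i by (simp add: interp_prod_nth o_def)
qed (simp add: prod_alg_def)

text \<open>\<open>select js\<close> is a homomorphism between the products; for the inclusion from
  left to right, arguments of an operation are lifted to chosen preimages.\<close>

lemma Sg_select:
  assumes "set js \<subseteq> {..<length As}"
  shows "Sg L (prod_alg (select js As)) (select js ` X) = select js ` Sg L (prod_alg As) X"
proof (intro equalityI subsetI)
  fix x assume "x \<in> Sg L (prod_alg (select js As)) (select js ` X)"
  then show "x \<in> select js ` Sg L (prod_alg As) X"
  proof induction
    case (gen x)
    then show ?case by (auto intro: Sg.gen)
  next
    case (op f xs)
    have "\<forall>x\<in>set xs. \<exists>y. x = select js y \<and> y \<in> Sg L (prod_alg As) X" using op(4) by blast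
    from bchoice[OF this] obtain g
      where g: "\<And>x. x \<in> set xs \<Longrightarrow> x = select js (g x) \<and> g x \<in> Sg L (prod_alg As) X" by blast
    have xs: "map (select js) (map g xs) = xs" using g by (auto intro: map_idI)
    have "interp (prod_alg As) f (map g xs) \<in> Sg L (prod_alg As) X"
      using op g by (intro Sg.op) auto
    then show ?case using select_interp[OF assms, of f "map g xs"] xs by (metis imageI)
  qed
next
  fix x assume "x \<in> select js ` Sg L (prod_alg As) X"
  then obtain y where x: "x = select js y" and "y \<in> Sg L (prod_alg As) X" by auto
  from this(2) have "select js y \<in> Sg L (prod_alg (select js As)) (select js ` X)"
  proof induction
    case (op f xs)
    then show ?case unfolding select_interp[OF assms] by (intro Sg.op) auto
  qed (auto intro: Sg.gen)
  then show "x \<in> Sg L (prod_alg (select js As)) (select js ` X)" by (simp add: x)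
qed

lemma select_in_univ:
  assumes "set js \<subseteq> {..<length As}" and "x \<in> univ (prod_alg As)"
  shows "select js x \<in> univ (prod_alg (select js As))"
proof -
  have "js ! i < length As" if "i < length js" for i
    using that assms by (auto simp: subset_iff)
  then show ?thesis using assms(2) by (auto simp: prod_alg_def)
qed

lemma select_upt: "select [0..<length xs] xs = xs"
  by (simp add: select_def map_nth)

section \<open>Gluing approximations with the parallelogram term\<close>

text \<open>The operation \<open>p\<close> is a parameter, so that one formula serves in an algebra,
  in the product and on codes. The list \<open>vs\<close> holds the \<open>k\<close> approximations,
  and \<open>v\<close> will be its head.\<close>

definition glue :: "nat \<Rightarrow> ('b list \<Rightarrow> 'b) \<Rightarrow> 'b \<Rightarrow> 'b \<Rightarrow> 'b \<Rightarrow> 'b \<Rightarrow> 'b list \<Rightarrow> 'b" where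
  "glue k p c u u' v vs =
     p ([p ([p ([c, v, v, c] @ vs), v, v, p ([c, v, v, c] @ vs)] @ vs),
         p ([u', u, v, u'] @ replicate k v), v, c] @ vs)"

text \<open>Applied with \<phi> a coordinate projection, the encoding of tuples, or the identity,
  where only closure matters.\<close>

lemma glue_hom:
  assumes "\<And>ts. length ts = k + 4 \<Longrightarrow> set ts \<subseteq> X \<Longrightarrow> p ts \<in> X \<and> \<phi> (p ts) = q (map \<phi> ts)"
    and "{c, u, u', v} \<subseteq> X" and "set vs \<subseteq> X" and "length vs = k"
  shows "glue k p c u u' v vs \<in> X"
    and "\<phi> (glue k p c u u' v vs) = glue k q (\<phi> c) (\<phi> u) (\<phi> u') (\<phi> v) (map \<phi> vs)"
proof -
  let ?c1 = "p ([c, v, v, c] @ vs)"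
  have 1: "?c1 \<in> X \<and> \<phi> ?c1 = q ([\<phi> c, \<phi> v, \<phi> v, \<phi> c] @ map \<phi> vs)"
    using assms(1)[of "[c, v, v, c] @ vs"] assms by simp
  let ?c2 = "p ([?c1, v, v, ?c1] @ vs)"
  have 2: "?c2 \<in> X \<and> \<phi> ?c2 = q ([\<phi> ?c1, \<phi> v, \<phi> v, \<phi> ?c1] @ map \<phi> vs)"
    using assms(1)[of "[?c1, v, v, ?c1] @ vs"] assms 1 by simp
  let ?w = "p ([u', u, v, u'] @ replicate k v)"
  have 3: "?w \<in> X \<and> \<phi> ?w = q ([\<phi> u', \<phi> u, \<phi> v, \<phi> u'] @ replicate k (\<phi> v))"
    using assms(1)[of "[u', u, v, u'] @ replicate k v"] assms by (auto simp: set_replicate_conv_if)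
  have 4: "p ([?c2, ?w, v, c] @ vs) \<in> X \<and>
     \<phi> (p ([?c2, ?w, v, c] @ vs)) = q ([\<phi> ?c2, \<phi> ?w, \<phi> v, \<phi> c] @ map \<phi> vs)"
    using assms(1)[of "[?c2, ?w, v, c] @ vs"] assms 2 3 by simp
  show "glue k p c u u' v vs \<in> X" using 4 unfolding glue_def by simp
  show "\<phi> (glue k p c u u' v vs) = glue k q (\<phi> c) (\<phi> u) (\<phi> u') (\<phi> v) (map \<phi> vs)"
    using 1 2 3 4 unfolding glue_def by simp
qed

locale smp_setting =
  fixes L :: "'f language" and V K :: "('f, 'a) alg set" and d :: nat and P :: "'f trm"
    and ca :: "('f, 'a) alg \<Rightarrow> val" and ce :: "'a \<Rightarrow> val"
  assumes var: "variety L V" and d: "d > 1" and par: "parallelogram_term L V d P"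
    and finK: "finite K" and KV: "K \<subseteq> V" and finA: "\<And>A. A \<in> K \<Longrightarrow> finite (univ A)"
    and inja: "inj_on ca K" and inje: "inj_on ce (\<Union>A\<in>K. univ A)"
begin

lemma alg: "A \<in> K \<Longrightarrow> is_algebra L A"
  using var KV unfolding variety_def by blast

lemma nary: "nary_term L (d + 3) P"
  using par by (simp add: parallelogram_term_def)

lemma parallelogram_first:
  assumes "A \<in> K" "x \<in> univ A" "y \<in> univ A" "z \<in> univ A"
  shows "term_op A P ([x, x, y, z] @ replicate (d - 1) y) = y"
proof -
  have "(replicate d y)[0 := z] = z # replicate (d - 1) y"
    using d by (cases d) auto
  then show ?thesis using par assms KV unfolding parallelogram_term_def by force
qed

lemma parallelogram_rest:
  assumes "A \<in> K" "x \<in> univ A" "y \<in> univ A" "z \<in> univ A" "j < d - 1"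
  shows "term_op A P ([y, x, x, y] @ (replicate (d - 1) y)[j := z]) = y"
proof -
  \<comment> \<open>The first of the last \<open>d\<close> places is taken by \<open>c\<close> in
    \<open>glue\<close>, so index \<open>j\<close> of the approximations, counted from 0, is place
    \<open>j + 2\<close> counted from 1.\<close>
  have "(replicate d y)[(j + 2) - 1 := z] = y # (replicate (d - 1) y)[j := z]"
    using d by (cases d) auto
  moreover have "j + 2 \<in> {2..d}" using assms(5) by auto
  ultimately show ?thesis using par assms KV unfolding parallelogram_term_def
    by (metis append_Cons append_Nil subsetD)
qed

lemma pow_op_eq: "pow_op d P A x y = term_op A P ([x, y, y, x] @ replicate (d - 1) y)"
proof -
  have "(replicate d y)[0 := x] = x # replicate (d - 1) y" using d by (cases d) auto
  then show ?thesis by (simp add: pow_op_def p_op_def)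
qed

lemma term_op_in: "A \<in> K \<Longrightarrow> length ts = d + 3 \<Longrightarrow> set ts \<subseteq> univ A \<Longrightarrow> term_op A P ts \<in> univ A"
  using term_op_in_univ[OF alg nary] .

lemma pow_op_in: "A \<in> K \<Longrightarrow> x \<in> univ A \<Longrightarrow> y \<in> univ A \<Longrightarrow> pow_op d P A x y \<in> univ A"
  unfolding pow_op_eq using d by (intro term_op_in) (auto simp: set_replicate_conv_if)

text \<open>\<open>q\<close> fixes \<open>b\<close>: the two middle arguments are equal, whatever
  they are, and the deviating entry \<open>z\<close> is in a place covered by
  \<open>parallelogram_rest\<close>. Equal witnesses make the inner \<open>p\<close> collapse to the
  head of the list, so the outer \<open>P\<close> is again this identity.\<close>

lemma glue_old_coordinate:
  assumes A: "A \<in> K" "b \<in> univ A" "u \<in> univ A" "z \<in> univ A" and j: "j < d - 1"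
  shows "glue (d - 1) (term_op A P) b u u (if j = 0 then z else b) ((replicate (d - 1) b)[j := z]) = b"
proof -
  let ?v = "if j = 0 then z else b"
  have v: "?v \<in> univ A" using A by auto
  have 1: "term_op A P ([b, ?v, ?v, b] @ (replicate (d - 1) b)[j := z]) = b"
    using parallelogram_rest[OF A(1) v A(2) A(4) j] by blast
  have 2: "term_op A P ([u, u, ?v, u] @ replicate (d - 1) ?v) = ?v"
    using parallelogram_first[OF A(1) A(3) v A(3)] by blast
  show ?thesis unfolding glue_def 1 2 ..
qed

text \<open>The outer \<open>P\<close> has \<open>(\<gamma>\<^sup>\<delta>)\<^sup>\<delta>\<close>
  in its first two places, once through two rounds of \<open>q\<close> and once through the fork;
  \<open>parallelogram_first\<close> then absorbs \<gamma> in the place of \<open>z\<close>. A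
  single round of \<open>q\<close> would give only \<open>\<gamma>\<^sup>\<delta>\<close> in the
  first place.\<close>

lemma glue_new_coordinate:
  assumes A: "A \<in> K" "\<gamma> \<in> univ A" "\<delta> \<in> univ A"
  shows "glue (d - 1) (term_op A P) \<gamma> \<delta> (pow_op d P A \<gamma> \<delta>) \<delta> (replicate (d - 1) \<delta>) = \<delta>"
proof -
  have e: "pow_op d P A (pow_op d P A \<gamma> \<delta>) \<delta> \<in> univ A" using A by (intro pow_op_in)
  show ?thesis unfolding glue_def pow_op_eq[symmetric]
    by (rule parallelogram_first[OF A(1) e A(3) A(2)])
qed

text \<open>The two preceding lemmas, applied coordinatewise. The exceptional approximation in
  \<open>vI\<close> may change with the coordinate; this slack is what lets an interval
  grow.\<close>

lemma glue_agrees: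
  assumes As: "set As \<subseteq> K" and U: "{b, c, u, u'} \<subseteq> univ (prod_alg As)"
    and vs: "set vs \<subseteq> univ (prod_alg As)" "length vs = d - 1"
    and I: "I \<subseteq> {..<length As}" and m: "m < length As"
    and c: "\<And>i. i \<in> I \<Longrightarrow> c ! i = b ! i" and uI: "\<And>i. i \<in> I \<Longrightarrow> u ! i = u' ! i"
    and um: "u ! m = b ! m" "u' ! m = pow_op d P (As ! m) (c ! m) (b ! m)"
    and vm: "\<And>j. j < d - 1 \<Longrightarrow> vs ! j ! m = b ! m"
    and vI: "\<And>i. i \<in> I \<Longrightarrow> \<exists>j<d - 1. \<forall>j'<d - 1. j' \<noteq> j \<longrightarrow> vs ! j' ! i = b ! i"
    and i: "i \<in> insert m I"
  shows "glue (d - 1) (term_op (prod_alg As) P) c u u' (hd vs) vs ! i = b ! i"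
proof -
  have n: "i < length As" using i I m by auto
  have A: "As ! i \<in> K" using As n by (meson nth_mem subsetD)
  have in_univ: "x ! i \<in> univ (As ! i)" if "x \<in> univ (prod_alg As)" for x
    using that n by (simp add: prod_alg_def)
  have ne: "vs \<noteq> []" using vs d by auto
  have hdvs: "hd vs = vs ! 0" using ne by (simp add: hd_conv_nth)
  have d0: "0 < d - 1" using d by simp
  have eq: "glue (d - 1) (term_op (prod_alg As) P) c u u' (hd vs) vs ! i =
    glue (d - 1) (term_op (As ! i) P) (c ! i) (u ! i) (u' ! i) (hd vs ! i) (map (\<lambda>x. x ! i) vs)"
  proof (rule glue_hom(2)[where X = UNIV])
    fix ts :: "'a list list" assume "length ts = d - 1 + 4"
    then show "term_op (prod_alg As) P ts \<in> UNIV \<and>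
        term_op (prod_alg As) P ts ! i = term_op (As ! i) P (map (\<lambda>x. x ! i) ts)"
      using term_op_prod_nth[OF nary _ n] d by simp
  qed (use vs in auto)
  show ?thesis
  proof (cases "i = m")
    case True
    have "map (\<lambda>x. x ! m) vs = replicate (d - 1) (b ! m)"
      using vm vs by (intro nth_equalityI) auto
    moreover have "hd vs ! m = b ! m" using vm[OF d0] hdvs by simp
    ultimately show ?thesis unfolding eq
      using True um glue_new_coordinate[OF A] in_univ U by simp
  next
    case False
    then have iI: "i \<in> I" using i by auto
    obtain j where j: "j < d - 1" and vj: "\<And>j'. j' < d - 1 \<Longrightarrow> j' \<noteq> j \<Longrightarrow> vs ! j' ! i = b ! i"
      using vI[OF iI] by auto
    have "map (\<lambda>x. x ! i) vs = (replicate (d - 1) (b ! i))[j := vs ! j ! i]"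
      using vj vs j by (intro nth_equalityI) (auto simp: nth_list_update)
    moreover have "hd vs ! i = (if j = 0 then vs ! j ! i else b ! i)"
      using vj[OF d0] hdvs by auto
    moreover have "vs ! j \<in> univ (prod_alg As)" using vs j by auto
    ultimately show ?thesis unfolding eq
      using glue_old_coordinate[OF A _ _ _ j] in_univ U c[OF iI] uI[OF iI] by simp
  qed
qed

end

section \<open>Enumerating coordinate tuples on codes\<close>

lemma enc_list_inject [simp]: "enc_list xs = enc_list ys \<longleftrightarrow> xs = ys"
  by (metis dec_enc_list)

lemma fp_replicate [fps]:
  assumes "fp Or Qs g"
  shows "fp Or Qs (\<lambda>x. enc_list (replicate k (g x)))"
proof (induction k)
  case (Suc k)
  then show ?case by (simp add: fp_Node[OF assms])
qed (simp add: fp_const)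

lemma finite_table_bounded:
  assumes "finite {z. g z \<noteq> (c :: val)}"
  shows "\<exists>C. \<forall>z. vsize (g z) \<le> C"
proof -
  have "range g \<subseteq> insert c (g ` {z. g z \<noteq> c})" by auto
  then have "finite (vsize ` range g)" using assms by (meson finite_imageI finite_insert finite_subset)
  then show ?thesis using Max_ge by (intro exI[of _ "Max (vsize ` range g)"]) auto
qed

text \<open>Tuples with repetition stand in for sets, since order and multiplicity do no harm. The
  length \<open>k\<close> is a constant of the program, so their number is polynomial.\<close>

fun index_tuples :: "nat \<Rightarrow> val list \<Rightarrow> val list" where
  "index_tuples 0 xs = [Leaf]"
| "index_tuples (Suc k) xs = concat (map (\<lambda>i. map (\<lambda>S. Node i S) (index_tuples k xs)) xs)"

lemma set_index_tuples: "length S = k \<Longrightarrow> set S \<subseteq> set xs \<Longrightarrow> enc_list S \<in> set (index_tuples k xs)"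
proof (induction k arbitrary: S)
  case (Suc k)
  then obtain i S' where "S = i # S'" by (cases S) auto
  then show ?case using Suc by auto
qed simp

lemma fp_index_tuples [fps]:
  assumes "fp Or Qs (\<lambda>x. enc_list (l x))"
  shows "fp Or Qs (\<lambda>x. enc_list (index_tuples k (l x)))"
proof (induction k)
  case (Suc k)
  show ?case unfolding index_tuples.simps
    \<comment> \<open>Inside a body the input is a component of a larger tree. Precomposing the
      given facts with projections makes them applicable there; the same device recurs
      below.\<close>
    by (intro fps assms[THEN fp_comp[rotated]] Suc[THEN fp_comp[rotated]])
qed (simp add: fp_const)

lemma length_filter_neq: "j < k \<Longrightarrow> length (filter (\<lambda>i. i \<noteq> j) [0..<k]) = k - 1"
proof -
  assume "j < k"
  have "length (filter (\<lambda>i. i \<noteq> j) [0..<k]) = card (set (filter (\<lambda>i. i \<noteq> j) [0..<k]))"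
    by (rule distinct_card[symmetric]) simp
  also have "set (filter (\<lambda>i. i \<noteq> j) [0..<k]) = {0..<k} - {j}" by auto
  finally show ?thesis using \<open>j < k\<close> by simp
qed

section \<open>Deciding membership with a standardized representation\<close>

abbreviation indices :: "val \<Rightarrow> val list" where
  "indices v \<equiv> map enc_nat [0..<length (dec_list v)]"

text \<open>The default \<open>a\<close> will be the first generator, so a failed search still
  yields an element of the subalgebra.\<close>

definition lookup :: "val \<Rightarrow> val list \<Rightarrow> val \<Rightarrow> val list \<Rightarrow> val" where
  "lookup eb J a T = find_default (\<lambda>t. list_all (\<lambda>j. vnth t j = vnth eb j) J) a T"

lemma fp_lookup [fps]:
  assumes "fp Or Qs eb" "fp Or Qs (\<lambda>x. enc_list (J x))" "fp Or Qs a" "fp Or Qs (\<lambda>x. enc_list (T x))"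
  shows "fp Or Qs (\<lambda>x. lookup (eb x) (J x) (a x) (T x))"
  unfolding lookup_def by (intro fps assms[THEN fp_comp[rotated]])

lemma lookup_in: "lookup eb J a T \<in> insert a (set T)"
  unfolding lookup_def using find_default_cases by (metis insert_iff)

context smp_setting
begin

definition graph_op :: "val \<Rightarrow> val \<Rightarrow> bool" where
  "graph_op z v \<longleftrightarrow> (\<exists>A ts. A \<in> K \<and> set ts \<subseteq> univ A \<and> length ts = d + 3 \<and>
     z = Node (ca A) (enc_tuple ce ts) \<and> v = ce (term_op A P ts))"

text \<open>The operation \<open>P\<close> on codes. Injectivity of \<open>ca\<close> and
  \<open>ce\<close> makes the chosen value unique on genuine codes; all other trees go to
  \<open>Leaf\<close>, which keeps the table finite.\<close>

definition op_table :: "val \<Rightarrow> val" where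
  "op_table z = (if \<exists>v. graph_op z v then SOME v. graph_op z v else Leaf)"

lemma enc_tuple_inj:
  assumes "set xs \<subseteq> (\<Union>A\<in>K. univ A)" "set ys \<subseteq> (\<Union>A\<in>K. univ A)" "enc_tuple ce xs = enc_tuple ce ys"
  shows "xs = ys"
  using assms inj_on_map_eq_map[of ce xs ys] inje unfolding enc_tuple_def
  by (metis Un_least enc_list_inject inj_on_subset)

lemma op_table_eq:
  assumes "A \<in> K" "set ts \<subseteq> univ A" "length ts = d + 3"
  shows "op_table (Node (ca A) (enc_tuple ce ts)) = ce (term_op A P ts)"
proof -
  let ?z = "Node (ca A) (enc_tuple ce ts)"
  have 1: "graph_op ?z (ce (term_op A P ts))" using assms unfolding graph_op_def by blast
  have "v = ce (term_op A P ts)" if v: "graph_op ?z v" for v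
  proof -
    obtain A' ts' where *: "A' \<in> K" "set ts' \<subseteq> univ A'" "ca A = ca A'"
      "enc_tuple ce ts = enc_tuple ce ts'" "v = ce (term_op A' P ts')"
      using v unfolding graph_op_def by auto
    have "A = A'" using inja * assms by (auto dest: inj_onD)
    moreover have "ts = ts'" by (rule enc_tuple_inj) (use * assms in auto)
    ultimately show ?thesis using * by simp
  qed
  then have "(SOME v. graph_op ?z v) = ce (term_op A P ts)" using someI[of "graph_op ?z", OF 1] by blast
  then show ?thesis using 1 unfolding op_table_def by auto
qed

lemma finite_op_table: "finite {z. op_table z \<noteq> Leaf}"
proof (rule finite_subset)
  show "{z. op_table z \<noteq> Leaf} \<subseteq> (\<lambda>(A, ts). Node (ca A) (enc_tuple ce ts)) `
      (SIGMA A:K. {ts. set ts \<subseteq> univ A \<and> length ts = d + 3})"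
  proof
    fix z assume "z \<in> {z. op_table z \<noteq> Leaf}"
    then obtain v where "graph_op z v" unfolding op_table_def by (auto split: if_splits)
    then obtain A ts where "A \<in> K" "set ts \<subseteq> univ A" "length ts = d + 3"
      "z = Node (ca A) (enc_tuple ce ts)" unfolding graph_op_def by auto
    then show "z \<in> (\<lambda>(A, ts). Node (ca A) (enc_tuple ce ts)) `
      (SIGMA A:K. {ts. set ts \<subseteq> univ A \<and> length ts = d + 3})"
      by (intro image_eqI[of _ _ "(A, ts)"]) auto
  qed
  show "finite ((\<lambda>(A, ts). Node (ca A) (enc_tuple ce ts)) `
      (SIGMA A:K. {ts. set ts \<subseteq> univ A \<and> length ts = d + 3}))"
    by (intro finite_imageI finite_SigmaI finK finite_lists_length_eq finA)
qed

lemmas fp_op_table = fp_finite_table[OF finite_op_table]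

definition vop :: "val \<Rightarrow> val list \<Rightarrow> val list \<Rightarrow> val" where
  "vop EA idx ts =
     enc_list (map (\<lambda>i. op_table (Node (vnth EA i) (enc_list (map (\<lambda>t. vnth t i) ts)))) idx)"

lemma fp_vop:
  assumes "fp Or Qs EA" "fp Or Qs (\<lambda>x. enc_list (idx x))" "fp Or Qs (\<lambda>x. enc_list (ts x))"
  shows "fp Or Qs (\<lambda>x. vop (EA x) (idx x) (ts x))"
  unfolding vop_def by (intro fps fp_op_table assms[THEN fp_comp[rotated]])

definition op_bound :: nat where
  "op_bound = (SOME C. \<forall>z. vsize (op_table z) \<le> C)"

lemma vsize_op_table: "vsize (op_table z) \<le> op_bound"
  using someI_ex[OF finite_table_bounded[OF finite_op_table]] unfolding op_bound_def by blast

text \<open>The result has one table value per index, so its size does not depend on the arguments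
  \<open>ts\<close>. For this reason iterated gluing stays polynomial even on malformed
  input.\<close>

lemma vsize_vop: "vsize (vop EA idx ts) \<le> vsize (enc_list idx) * (op_bound + 1) + 1"
proof -
  have "vsize (vop EA idx ts) \<le> length idx * (op_bound + 1) + 1"
    unfolding vop_def by (rule order_trans[OF vsize_enc_list_le[where C = op_bound]])
      (auto simp: vsize_op_table)
  also have "\<dots> \<le> vsize (enc_list idx) * (op_bound + 1) + 1"
    using length_dec_list[of "enc_list idx"] by (intro add_mono mult_mono) auto
  finally show ?thesis .
qed

definition slots :: "val list" where
  "slots = map enc_nat [0..<d - 1]"

definition approximants :: "val \<Rightarrow> val \<Rightarrow> val list \<Rightarrow> val list \<Rightarrow> val \<Rightarrow> val list" where
  "approximants eb a J T S =
     map (\<lambda>j. lookup eb (map (\<lambda>i. vnth S i) (filter (\<lambda>i. i \<noteq> j) slots) @ J) a T) slots"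

lemma fp_approximants:
  assumes "fp Or Qs eb" "fp Or Qs a" "fp Or Qs (\<lambda>x. enc_list (J x))" "fp Or Qs (\<lambda>x. enc_list (T x))"
    "fp Or Qs S"
  shows "fp Or Qs (\<lambda>x. enc_list (approximants (eb x) (a x) (J x) (T x) (S x)))"
  unfolding approximants_def by (intro fps assms[THEN fp_comp[rotated]])

definition glued :: "val \<Rightarrow> val list \<Rightarrow> val \<Rightarrow> val \<Rightarrow> val \<Rightarrow> val list \<Rightarrow> val" where
  "glued EA idx c u u' vs = glue (d - 1) (vop EA idx) c u u' (left (enc_list vs)) vs"

lemma fp_glued:
  assumes "fp Or Qs EA" "fp Or Qs (\<lambda>x. enc_list (idx x))" "fp Or Qs c" "fp Or Qs u" "fp Or Qs u'"
    "fp Or Qs (\<lambda>x. enc_list (vs x))"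
  shows "fp Or Qs (\<lambda>x. glued (EA x) (idx x) (c x) (u x) (u' x) (vs x))"
  unfolding glued_def glue_def by (intro fps fp_vop assms)

text \<open>Enlarges the interval \<open>J\<close> by \<open>i\<close>: each \<open>S\<close> of
  length \<open>d - 2\<close> is turned into the tuple \<open>Node i S\<close> of length
  \<open>d - 1\<close>, and gluing gives a candidate for \<open>S\<close> together with the larger
  interval.\<close>

definition refine ::
  "val \<Rightarrow> val list \<Rightarrow> val \<Rightarrow> val \<Rightarrow> val \<Rightarrow> val \<Rightarrow> val \<Rightarrow> val list \<Rightarrow> val list \<Rightarrow> val list \<Rightarrow> val \<Rightarrow> val list" where
  "refine EA idx eb a c u u' Sl J T i =
     map (\<lambda>S. glued EA idx c u u' (approximants eb a J T (Node i S))) Sl"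

lemma fp_refine:
  assumes "fp Or Qs EA" "fp Or Qs (\<lambda>x. enc_list (idx x))" "fp Or Qs eb" "fp Or Qs a" "fp Or Qs c"
    "fp Or Qs u" "fp Or Qs u'" "fp Or Qs (\<lambda>x. enc_list (Sl x))" "fp Or Qs (\<lambda>x. enc_list (J x))"
    "fp Or Qs (\<lambda>x. enc_list (T x))" "fp Or Qs i"
  shows "fp Or Qs (\<lambda>x. enc_list (refine (EA x) (idx x) (eb x) (a x) (c x) (u x) (u' x)
    (Sl x) (J x) (T x) (i x)))"
  unfolding refine_def by (intro fps fp_glued fp_approximants assms[THEN fp_comp[rotated]])

lemma vsize_refine:
  "vsize (enc_list (refine EA idx eb a c u u' Sl J T i)) \<le>
     vsize (enc_list Sl) * (vsize (enc_list idx) * (op_bound + 1) + 1 + 1) + 1"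
proof -
  let ?C = "vsize (enc_list idx) * (op_bound + 1) + 1"
  have "vsize (enc_list (refine EA idx eb a c u u' Sl J T i)) \<le> length Sl * (?C + 1) + 1"
    unfolding refine_def glued_def glue_def
    by (rule order_trans[OF vsize_enc_list_le[where C = ?C]]) (use vsize_vop in auto)
  also have "\<dots> \<le> vsize (enc_list Sl) * (?C + 1) + 1"
    using length_dec_list[of "enc_list Sl"] by (intro add_mono mult_mono) auto
  finally show ?thesis .
qed

text \<open>The state has the interval reached so far on the left and the candidates for all
  \<open>S\<close> on the right. As \<open>m\<close> is in unary, its decoded length is the number
  of rounds.\<close>

definition sweep ::
  "val \<Rightarrow> val list \<Rightarrow> val \<Rightarrow> val \<Rightarrow> val \<Rightarrow> val \<Rightarrow> val \<Rightarrow> val list \<Rightarrow> val list \<Rightarrow> val \<Rightarrow> val" where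
  "sweep EA idx eb a c u u' Sl pool m =
     foldl (\<lambda>st i. Node (Node i (left st))
         (enc_list (refine EA idx eb a c u u' Sl (dec_list (left st)) (dec_list (right st)) i)))
       (Node (enc_list [m]) (enc_list pool)) (map enc_nat (rev [0..<length (dec_list m)]))"

lemma fp_sweep:
  assumes "fp Or Qs EA" "fp Or Qs (\<lambda>x. enc_list (idx x))" "fp Or Qs eb" "fp Or Qs a" "fp Or Qs c"
    "fp Or Qs u" "fp Or Qs u'" "fp Or Qs (\<lambda>x. enc_list (Sl x))" "fp Or Qs (\<lambda>x. enc_list (pool x))"
    "fp Or Qs m"
  shows "fp Or Qs (\<lambda>x. sweep (EA x) (idx x) (eb x) (a x) (c x) (u x) (u' x) (Sl x) (pool x) (m x))"
proof (cases "Or = {}")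
  case False
  let ?l = "\<lambda>x. map enc_nat (rev [0..<length (dec_list (m x))])"
  have l: "fp Or Qs (\<lambda>x. enc_list (?l x))" by (intro fps assms)
  \<comment> \<open>Per round the interval gains one index, while the candidate list is replaced by
    one whose size \<open>vsize_refine\<close> bounds independently of the state.\<close>
  let ?B = "\<lambda>x. vsize (enc_list (?l x)) +
    (vsize (enc_list (Sl x)) * (vsize (enc_list (idx x)) * (op_bound + 1) + 1 + 1) + 1) + 2"
  show ?thesis unfolding sweep_def
  proof (rule fp_foldl_list[where B = ?B])
    show "fp Or Qs (\<lambda>z. Node (Node (left (right z)) (left (left z)))
       (enc_list (refine (EA (right (right z))) (idx (right (right z))) (eb (right (right z)))
          (a (right (right z))) (c (right (right z))) (u (right (right z))) (u' (right (right z)))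
          (Sl (right (right z))) (dec_list (left (left z))) (dec_list (right (left z)))
          (left (right z)))))"
      by (intro fps fp_refine assms[THEN fp_comp[rotated]])
    show "poly_bounded ?B"
      by (intro pb fp_poly_bounded[OF l False] fp_poly_bounded[OF assms(2) False]
          fp_poly_bounded[OF assms(8) False])
    fix x st e assume e: "e \<in> set (?l x)"
    have "vsize (left st) \<le> vsize st" by (cases st) auto
    then show "vsize (Node (Node e (left st))
        (enc_list (refine (EA x) (idx x) (eb x) (a x) (c x) (u x) (u' x) (Sl x)
            (dec_list (left st)) (dec_list (right st)) e))) \<le> vsize st + ?B x"
      using vsize_refine[of "EA x" "idx x" "eb x" "a x" "c x" "u x" "u' x" "Sl x"
          "dec_list (left st)" "dec_list (right st)" e] vsize_enc_list_in[OF e]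
      unfolding vsize.simps by linarith
  qed (intro fps assms)+
qed (simp add: fp_empty)

abbreviation fst_wit where "fst_wit e \<equiv> left (right (right (right e)))"
abbreviation snd_wit where "snd_wit e \<equiv> left (right (right (right (right e))))"

text \<open>Representations count coordinates from 1 and programs from 0, hence
  \<open>Node Leaf m\<close>. The third test recomputes \<open>\<gamma>\<^sup>\<delta>\<close> from
  the table. The default carries \<open>a\<close> in both witness fields, so that gluing never
  leaves the subalgebra.\<close>

definition fork_entry :: "val \<Rightarrow> val \<Rightarrow> val \<Rightarrow> val \<Rightarrow> val list \<Rightarrow> val \<Rightarrow> val" where
  "fork_entry EA eb a c fs m = find_default (\<lambda>e.
       left e = Node Leaf m \<and> left (right e) = vnth eb m \<and>
       left (right (right e)) = op_table (Node (vnth EA m) (enc_list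
         ([vnth c m, vnth eb m, vnth eb m, vnth c m] @ replicate (d - 1) (vnth eb m)))))
     (enc_list [Leaf, Leaf, Leaf, a, a]) fs"

lemma fp_fork_entry:
  assumes "fp Or Qs EA" "fp Or Qs eb" "fp Or Qs a" "fp Or Qs c" "fp Or Qs (\<lambda>x. enc_list (fs x))"
    "fp Or Qs m"
  shows "fp Or Qs (\<lambda>x. fork_entry (EA x) (eb x) (a x) (c x) (fs x) (m x))"
  unfolding fork_entry_def by (intro fps fp_op_table assms[THEN fp_comp[rotated]])

text \<open>\<open>P\<close> on \<open>d + 3\<close> equal arguments is the identity on the product,
  see \<open>vop_idem\<close>. It is inserted because it caps the size of the result on arbitrary
  trees, as the fold in \<open>reach\<close> needs.\<close>

definition advance ::
  "val \<Rightarrow> val list \<Rightarrow> val \<Rightarrow> val \<Rightarrow> val list \<Rightarrow> val list \<Rightarrow> val list \<Rightarrow> val \<Rightarrow> val \<Rightarrow> val \<Rightarrow> val" where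
  "advance EA idx eb a Sl pool fs c m e =
     (\<lambda>r. vop EA idx (replicate (d + 3) (lookup eb (dec_list (left r)) a (dec_list (right r)))))
     (sweep EA idx eb a c (fst_wit e) (snd_wit e)
        Sl pool m)"

lemma fp_advance:
  assumes "fp Or Qs EA" "fp Or Qs (\<lambda>x. enc_list (idx x))" "fp Or Qs eb" "fp Or Qs a"
    "fp Or Qs (\<lambda>x. enc_list (Sl x))" "fp Or Qs (\<lambda>x. enc_list (pool x))"
    "fp Or Qs (\<lambda>x. enc_list (fs x))" "fp Or Qs c" "fp Or Qs m" "fp Or Qs e"
  shows "fp Or Qs (\<lambda>x. advance (EA x) (idx x) (eb x) (a x) (Sl x) (pool x) (fs x) (c x) (m x) (e x))"
  unfolding advance_def by (intro fps fp_vop fp_sweep assms)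

text \<open>Local designations settle the first \<open>d - 1\<close> coordinates, so the loop starts
  at index \<open>d - 1\<close>, which is coordinate \<open>d\<close>.\<close>

definition reach ::
  "val \<Rightarrow> val list \<Rightarrow> val \<Rightarrow> val \<Rightarrow> val list \<Rightarrow> val list \<Rightarrow> val list \<Rightarrow> val" where
  "reach EA idx eb a Sl pool fs =
     foldl (\<lambda>c m. advance EA idx eb a Sl pool fs c m (fork_entry EA eb a c fs m))
       (lookup eb slots a pool) (dec_list (vdrop (enc_nat (d - 1)) (enc_list idx)))"

lemma fp_reach:
  assumes "fp Or Qs EA" "fp Or Qs (\<lambda>x. enc_list (idx x))" "fp Or Qs eb" "fp Or Qs a"
    "fp Or Qs (\<lambda>x. enc_list (Sl x))" "fp Or Qs (\<lambda>x. enc_list (pool x))"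
    "fp Or Qs (\<lambda>x. enc_list (fs x))"
  shows "fp Or Qs (\<lambda>x. reach (EA x) (idx x) (eb x) (a x) (Sl x) (pool x) (fs x))"
proof (cases "Or = {}")
  case False
  show ?thesis unfolding reach_def
  proof (rule fp_foldl_list[where B = "\<lambda>x. vsize (enc_list (idx x)) * (op_bound + 1) + 1"])
    show "fp Or Qs (\<lambda>z. advance (EA (right (right z))) (idx (right (right z))) (eb (right (right z)))
       (a (right (right z))) (Sl (right (right z))) (pool (right (right z))) (fs (right (right z)))
       (left z) (left (right z))
       (fork_entry (EA (right (right z))) (eb (right (right z))) (a (right (right z))) (left z)
         (fs (right (right z))) (left (right z))))"
      by (intro fps fp_advance fp_fork_entry assms[THEN fp_comp[rotated]])
    show "poly_bounded (\<lambda>x. vsize (enc_list (idx x)) * (op_bound + 1) + 1)"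
      by (intro pb fp_poly_bounded[OF assms(2) False])
    show "vsize (advance (EA x) (idx x) (eb x) (a x) (Sl x) (pool x) (fs x) c e
          (fork_entry (EA x) (eb x) (a x) c (fs x) e))
      \<le> vsize c + (vsize (enc_list (idx x)) * (op_bound + 1) + 1)" for x c e
      unfolding advance_def using vsize_vop trans_le_add2 by blast
  qed (intro fps assms)+
qed (simp add: fp_empty)

definition decide :: "val \<Rightarrow> val" where
  "decide z = enc_bool (reach (left (left (left z)))
      (indices (left (left (left z))))
      (right (left z)) (left (right (left (left z))))
      (index_tuples (d - 2) (indices (left (left (left z)))))
      (map (\<lambda>e. left (right (right e))) (dec_list (left (right z))))
      (dec_list (right (right z))) = right (left z))"

lemma fp_decide: "fp Or Qs decide"
  unfolding decide_def by (intro fps fp_reach)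

end

lemma standardized_repD:
  assumes "standardized_rep d P As B R r F u"
  shows "R \<subseteq> B"
    and "(I, c) \<in> local_indices d (length As) B \<Longrightarrow> r (I, c) \<in> R"
    and "(I, c) \<in> local_indices d (length As) B \<Longrightarrow> proj I (r (I, c)) = c"
    and "d \<le> m \<Longrightarrow> m \<le> length As \<Longrightarrow> fork' d P As m B \<subseteq> F m"
    and "d \<le> m \<Longrightarrow> m \<le> length As \<Longrightarrow> F m \<subseteq> fork m R"
    and "(m, g) \<in> fork_indices d (length As) F \<Longrightarrow> u (m, g) \<in> R \<times> R"
    and "(m, g) \<in> fork_indices d (length As) F \<Longrightarrow> witnesses_fork m (u (m, g)) g"
proof -
  note 1 = assms[unfolded standardized_rep_def]
  note * = conjunct1[OF 1] conjunct1[OF conjunct2[OF 1]] conjunct1[OF conjunct2[OF conjunct2[OF 1]]]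
    conjunct1[OF conjunct2[OF conjunct2[OF conjunct2[OF 1]]]]
  show "R \<subseteq> B" by (rule *(1))
  show "(I, c) \<in> local_indices d (length As) B \<Longrightarrow> r (I, c) \<in> R"
    "(I, c) \<in> local_indices d (length As) B \<Longrightarrow> proj I (r (I, c)) = c"
    using *(2) by auto
  show "d \<le> m \<Longrightarrow> m \<le> length As \<Longrightarrow> fork' d P As m B \<subseteq> F m"
    "d \<le> m \<Longrightarrow> m \<le> length As \<Longrightarrow> F m \<subseteq> fork m R"
    using *(3) by auto
  show "(m, g) \<in> fork_indices d (length As) F \<Longrightarrow> u (m, g) \<in> R \<times> R"
    "(m, g) \<in> fork_indices d (length As) F \<Longrightarrow> witnesses_fork m (u (m, g)) g"
    using *(4) by auto
qed

section \<open>Correctness of the membership test\<close>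

locale smp_instance = smp_setting L V K d P ca ce
  for L :: "'f language" and V K :: "('f, 'a) alg set" and d :: nat and P :: "'f trm"
    and ca :: "('f, 'a) alg \<Rightarrow> val" and ce :: "'a \<Rightarrow> val" +
  fixes As :: "('f, 'a) alg list" and as :: "'a list list"
  assumes valid: "valid_gens K As as"
begin

abbreviation n where "n \<equiv> length As"
abbreviation B where "B \<equiv> Sg L (prod_alg As) (set as)"
abbreviation EA where "EA \<equiv> enc_list (map ca As)"
abbreviation idx where "idx \<equiv> map enc_nat [0..<n]"
abbreviation en where "en \<equiv> enc_tuple ce"
abbreviation opA where "opA \<equiv> term_op (prod_alg As) P"
abbreviation UA where "UA \<equiv> univ (prod_alg As)"
abbreviation tuples where "tuples \<equiv> index_tuples (d - 2) idx"

lemma As: "set As \<subseteq> K" "As \<noteq> []" and as: "as \<noteq> []" "set as \<subseteq> UA"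
  using valid by (auto simp: valid_gens_def)

lemma AsK: "i < n \<Longrightarrow> As ! i \<in> K"
  using As(1) by (meson nth_mem subsetD)

lemma B_univ: "B \<subseteq> UA"
  by (rule Sg_subset_univ[OF is_algebra_prod as(2)]) (use As alg in auto)

lemma univD: "t \<in> UA \<Longrightarrow> length t = n"
  "t \<in> UA \<Longrightarrow> i < n \<Longrightarrow> t ! i \<in> univ (As ! i)"
  by (auto simp: prod_alg_def)

lemma univ_sub: "t \<in> UA \<Longrightarrow> set t \<subseteq> (\<Union>A\<in>K. univ A)"
  using univD AsK by (fastforce simp: in_set_conv_nth)

lemma en_inj: "s \<in> UA \<Longrightarrow> t \<in> UA \<Longrightarrow> en s = en t \<longleftrightarrow> s = t"
  using enc_tuple_inj univ_sub by metis

lemma hd_as: "hd as \<in> B"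
  using as by (auto intro: Sg.gen)

lemma vnth_en: "length t = n \<Longrightarrow> i < n \<Longrightarrow> vnth (en t) (enc_nat i) = ce (t ! i)"
  by (simp add: enc_tuple_def)

lemma ce_inj: "s \<in> UA \<Longrightarrow> t \<in> UA \<Longrightarrow> i < n \<Longrightarrow>
   ce (s ! i) = ce (t ! i) \<longleftrightarrow> s ! i = t ! i"
  using inje AsK univD(2) by (auto dest!: inj_onD)

lemma term_op_prod_in_univ:
  "length ts = d + 3 \<Longrightarrow> set ts \<subseteq> UA \<Longrightarrow> opA ts \<in> UA"
  by (rule term_op_in_univ[OF is_algebra_prod nary]) (use As alg in auto)

lemma vop_eq:
  assumes "length ts = d + 3" "set ts \<subseteq> UA"
  shows "vop EA idx (map en ts) = en (opA ts)"
proof -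
  let ?y = "opA ts"
  have y: "length ?y = n" using term_op_prod_in_univ[OF assms] univD by blast
  have "op_table (Node (vnth EA (enc_nat i)) (enc_list (map (\<lambda>t. vnth t (enc_nat i)) (map en ts)))) =
      ce (?y ! i)" if i: "i < n" for i
  proof -
    have EAi: "vnth EA (enc_nat i) = ca (As ! i)" using i by simp
    have "map (\<lambda>t. vnth t (enc_nat i)) (map en ts) = map ce (map (\<lambda>t. t ! i) ts)"
      using assms(2) univD(1) i by (auto simp: vnth_en subset_iff)
    then have "op_table (Node (vnth EA (enc_nat i)) (enc_list (map (\<lambda>t. vnth t (enc_nat i)) (map en ts)))) =
        op_table (Node (ca (As ! i)) (enc_tuple ce (map (\<lambda>t. t ! i) ts)))"
      by (simp only: EAi enc_tuple_def)
    also have "\<dots> = ce (term_op (As ! i) P (map (\<lambda>t. t ! i) ts))"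
      using assms univD(2) i by (intro op_table_eq AsK) (auto simp: subset_iff)
    also have "\<dots> = ce (?y ! i)" using term_op_prod_nth[OF nary assms(1) i] by simp
    finally show ?thesis .
  qed
  then have "map (\<lambda>i. op_table (Node (vnth EA i) (enc_list (map (\<lambda>t. vnth t i) (map en ts))))) idx =
     map ce ?y"
    by (intro nth_equalityI) (use y in auto)
  then show ?thesis by (simp add: vop_def enc_tuple_def)
qed

text \<open>The first parallelogram identity with all variables equal says that \<open>P\<close> is
  idempotent.\<close>

lemma vop_idem:
  assumes "t \<in> UA"
  shows "vop EA idx (replicate (d + 3) (en t)) = en t"
proof -
  have *: "opA (replicate (d + 3) t) ! i = t ! i" if i: "i < n" for i
  proof -
    have "replicate (d + 3) (t ! i) = [t ! i, t ! i, t ! i, t ! i] @ replicate (d - 1) (t ! i)"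
      using d by (cases d) (auto simp: numeral_3_eq_3)
    then show ?thesis
      using term_op_prod_nth[OF nary _ i, of "replicate (d + 3) t"]
        parallelogram_first[OF AsK[OF i] univD(2)[OF assms i] univD(2)[OF assms i] univD(2)[OF assms i]]
      by simp
  qed
  have u: "set (replicate (d + 3) t) \<subseteq> UA" using assms by (auto simp: set_replicate_conv_if)
  have "opA (replicate (d + 3) t) = t"
    using univD(1)[OF term_op_prod_in_univ[OF _ u]] univD(1)[OF assms] *
    by (intro nth_equalityI) auto
  then show ?thesis using vop_eq[OF _ u] by simp
qed

lemma vop_in:
  assumes "length ts = d + 3" "set ts \<subseteq> en ` B"
  shows "vop EA idx ts \<in> en ` B"
proof -
  define ts' where "ts' = map (inv_into B en) ts"
  have ts: "ts = map en ts'" "set ts' \<subseteq> B"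
    using assms(2) by (auto simp: ts'_def subset_iff f_inv_into_f inv_into_into intro!: map_idI[symmetric])
  have "vop EA idx ts = en (opA ts')"
    unfolding ts by (rule vop_eq) (use assms ts B_univ in auto)
  moreover have "opA ts' \<in> B"
    by (rule term_op_in_Sg[OF nary]) (use assms ts in auto)
  ultimately show ?thesis by simp
qed

lemma glued_in:
  assumes "{c, u, u'} \<subseteq> en ` B" "set vs \<subseteq> en ` B" "length vs = d - 1"
  shows "glued EA idx c u u' vs \<in> en ` B"
  unfolding glued_def
proof (rule glue_hom(1)[where \<phi> = "\<lambda>x. x" and q = "vop EA idx"])
  have "vs \<noteq> []" using assms d by auto
  then have "left (enc_list vs) \<in> set vs" by (cases vs) auto
  then show "{c, u, u', left (enc_list vs)} \<subseteq> en ` B" using assms by auto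
  fix ts assume "length ts = d - 1 + 4" "set ts \<subseteq> en ` B"
  then show "vop EA idx ts \<in> en ` B \<and> vop EA idx ts = vop EA idx (map (\<lambda>x. x) ts)"
    using vop_in d by simp
qed (use assms in auto)

lemma approximants_in:
  "a \<in> en ` B \<Longrightarrow> set T \<subseteq> en ` B \<Longrightarrow> set (approximants eb a J T S) \<subseteq> en ` B"
  unfolding approximants_def using lookup_in[of eb _ a T] by fastforce

lemma length_approximants: "length (approximants eb a J T S) = d - 1"
  by (simp add: approximants_def slots_def)

lemma refine_in:
  assumes "{a, c, u, u'} \<subseteq> en ` B" "set T \<subseteq> en ` B"
  shows "set (refine EA idx eb a c u u' Sl J T i) \<subseteq> en ` B"
proof -
  have "glued EA idx c u u' (approximants eb a J T (Node i S)) \<in> en ` B" for S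
    by (rule glued_in) (use assms approximants_in[OF _ assms(2)] length_approximants in auto)
  then show ?thesis unfolding refine_def by auto
qed

lemma sweep_in:
  assumes "{a, c, u, u'} \<subseteq> en ` B" "set pool \<subseteq> en ` B"
  shows "set (dec_list (right (sweep EA idx eb a c u u' Sl pool m))) \<subseteq> en ` B"
proof -
  have "set (dec_list (right st)) \<subseteq> en ` B \<Longrightarrow> set (dec_list (right (
     foldl (\<lambda>st i. Node (Node i (left st))
         (enc_list (refine EA idx eb a c u u' Sl (dec_list (left st)) (dec_list (right st)) i))) st l)))
      \<subseteq> en ` B" for l st
  proof (induction l arbitrary: st)
    case (Cons i l)
    show ?case unfolding foldl_Cons
      by (rule Cons.IH) (use refine_in[OF assms(1) Cons.prems] in simp)
  qed simp
  then show ?thesis unfolding sweep_def using assms(2) by simp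
qed

lemma advance_in:
  assumes "{a, c, fst_wit e, snd_wit e} \<subseteq> en ` B"
    and "set pool \<subseteq> en ` B"
  shows "advance EA idx eb a Sl pool fs c m e \<in> en ` B"
  unfolding advance_def
proof (rule vop_in)
  let ?r = "sweep EA idx eb a c (fst_wit e) (snd_wit e)
        Sl pool m"
  have "lookup eb (dec_list (left ?r)) a (dec_list (right ?r)) \<in> en ` B"
    using lookup_in[of eb "dec_list (left ?r)" a "dec_list (right ?r)"]
      sweep_in[OF assms, of eb Sl m] assms(1) by auto
  then show "set (replicate (d + 3) (lookup eb (dec_list (left ?r)) a (dec_list (right ?r)))) \<subseteq> en ` B"
    by (simp add: set_replicate_conv_if)
qed simp

text \<open>Soundness, for any target \<open>eb\<close>: all candidates arise from designated
  elements by \<open>P\<close>, and every default is \<open>a\<close>. So if the result is the code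
  of \<open>b\<close>, membership of \<open>b\<close> follows.\<close>

lemma reach_in:
  assumes a: "a \<in> en ` B" and pool: "set pool \<subseteq> en ` B"
    and fs: "\<And>e. e \<in> set fs \<Longrightarrow>
      {fst_wit e, snd_wit e} \<subseteq> en ` B"
  shows "reach EA idx eb a Sl pool fs \<in> en ` B"
proof -
  have f: "{fst_wit (fork_entry EA eb a c fs m),
      snd_wit (fork_entry EA eb a c fs m)} \<subseteq> en ` B" for c m
  proof (cases "fork_entry EA eb a c fs m \<in> set fs")
    case False
    then have "fork_entry EA eb a c fs m = enc_list [Leaf, Leaf, Leaf, a, a]"
      unfolding fork_entry_def
      using find_default_cases[of _ "enc_list [Leaf, Leaf, Leaf, a, a]" fs] by blast
    then show ?thesis using a by simp
  qed (rule fs)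
  have "c \<in> en ` B \<Longrightarrow>
     foldl (\<lambda>c m. advance EA idx eb a Sl pool fs c m (fork_entry EA eb a c fs m)) c l \<in> en ` B" for c l
  proof (induction l arbitrary: c)
    case (Cons m l)
    show ?case unfolding foldl_Cons
      by (rule Cons.IH, rule advance_in) (use f a Cons.prems pool in auto)
  qed simp
  then show ?thesis unfolding reach_def using lookup_in[of eb slots a pool] a pool by auto
qed

definition agrees :: "'a list \<Rightarrow> nat set \<Rightarrow> val \<Rightarrow> bool" where
  "agrees b J t \<longleftrightarrow> (\<forall>j\<in>J. vnth t (enc_nat j) = vnth (en b) (enc_nat j))"

lemma agrees_en:
  assumes "b \<in> UA" "t \<in> UA" "J \<subseteq> {..<n}"
  shows "agrees b J (en t) \<longleftrightarrow> (\<forall>j\<in>J. t ! j = b ! j)"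
proof -
  have "vnth (en t) (enc_nat j) = vnth (en b) (enc_nat j) \<longleftrightarrow> t ! j = b ! j" if "j \<in> J" for j
    using that assms univD(1) ce_inj[of t b j] by (auto simp: vnth_en)
  then show ?thesis by (simp add: agrees_def)
qed

lemma lookup_agrees:
  assumes "\<exists>t\<in>set T. agrees b (set J) t"
  shows "agrees b (set J) (lookup (en b) (map enc_nat J) a T)"
    and "lookup (en b) (map enc_nat J) a T \<in> set T"
proof -
  have "list_all (\<lambda>j. vnth t j = vnth (en b) j) (map enc_nat J) \<longleftrightarrow> agrees b (set J) t" for t
    by (auto simp: list_all_iff agrees_def)
  then show "agrees b (set J) (lookup (en b) (map enc_nat J) a T)"
    and "lookup (en b) (map enc_nat J) a T \<in> set T"
    using assms find_default_cases[of "\<lambda>t. list_all (\<lambda>j. vnth t j = vnth (en b) j) (map enc_nat J)" a T]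
    unfolding lookup_def by auto
qed

text \<open>The invariant of \<open>sweep\<close>. For \<open>i = m\<close> at most
  \<open>d - 1\<close> coordinates are involved, which local designations handle; for
  \<open>i = 0\<close> the interval alone contains all coordinates up to \<open>m\<close>.\<close>

definition covers :: "'a list \<Rightarrow> nat \<Rightarrow> nat \<Rightarrow> val list \<Rightarrow> bool" where
  "covers b m i T \<longleftrightarrow> (\<forall>S. length S = d - 2 \<longrightarrow> set S \<subseteq> {..<m} \<longrightarrow>
     (\<exists>t\<in>set T. agrees b (set S \<union> {i..m}) t))"

text \<open>Put \<open>i\<close> in front of \<open>S\<close> and leave out one entry at a time. A
  coordinate of \<open>i # S\<close> is then lost in at most one approximation and a coordinate of
  the interval in none, which is the situation of \<open>glue_agrees\<close>.\<close>

lemma refine_covers: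
  assumes b: "b \<in> UA" and c: "c \<in> B" "\<And>i. i < m \<Longrightarrow> c ! i = b ! i"
    and u: "{u, u'} \<subseteq> B" "\<And>i. i < m \<Longrightarrow> u ! i = u' ! i"
    and um: "u ! m = b ! m" "u' ! m = pow_op d P (As ! m) (c ! m) (b ! m)"
    and i: "i < m" and m: "m < n" and T: "set T \<subseteq> en ` B" "covers b m (Suc i) T" and a: "a \<in> en ` B"
  shows "covers b m i (refine EA idx (en b) a (en c) (en u) (en u') tuples
    (map enc_nat [Suc i..<Suc m]) T (enc_nat i))"
  unfolding covers_def
proof (intro allI impI)
  fix S :: "nat list" assume S: "length S = d - 2" "set S \<subseteq> {..<m}"
  define S' where "S' = i # S"
  have lS': "length S' = d - 1" and S'm: "set S' \<subseteq> {..<m}" using S i d by (auto simp: S'_def)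
  define J where "J = [Suc i..<Suc m]"
  define rem where "rem j = map (\<lambda>k. S' ! k) (filter (\<lambda>k. k \<noteq> j) [0..<d - 1])" for j
  define vs where "vs = approximants (en b) a (map enc_nat J) T (Node (enc_nat i) (enc_list (map enc_nat S)))"
  have Nd: "Node (enc_nat i) (enc_list (map enc_nat S)) = enc_list (map enc_nat S')" by (simp add: S'_def)
  have lvs: "length vs = d - 1" by (simp add: vs_def length_approximants)
  have vsj: "vs ! j = lookup (en b) (map enc_nat (rem j @ J)) a T" if j: "j < d - 1" for j
  proof -
    have "filter (\<lambda>k. k \<noteq> enc_nat j) slots = map enc_nat (filter (\<lambda>k. k \<noteq> j) [0..<d - 1])"
      by (simp add: slots_def filter_map o_def)
    then have "map (\<lambda>k. vnth (enc_list (map enc_nat S')) k) (filter (\<lambda>k. k \<noteq> enc_nat j) slots) =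
        map enc_nat (rem j)" using lS' by (simp add: rem_def)
    then show ?thesis using j unfolding vs_def Nd approximants_def by (simp add: slots_def)
  qed
  have rem: "length (rem j) = d - 2" "set (rem j) \<subseteq> {..<m}" if "j < d - 1" for j
    using length_filter_neq[OF that] S'm lS' by (auto simp: rem_def subset_iff)
  have J: "set J = {Suc i..m}" by (auto simp: J_def)
  have ex: "\<exists>t\<in>set T. agrees b (set (rem j @ J)) t" if "j < d - 1" for j
    using T(2) rem[OF that] J unfolding covers_def by simp
  have vs1: "vs ! j \<in> set T" "agrees b (set (rem j) \<union> {Suc i..m}) (vs ! j)" if "j < d - 1" for j
    using lookup_agrees[OF ex[OF that]] vsj[OF that] J by auto
  have "\<exists>t. \<forall>j<d - 1. t j \<in> B \<and> vs ! j = en (t j)"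
  proof -
    have "\<forall>j. \<exists>t. j < d - 1 \<longrightarrow> t \<in> B \<and> vs ! j = en t" using vs1(1) T(1) by blast
    then show ?thesis by (rule choice[THEN ex_forward]) auto
  qed
  then obtain t where t: "\<And>j. j < d - 1 \<Longrightarrow> t j \<in> B \<and> vs ! j = en (t j)" by blast
  define ws where "ws = map t [0..<d - 1]"
  have lws: "length ws = d - 1" by (simp add: ws_def)
  have wsB: "set ws \<subseteq> B" using t by (auto simp: ws_def)
  have vs: "vs = map en ws" using lvs t by (intro nth_equalityI) (auto simp: ws_def)
  have wne: "ws \<noteq> []" using lws d by auto
  have bc: "{b, c, u, u'} \<subseteq> UA" using b c u B_univ by auto
  have ag: "ws ! j ! k = b ! k" if "j < d - 1" "k \<in> set (rem j) \<union> {Suc i..m}" for j k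
  proof -
    have "set (rem j) \<union> {Suc i..m} \<subseteq> {..<n}" using rem(2)[OF that(1)] m by auto
    then show ?thesis using vs1(2)[OF that(1)] that t[OF that(1)] b B_univ agrees_en[of b "t j"]
      by (auto simp: ws_def)
  qed
  define g where "g = glue (d - 1) (opA) c u u' (hd ws) ws"
  have hom1: "opA ts \<in> B \<and> en (opA ts) = vop EA idx (map en ts)"
    if "length ts = d - 1 + 4" "set ts \<subseteq> B" for ts
  proof -
    have "length ts = d + 3" "set ts \<subseteq> UA" using that d B_univ by auto
    then show ?thesis using term_op_in_Sg[OF nary _ that(2)] vop_eq by simp
  qed
  have "{c, u, u', hd ws} \<subseteq> B" using c u wsB wne by auto
  from glue_hom[where X = B and q = "vop EA idx" and \<phi> = en and p = "opA",
      OF hom1 this wsB lws]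
  have hom: "g \<in> B" "en g = glue (d - 1) (vop EA idx) (en c) (en u) (en u') (en (hd ws)) (map en ws)"
    unfolding g_def by auto
  have "left (enc_list vs) = en (hd ws)" unfolding vs using wne by (cases ws) auto
  then have gl: "glued EA idx (en c) (en u) (en u') vs = en g"
    unfolding glued_def using vs hom(2) by simp
  have "g ! k = b ! k" if k: "k \<in> set S \<union> {i..m}" for k
    unfolding g_def
  \<comment> \<open>The old coordinates stop before \<open>m\<close>: there \<open>c\<close> is
    already right, while \<open>m\<close> is the new coordinate.\<close>
  proof (rule glue_agrees[OF As(1) bc _ lws, where I = "set S' \<union> {Suc i..<m}" and m = m])
    show "set ws \<subseteq> UA" using wsB B_univ by auto
    show "set S' \<union> {Suc i..<m} \<subseteq> {..<n}" using S'm m by auto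
    show "c ! k = b ! k" "u ! k = u' ! k" if "k \<in> set S' \<union> {Suc i..<m}" for k
      using that c(2) u(2) S'm by auto
    show "ws ! j ! m = b ! m" if "j < d - 1" for j using ag[OF that, of m] i by auto
    show "k \<in> insert m (set S' \<union> {Suc i..<m})" using k by (auto simp: S'_def)
    show "\<exists>j<d - 1. \<forall>j'<d - 1. j' \<noteq> j \<longrightarrow> ws ! j' ! k = b ! k" if k: "k \<in> set S' \<union> {Suc i..<m}" for k
    proof (cases "k \<in> set S'")
      case True
      then obtain j where j: "j < d - 1" "k = S' ! j" using lS' by (auto simp: in_set_conv_nth)
      \<comment> \<open>Dropping a position other than \<open>j\<close> keeps the occurrence of
        \<open>k\<close> at \<open>j\<close>.\<close>
      have "k \<in> set (rem j')" if "j' \<noteq> j" for j'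
        using j that by (auto simp: rem_def)
      then show ?thesis using j ag by (intro exI[of _ j]) auto
    next
      case False
      \<comment> \<open>A coordinate of the interval is right in all approximations, so any index
        may be named as the exception.\<close>
      then show ?thesis using k ag d by (intro exI[of _ 0]) auto
    qed
  qed (use um m in auto)
  moreover have "set S \<union> {i..m} \<subseteq> {..<n}" using S(2) m by auto
  ultimately have "agrees b (set S \<union> {i..m}) (en g)"
    using agrees_en[OF b, of g "set S \<union> {i..m}"] hom(1) B_univ by blast
  moreover have "en g \<in> set (refine EA idx (en b) a (en c) (en u) (en u') tuples
    (map enc_nat [Suc i..<Suc m]) T (enc_nat i))"
  proof -
    have "enc_list (map enc_nat S) \<in> set tuples"
      using S m by (intro set_index_tuples) auto
    then show ?thesis unfolding refine_def using gl by (auto simp: vs_def J_def intro!: rev_image_eqI)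
  qed
  ultimately show "\<exists>t\<in>set (refine EA idx (en b) a (en c) (en u) (en u') tuples
    (map enc_nat [Suc i..<Suc m]) T (enc_nat i)). agrees b (set S \<union> {i..m}) t" by blast
qed

lemma sweep_covers:
  assumes b: "b \<in> UA" and c: "c \<in> B" "\<And>i. i < m \<Longrightarrow> c ! i = b ! i"
    and u: "{u, u'} \<subseteq> B" "\<And>i. i < m \<Longrightarrow> u ! i = u' ! i"
    and um: "u ! m = b ! m" "u' ! m = pow_op d P (As ! m) (c ! m) (b ! m)"
    and m: "m < n" and pool: "set pool \<subseteq> en ` B" "covers b m m pool" and a: "a \<in> en ` B"
    and r: "r = sweep EA idx (en b) a (en c) (en u) (en u') tuples pool (enc_nat m)"
  shows "left r = enc_list (map enc_nat [0..<Suc m])" and "covers b m 0 (dec_list (right r))"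
proof -
  let ?f = "\<lambda>st i. Node (Node i (left st)) (enc_list (refine EA idx (en b) a (en c) (en u) (en u')
     tuples (dec_list (left st)) (dec_list (right st)) i))"
  have "left (foldl ?f st (map enc_nat (rev [0..<i]))) = enc_list (map enc_nat [0..<Suc m]) \<and>
      covers b m 0 (dec_list (right (foldl ?f st (map enc_nat (rev [0..<i])))))"
    if "i \<le> m" "left st = enc_list (map enc_nat [i..<Suc m])" "covers b m i (dec_list (right st))"
      "set (dec_list (right st)) \<subseteq> en ` B" for i st
    using that
  proof (induction i arbitrary: st)
    case (Suc i)
    have *: "foldl ?f st (map enc_nat (rev [0..<Suc i])) =
        foldl ?f (?f st (enc_nat i)) (map enc_nat (rev [0..<i]))" by simp
    show ?case unfolding *
    proof (rule Suc.IH)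
      have "[i..<Suc m] = i # [Suc i..<Suc m]" using Suc.prems by (simp add: upt_conv_Cons)
      then show "left (?f st (enc_nat i)) = enc_list (map enc_nat [i..<Suc m])"
        using Suc.prems by simp
      show "covers b m i (dec_list (right (?f st (enc_nat i))))"
        using refine_covers[OF b c u um _ m Suc.prems(4,3) a] Suc.prems by simp
      show "set (dec_list (right (?f st (enc_nat i)))) \<subseteq> en ` B"
        using refine_in[OF _ Suc.prems(4)] a c u by simp
    qed (use Suc.prems in simp)
  qed simp
  from this[of m "Node (enc_list [enc_nat m]) (enc_list pool)"] pool
  show "left r = enc_list (map enc_nat [0..<Suc m])" and "covers b m 0 (dec_list (right r))"
    unfolding r sweep_def by simp_all
qed

text \<open>Designations exist for exactly \<open>d - 1\<close> coordinates, so \<open>J\<close> is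
  enlarged to such a set, for which \<open>d \<le> n\<close> leaves room. The image under
  \<open>Suc\<close> passes to the numbering from 1.\<close>

lemma pool_agrees:
  assumes rep: "standardized_rep d P As B R r F u" and ls: "set ls = local_indices d n B"
    and b: "b \<in> B" and J: "J \<subseteq> {..<n}" "card J \<le> d - 1" and dn: "d \<le> n"
  shows "\<exists>t\<in>set (map (\<lambda>(I, c). en (r (I, c))) ls). agrees b J t"
proof -
  obtain I where I: "J \<subseteq> I" "I \<subseteq> {..<n}" "card I = d - 1"
    using exists_subset_between[OF J(2) _ J(1)] dn le_trans[OF diff_le_self dn] by auto
  let ?I = "Suc ` I" and ?t = "r (Suc ` I, proj (Suc ` I) b)"
  have fin: "finite ?I" using finite_subset[OF I(2)] by simp
  have l: "(?I, proj ?I b) \<in> local_indices d n B"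
    using I b by (auto simp: local_indices_def card_image)
  then have t: "?t \<in> R" "proj ?I ?t = proj ?I b" using standardized_repD(2,3)[OF rep] by auto
  then have tB: "?t \<in> B" using standardized_repD(1)[OF rep] by blast
  have "?t ! j = b ! j" if "j \<in> J" for j
  proof -
    have "Suc j \<in> set (sorted_list_of_set ?I)" using that I fin by auto
    then show ?thesis using t(2) unfolding proj_def map_eq_conv by fastforce
  qed
  then have "agrees b J (en ?t)" using agrees_en[OF _ _ J(1)] b tB B_univ by blast
  then show ?thesis using l ls by (auto intro!: bexI[of _ "(?I, proj ?I b)"])
qed

definition enc_fork :: "(nat \<times> 'a \<times> 'a \<Rightarrow> 'a list \<times> 'a list) \<Rightarrow> nat \<times> 'a \<times> 'a \<Rightarrow> val" where
  "enc_fork u = (\<lambda>(m, \<gamma>, \<delta>). enc_list [enc_nat m, ce \<gamma>, ce \<delta>, en (fst (u (m, \<gamma>, \<delta>))), en (snd (u (m, \<gamma>, \<delta>)))])"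

text \<open>Since \<open>b\<close> and \<open>c\<close> share the prefix before \<open>m\<close>,
  (\<delta>, \<gamma>) is a fork of \<open>B\<close>, and
  \<open>(\<delta>, \<gamma>\<^sup>\<delta>)\<close> lies in \<open>fork'\<close> and hence in
  \<open>F\<close>. The search compares codes; injectivity of \<open>ce\<close> on the carriers
  recovers the values.\<close>

lemma fork_entry_found:
  assumes rep: "standardized_rep d P As B R r F u" and fs: "set fs = fork_indices d n F"
    and b: "b \<in> B" and c: "c \<in> B" "\<And>i. i < m \<Longrightarrow> c ! i = b ! i" and m: "d - 1 \<le> m" "m < n"
  shows "\<exists>w w'. {w, w'} \<subseteq> B \<and> (\<forall>i<m. w ! i = w' ! i) \<and> w ! m = b ! m \<and>
     w' ! m = pow_op d P (As ! m) (c ! m) (b ! m) \<and>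
     fst_wit (fork_entry EA (en b) a (en c) (map (enc_fork u) fs) (enc_nat m)) = en w \<and>
     snd_wit (fork_entry EA (en b) a (en c) (map (enc_fork u) fs) (enc_nat m)) = en w'"
proof -
  let ?\<gamma> = "c ! m" and ?\<delta> = "b ! m"
  let ?\<epsilon> = "pow_op d P (As ! m) ?\<gamma> ?\<delta>"
  have bU: "b \<in> UA" and cU: "c \<in> UA" using b c B_univ by auto
  note A = AsK[OF m(2)]
  have gU: "?\<gamma> \<in> univ (As ! m)" "?\<delta> \<in> univ (As ! m)" using univD(2)[OF _ m(2)] bU cU by auto
  have eU: "?\<epsilon> \<in> univ (As ! m)" using pow_op_in[OF A] gU by auto
  have dm: "d \<le> Suc m" "Suc m \<le> n" using m by auto
  have "take m b = take m c" using c(2) univD(1)[OF bU] univD(1)[OF cU] m by (intro nth_equalityI) auto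
  then have "(?\<delta>, ?\<gamma>) \<in> fork (Suc m) B"
    using b c(1) unfolding fork_def witnesses_fork_def by auto
  then have "(?\<delta>, ?\<epsilon>) \<in> fork' d P As (Suc m) B" unfolding fork'_def by auto
  then have "(?\<delta>, ?\<epsilon>) \<in> F (Suc m)" using standardized_repD(4)[OF rep dm] by blast
  then have ix: "(Suc m, ?\<delta>, ?\<epsilon>) \<in> set fs" using fs dm by (auto simp: fork_indices_def)
  have tab: "op_table (Node (vnth EA (enc_nat m)) (enc_list
         ([vnth (en c) (enc_nat m), vnth (en b) (enc_nat m), vnth (en b) (enc_nat m), vnth (en c) (enc_nat m)]
          @ replicate (d - 1) (vnth (en b) (enc_nat m))))) = ce ?\<epsilon>"
  proof -
    have "op_table (Node (ca (As ! m)) (enc_tuple ce ([?\<gamma>, ?\<delta>, ?\<delta>, ?\<gamma>] @ replicate (d - 1) ?\<delta>))) = ce ?\<epsilon>"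
      unfolding pow_op_eq
      by (rule op_table_eq[OF A]) (use gU d in \<open>auto simp: set_replicate_conv_if\<close>)
    moreover have "vnth EA (enc_nat m) = ca (As ! m)" using m by simp
    moreover have "vnth (en c) (enc_nat m) = ce ?\<gamma>" "vnth (en b) (enc_nat m) = ce ?\<delta>"
      using vnth_en univD(1) bU cU m by auto
    ultimately show ?thesis by (simp add: enc_tuple_def)
  qed
  define p where "p e \<longleftrightarrow> left e = enc_nat (Suc m) \<and> left (right e) = ce ?\<delta> \<and> left (right (right e)) = ce ?\<epsilon>" for e
  define e where "e = fork_entry EA (en b) a (en c) (map (enc_fork u) fs) (enc_nat m)"
  have e': "e = find_default p (enc_list [Leaf, Leaf, Leaf, a, a]) (map (enc_fork u) fs)"
    unfolding e_def fork_entry_def tab p_def using vnth_en[of b m] univD(1)[OF bU] m by simp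
  have "p (enc_fork u (Suc m, ?\<delta>, ?\<epsilon>))" by (simp add: p_def enc_fork_def)
  then have "e \<in> set (map (enc_fork u) fs)" "p e"
    using find_default_cases[of p "enc_list [Leaf, Leaf, Leaf, a, a]" "map (enc_fork u) fs"] ix
    unfolding e'[symmetric] by auto
  then obtain m' \<gamma>' \<delta>' where h: "(m', \<gamma>', \<delta>') \<in> fork_indices d n F" "e = enc_fork u (m', \<gamma>', \<delta>')"
    using fs by auto
  have m': "m' = Suc m" and ceq: "ce \<gamma>' = ce ?\<delta>" "ce \<delta>' = ce ?\<epsilon>"
    using \<open>p e\<close> h(2) by (auto simp: p_def enc_fork_def simp del: enc_nat_simps)
  let ?w = "fst (u (m', \<gamma>', \<delta>'))" and ?w' = "snd (u (m', \<gamma>', \<delta>'))"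
  have w: "u (m', \<gamma>', \<delta>') \<in> R \<times> R" "witnesses_fork m' (u (m', \<gamma>', \<delta>')) (\<gamma>', \<delta>')"
    using standardized_repD(6,7)[OF rep h(1)] .
  have wB: "?w \<in> B" "?w' \<in> B" using w(1) standardized_repD(1)[OF rep] by auto
  then have wU: "?w \<in> UA" "?w' \<in> UA" using B_univ by auto
  have tk: "take m ?w = take m ?w'" and wm: "?w ! m = \<gamma>'" "?w' ! m = \<delta>'"
    using w(2) m' unfolding witnesses_fork_def by auto
  have "?w ! i = ?w' ! i" if "i < m" for i using tk that by (metis nth_take)
  moreover have "?w ! m = ?\<delta>" using ce_inj[OF wU(1) bU m(2)] wm ceq by simp
  moreover have "?w' ! m = ?\<epsilon>"
  proof -
    have "?w' ! m \<in> univ (As ! m)" using univD(2)[OF wU(2) m(2)] .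
    then show ?thesis using inje A eU ceq(2) wm(2) by (auto dest!: inj_onD)
  qed
  moreover have "fst_wit e = en ?w" "snd_wit e = en ?w'"
    using h(2) by (simp_all add: enc_fork_def)
  ultimately show ?thesis using wB unfolding e_def[symmetric] by blast
qed

lemma reach_complete:
  assumes rep: "standardized_rep d P As B R r F u" and ls: "set ls = local_indices d n B"
    and fs: "set fs = fork_indices d n F" and b: "b \<in> B" and dn: "d \<le> n" and a: "a \<in> en ` B"
    and pool: "pool = map (\<lambda>(I, c). en (r (I, c))) ls" "set pool \<subseteq> en ` B"
  shows "reach EA idx (en b) a tuples pool (map (enc_fork u) fs) = en b"
proof -
  let ?f = "\<lambda>c m. advance EA idx (en b) a tuples pool (map (enc_fork u) fs) c m
     (fork_entry EA (en b) a c (map (enc_fork u) fs) m)"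
  have bU: "b \<in> UA" using b B_univ by auto
  have step: "\<exists>c'\<in>B. ?f (en c) (enc_nat m) = en c' \<and> (\<forall>i<Suc m. c' ! i = b ! i)"
    if c: "c \<in> B" "\<forall>i<m. c ! i = b ! i" and m: "d - 1 \<le> m" "m < n" for c m
  proof -
    define e where "e = fork_entry EA (en b) a (en c) (map (enc_fork u) fs) (enc_nat m)"
    obtain w w' where w: "{w, w'} \<subseteq> B" "\<forall>i<m. w ! i = w' ! i" "w ! m = b ! m"
      "w' ! m = pow_op d P (As ! m) (c ! m) (b ! m)" "fst_wit e = en w"
      "snd_wit e = en w'"
      using fork_entry_found[OF rep fs b c(1) _ m, of a] c(2) unfolding e_def by blast
    have "covers b m m pool" unfolding covers_def
    proof (intro allI impI)
      fix S :: "nat list" assume S: "length S = d - 2" "set S \<subseteq> {..<m}"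
      have "card (set S \<union> {m..m}) \<le> d - 1"
        using card_length[of S] S(1) card_Un_le[of "set S" "{m..m}"] d by auto
      then show "\<exists>t\<in>set pool. agrees b (set S \<union> {m..m}) t"
        unfolding pool(1) using S(2) m by (intro pool_agrees[OF rep ls b _ _ dn]) auto
    qed
    define r where "r = sweep EA idx (en b) a (en c) (en w) (en w') tuples pool (enc_nat m)"
    have r: "left r = enc_list (map enc_nat [0..<Suc m])" "covers b m 0 (dec_list (right r))"
      using sweep_covers[OF bU c(1) _ w(1) _ w(3,4) m(2) pool(2) \<open>covers b m m pool\<close> a r_def] c(2) w(2)
      by auto
    define t where "t = lookup (en b) (map enc_nat [0..<Suc m]) a (dec_list (right r))"
    \<comment> \<open>With the interval \<open>{0..m}\<close> the tuple \<open>S\<close> no longer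
      matters; zeros are a dummy, admissible because \<open>m\<close> is positive.\<close>
    have "set (replicate (d - 2) 0) \<subseteq> {..<m}" using m d by (auto simp: set_replicate_conv_if)
    then obtain t0 where "t0 \<in> set (dec_list (right r))" "agrees b (set (replicate (d - 2) 0) \<union> {0..m}) t0"
      using r(2) unfolding covers_def by (meson length_replicate)
    then have "\<exists>t\<in>set (dec_list (right r)). agrees b (set [0..<Suc m]) t"
      by (auto simp: agrees_def intro!: bexI[of _ t0])
    from lookup_agrees[OF this, of a] have t: "agrees b (set [0..<Suc m]) t" "t \<in> set (dec_list (right r))"
      unfolding t_def by auto
    have "set (dec_list (right r)) \<subseteq> en ` B" unfolding r_def
      by (rule sweep_in) (use a c w pool in auto)
    then obtain c' where c': "c' \<in> B" "t = en c'" using t(2) by auto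
    have c'U: "c' \<in> UA" using c' B_univ by auto
    have "?f (en c) (enc_nat m) = en c'"
      unfolding e_def[symmetric] advance_def w(5,6) r_def[symmetric] r(1) dec_enc_list t_def[symmetric] c'(2)
      by (rule vop_idem[OF c'U])
    moreover have "\<forall>i<Suc m. c' ! i = b ! i"
    proof -
      have "set [0..<Suc m] \<subseteq> {..<n}" using m by auto
      then have "\<forall>j\<in>set [0..<Suc m]. c' ! j = b ! j" using agrees_en[OF bU c'U] t(1) c'(2) by blast
      then show ?thesis by (simp del: upt_Suc)
    qed
    ultimately show ?thesis using c' by blast
  qed
  have loop: "\<exists>c'\<in>B. foldl ?f (en c) (map enc_nat [m..<n]) = en c' \<and> (\<forall>i<n. c' ! i = b ! i)"
    if "c \<in> B" "\<forall>i<m. c ! i = b ! i" "d - 1 \<le> m" "m \<le> n" for c m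
    using that
  proof (induction "n - m" arbitrary: c m)
    case (Suc k)
    then have mn: "m < n" by auto
    obtain c1 where c1: "c1 \<in> B" "?f (en c) (enc_nat m) = en c1" "\<forall>i<Suc m. c1 ! i = b ! i"
      using step[OF Suc.prems(1-3) mn] by blast
    have "\<exists>c'\<in>B. foldl ?f (en c1) (map enc_nat [Suc m..<n]) = en c' \<and> (\<forall>i<n. c' ! i = b ! i)"
      by (rule Suc.hyps(1)) (use Suc c1 mn in auto)
    then show ?case using c1(2) mn by (simp add: upt_conv_Cons)
  qed auto
  have sub: "set [0..<d - 1] \<subseteq> {..<n}" using dn by auto
  have "\<exists>t\<in>set pool. agrees b (set [0..<d - 1]) t"
    unfolding pool(1) by (rule pool_agrees[OF rep ls b sub _ dn]) simp
  from lookup_agrees[OF this, of a] obtain c where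
    c: "c \<in> B" "lookup (en b) slots a pool = en c" "agrees b (set [0..<d - 1]) (en c)"
    using pool(2) unfolding slots_def by auto
  have "c \<in> UA" using c B_univ by auto
  then have "\<forall>i<d - 1. c ! i = b ! i" using agrees_en[OF bU _ sub] c(3) by auto
  from loop[OF c(1) this order_refl le_trans[OF diff_le_self dn]] obtain c' where
    c': "c' \<in> B" "foldl ?f (en c) (map enc_nat [d - 1..<n]) = en c'" "\<forall>i<n. c' ! i = b ! i"
    by blast
  have "c' = b" using c' univD(1) bU B_univ by (intro nth_equalityI) auto
  moreover have "dec_list (vdrop (enc_nat (d - 1)) (enc_list idx)) = map enc_nat [d - 1..<n]"
    by (simp add: drop_map)
  ultimately show ?thesis unfolding reach_def c(2) using c'(2) by simp
qed

lemma decide_correct: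
  assumes rep: "standardized_rep d P As B R r F u" and enc: "encodes_rep ce d n B r F u v"
    and b: "b \<in> UA" and dn: "d \<le> n"
  shows "decide (Node (Node (enc_gens ca ce As as) (en b)) v) = enc_bool (b \<in> B)"
proof -
  obtain ls fs where ls: "set ls = local_indices d n B" and fs: "set fs = fork_indices d n F"
    and v: "v = Node (enc_list (map (\<lambda>(I, c). enc_list
          [enc_list (map enc_nat (sorted_list_of_set I)), en c, en (r (I, c))]) ls))
       (enc_list (map (enc_fork u) fs))"
    using enc unfolding encodes_rep_def enc_fork_def by blast
  define pool where "pool = map (\<lambda>(I, c). en (r (I, c))) ls"
  let ?a = "en (hd as)"
  note RB = standardized_repD(1)[OF rep]
  have pool: "set pool \<subseteq> en ` B"
  proof -
    have "r l \<in> B" if "l \<in> set ls" for l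
      using that RB standardized_repD(2)[OF rep, of "fst l" "snd l"] unfolding ls by auto
    then show ?thesis by (auto simp: pool_def)
  qed
  have a: "?a \<in> en ` B" using hd_as by blast
  have e: "{fst_wit e, snd_wit e} \<subseteq> en ` B"
    if e: "e \<in> set (map (enc_fork u) fs)" for e
  proof -
    obtain m \<gamma> \<delta> where h: "(m, \<gamma>, \<delta>) \<in> fork_indices d n F" "e = enc_fork u (m, \<gamma>, \<delta>)" using e fs by auto
    then have "u (m, \<gamma>, \<delta>) \<in> R \<times> R" using standardized_repD(6)[OF rep] by blast
    then show ?thesis using h(2) RB by (auto simp: enc_fork_def)
  qed
  have "map (\<lambda>e. left (right (right e))) (dec_list (left v)) = pool"
    unfolding v pool_def by (auto simp: case_prod_beta)
  moreover have "dec_list (right v) = map (enc_fork u) fs" unfolding v by simp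
  moreover have "left (enc_list (map en as)) = ?a" using as(1) by (cases as) auto
  ultimately have dec: "decide (Node (Node (enc_gens ca ce As as) (en b)) v) =
    enc_bool (reach EA idx (en b) ?a tuples pool (map (enc_fork u) fs) = en b)"
    unfolding decide_def enc_gens_def by simp
  have "reach EA idx (en b) ?a tuples pool (map (enc_fork u) fs) = en b \<longleftrightarrow> b \<in> B"
  proof
    assume "b \<in> B"
    then show "reach EA idx (en b) ?a tuples pool (map (enc_fork u) fs) = en b"
      by (rule reach_complete[OF rep ls fs _ dn a pool_def pool])
  next
    assume "reach EA idx (en b) ?a tuples pool (map (enc_fork u) fs) = en b"
    moreover have "reach EA idx (en b) ?a tuples pool (map (enc_fork u) fs) \<in> en ` B"
      by (rule reach_in[OF a pool e])
    ultimately obtain b' where "b' \<in> B" "en b = en b'" by auto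
    then show "b \<in> B" using en_inj[OF b, of b'] B_univ by auto
  qed
  then show ?thesis using dec by simp
qed

end

section \<open>Size of standardized representations and the single-call reduction\<close>

context smp_setting
begin

abbreviation CR where "CR \<equiv> CompactRep d P L K ca ce"
abbreviation carriers where "carriers \<equiv> \<Union>A\<in>K. univ A"

lemma finite_carriers: "finite carriers"
  using finK finA by auto

lemma smp_instanceI: "valid_gens K As as \<Longrightarrow> smp_instance L V K d P ca ce As as"
  by unfold_locales

text \<open>Solutions are described through some decoding of the instance; uniqueness of the
  decoding ties them to the given generators.\<close>

lemma enc_gens_inj:
  assumes "valid_gens K As as" "valid_gens K As' as'" "enc_gens ca ce As as = enc_gens ca ce As' as'"
  shows "As = As' \<and> as = as'"
proof -
  interpret i1: smp_instance L V K d P ca ce As as by (rule smp_instanceI) fact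
  interpret i2: smp_instance L V K d P ca ce As' as' by (rule smp_instanceI) fact
  have "map ca As = map ca As'" "map (enc_tuple ce) as = map (enc_tuple ce) as'"
    using assms(3) unfolding enc_gens_def by auto
  moreover have "inj_on ca (set As \<union> set As')"
    by (rule inj_on_subset[OF inja]) (use i1.As(1) i2.As(1) in auto)
  moreover have "inj_on (enc_tuple ce) (set as \<union> set as')"
  proof (rule inj_onI)
    fix s t assume "s \<in> set as \<union> set as'" "t \<in> set as \<union> set as'" "enc_tuple ce s = enc_tuple ce t"
    moreover have "set s \<subseteq> carriers" if "s \<in> set as \<union> set as'" for s
      using that i1.as(2) i2.as(2) i1.univ_sub[of s] i2.univ_sub[of s] by blast
    ultimately show "s = t" using enc_tuple_inj by blast
  qed
  ultimately show ?thesis by (auto dest: inj_on_map_eq_map)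
qed

definition code_bound :: nat where
  "code_bound = Max (insert 0 ((\<lambda>a. vsize (ce a)) ` carriers))"

lemma vsize_ce: "a \<in> carriers \<Longrightarrow> vsize (ce a) \<le> code_bound"
  unfolding code_bound_def using finite_carriers by (intro Max_ge) auto

text \<open>Number of designations times size of one, for local and for fork designations. The
  summands 4 and 6 count the list cells of entries with three and with five fields.\<close>

definition rep_bound :: "nat \<Rightarrow> nat" where
  "rep_bound n = (n ^ (d - 1) * card carriers ^ (d - 1)) *
      (((d - 1) * (2 * n + 1 + 1) + 1) + ((d - 1) * (code_bound + 1) + 1) + (n * (code_bound + 1) + 1) + 4 + 1) + 1 +
    ((n + 1) * (card carriers * card carriers)) *
      ((2 * n + 1) + code_bound + code_bound + (n * (code_bound + 1) + 1) + (n * (code_bound + 1) + 1) + 6 + 1) + 1 + 1"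

lemma vsize_enc_tuple:
  "set t \<subseteq> carriers \<Longrightarrow> vsize (enc_tuple ce t) \<le> length t * (code_bound + 1) + 1"
  unfolding enc_tuple_def using vsize_ce
  by (intro order_trans[OF vsize_enc_list_le[where C = code_bound]]) auto

end

context smp_instance
begin

lemma proj_in:
  assumes "c \<in> proj I ` B" "I \<subseteq> {1..n}"
  shows "set c \<subseteq> carriers" "length c = card I"
proof -
  obtain t where t: "t \<in> B" "c = proj I t" using assms by auto
  have tU: "t \<in> univ (prod_alg As)" using t B_univ by auto
  have fin: "finite I" using assms(2) finite_subset by blast
  show "length c = card I" using t by (simp add: proj_def)
  have "t ! (i - 1) \<in> set t" if "i \<in> I" for i
  proof -
    have "1 \<le> i" "i \<le> n" using that assms(2) by auto
    then show ?thesis using univD(1)[OF tU] by (intro nth_mem) linarith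
  qed
  then have "set c \<subseteq> set t" using t fin by (auto simp: proj_def)
  then show "set c \<subseteq> carriers" using univ_sub[OF tU] by auto
qed

lemma card_local_indices:
  "card (local_indices d n B) \<le> n ^ (d - 1) * card carriers ^ (d - 1)"
proof -
  let ?S = "{l. set l \<subseteq> {1..n} \<and> length l = d - 1} \<times> {c. set c \<subseteq> carriers \<and> length c = d - 1}"
  let ?f = "\<lambda>(I, c). (sorted_list_of_set I, c)"
  have fin: "finite I" if "(I, c) \<in> local_indices d n B" for I c
    using that finite_subset[of I "{1..n}"] by (auto simp: local_indices_def)
  have "inj_on ?f (local_indices d n B)"
  proof (rule inj_onI)
    fix x y assume xy: "x \<in> local_indices d n B" "y \<in> local_indices d n B" "?f x = ?f y"
    obtain I c I' c' where [simp]: "x = (I, c)" "y = (I', c')" by (cases x, cases y)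
    have "I = I'" using xy fin[of I c] fin[of I' c'] by (simp add: sorted_list_of_set_inject)
    then show "x = y" using xy by simp
  qed
  moreover have "?f ` local_indices d n B \<subseteq> ?S"
  proof
    fix y assume "y \<in> ?f ` local_indices d n B"
    then obtain I c where I: "(I, c) \<in> local_indices d n B" "y = (sorted_list_of_set I, c)" by auto
    then show "y \<in> ?S" using fin[OF I(1)] proj_in[of c I] by (auto simp: local_indices_def)
  qed
  moreover have "finite ?S"
    by (intro finite_cartesian_product finite_lists_length_eq finite_carriers) simp
  ultimately have "card (local_indices d n B) \<le> card ?S" by (rule card_inj_on_le)
  also have "\<dots> = n ^ (d - 1) * card carriers ^ (d - 1)"
    by (simp add: card_cartesian_product card_lists_length_eq finite_carriers)
  finally show ?thesis .
qed

text \<open>The solution is free to choose \<open>F\<close>, but each pair in \<open>F\<close> has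
  witnesses in \<open>R\<close>, so its entries lie in the carriers and their number is
  bounded.\<close>

lemma fork_indices_subset:
  assumes "standardized_rep d P As B R r F u" and "d > 0"
  shows "fork_indices d n F \<subseteq> {..n} \<times> carriers \<times> carriers"
proof
  fix x assume x: "x \<in> fork_indices d n F"
  obtain m \<gamma> \<delta> where [simp]: "x = (m, \<gamma>, \<delta>)" by (cases x)
  have m: "d \<le> m" "m \<le> n" using x by (auto simp: fork_indices_def)
  have "u (m, \<gamma>, \<delta>) \<in> R \<times> R" "witnesses_fork m (u (m, \<gamma>, \<delta>)) (\<gamma>, \<delta>)"
    using standardized_repD(6,7)[OF assms(1)] x by auto
  then have "fst (u (m, \<gamma>, \<delta>)) \<in> B" "snd (u (m, \<gamma>, \<delta>)) \<in> B"
      "fst (u (m, \<gamma>, \<delta>)) ! (m - 1) = \<gamma>" "snd (u (m, \<gamma>, \<delta>)) ! (m - 1) = \<delta>"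
    using standardized_repD(1)[OF assms(1)] by (auto simp: witnesses_fork_def)
  moreover have "s ! (m - 1) \<in> carriers" if "s \<in> B" for s
  proof -
    have sU: "s \<in> univ (prod_alg As)" using that B_univ by auto
    have "s ! (m - 1) \<in> set s" using univD(1)[OF sU] m assms(2) by (intro nth_mem) auto
    then show ?thesis using univ_sub[OF sU] by auto
  qed
  ultimately have "\<gamma> \<in> carriers" "\<delta> \<in> carriers" by metis+
  then show "x \<in> {..n} \<times> carriers \<times> carriers" using m by auto
qed

lemma vsize_rep:
  assumes rep: "standardized_rep d P As B R r F u" and enc: "encodes_rep ce d n B r F u v"
  shows "vsize v \<le> rep_bound n"
proof -
  define cu where "cu = card carriers"
  define cb where "cb = code_bound"
  obtain ls fs where ls: "distinct ls" "set ls = local_indices d n B"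
    and fs: "distinct fs" "set fs = fork_indices d n F"
    and v: "v = Node (enc_list (map (\<lambda>(I, c). enc_list
          [enc_list (map enc_nat (sorted_list_of_set I)), en c, en (r (I, c))]) ls))
       (enc_list (map (\<lambda>(m, \<gamma>, \<delta>). enc_list
          [enc_nat m, ce \<gamma>, ce \<delta>, en (fst (u (m, \<gamma>, \<delta>))), en (snd (u (m, \<gamma>, \<delta>)))]) fs))"
    using enc unfolding encodes_rep_def by blast
  let ?C = "((d - 1) * (2 * n + 1 + 1) + 1) + ((d - 1) * (cb + 1) + 1) + (n * (cb + 1) + 1) + 4"
  let ?D = "(2 * n + 1) + cb + cb + (n * (cb + 1) + 1) + (n * (cb + 1) + 1) + 6"
  have tup: "vsize (en t) \<le> n * (cb + 1) + 1" if "t \<in> R" for t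
  proof -
    have "t \<in> univ (prod_alg As)" using that standardized_repD(1)[OF rep] B_univ by auto
    then show ?thesis using vsize_enc_tuple[OF univ_sub] univD(1) unfolding cb_def by metis
  qed
  have lb: "length ls \<le> n ^ (d - 1) * cu ^ (d - 1)"
    using distinct_card[OF ls(1)] ls(2) card_local_indices unfolding cu_def by simp
  have "card (fork_indices d n F) \<le> card ({..n} \<times> carriers \<times> carriers)"
    using d by (intro card_mono fork_indices_subset[OF rep])
      (auto intro!: finite_cartesian_product finA finK)
  then have fb: "length fs \<le> (n + 1) * (cu * cu)"
    using distinct_card[OF fs(1)] fs(2) unfolding cu_def by (simp add: card_cartesian_product)
  have le: "vsize e \<le> ?C" if "e \<in> set (map (\<lambda>(I, c). enc_list
          [enc_list (map enc_nat (sorted_list_of_set I)), en c, en (r (I, c))]) ls)" for e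
  proof -
    obtain I c where I: "(I, c) \<in> local_indices d n B"
      and e: "e = enc_list [enc_list (map enc_nat (sorted_list_of_set I)), en c, en (r (I, c))]"
      using \<open>e \<in> _\<close> ls(2) by auto
    have Ic: "I \<subseteq> {1..n}" "card I = d - 1" "c \<in> proj I ` B" using I by (auto simp: local_indices_def)
    have fin: "finite I" using Ic(1) finite_subset by blast
    have "vsize (enc_list (map enc_nat (sorted_list_of_set I))) \<le>
        length (map enc_nat (sorted_list_of_set I)) * ((2 * n + 1) + 1) + 1"
      by (rule vsize_enc_list_le) (use Ic(1) fin in auto)
    moreover have "vsize (en c) \<le> (d - 1) * (cb + 1) + 1"
      using vsize_enc_tuple[OF proj_in(1)[OF Ic(3,1)]] proj_in(2)[OF Ic(3,1)] Ic(2) unfolding cb_def by simp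
    moreover note tup[OF standardized_repD(2)[OF rep I]]
    ultimately show ?thesis unfolding e using Ic(2) by simp
  qed
  have fe: "vsize e \<le> ?D" if "e \<in> set (map (\<lambda>(m, \<gamma>, \<delta>). enc_list
          [enc_nat m, ce \<gamma>, ce \<delta>, en (fst (u (m, \<gamma>, \<delta>))), en (snd (u (m, \<gamma>, \<delta>)))]) fs)" for e
  proof -
    obtain m \<gamma> \<delta> where I: "(m, \<gamma>, \<delta>) \<in> fork_indices d n F"
      and e: "e = enc_list [enc_nat m, ce \<gamma>, ce \<delta>, en (fst (u (m, \<gamma>, \<delta>))), en (snd (u (m, \<gamma>, \<delta>)))]"
      using \<open>e \<in> _\<close> fs(2) by auto
    have m: "m \<le> n" "\<gamma> \<in> carriers" "\<delta> \<in> carriers"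
      using subsetD[OF fork_indices_subset[OF rep] I] d by auto
    have w: "fst (u (m, \<gamma>, \<delta>)) \<in> R" "snd (u (m, \<gamma>, \<delta>)) \<in> R"
      using standardized_repD(6)[OF rep I] by auto
    show ?thesis unfolding e using tup[OF w(1)] tup[OF w(2)] vsize_ce[OF m(2)] vsize_ce[OF m(3)] m(1)
      unfolding cb_def by simp
  qed
  have size: "vsize (enc_list l) \<le> k * (C + 1) + 1"
    if "\<And>e. e \<in> set l \<Longrightarrow> vsize e \<le> C" "length l \<le> k" for l C k
    using vsize_enc_list_le[of l C, OF that(1)] mult_le_mono1[OF that(2), of "C + 1"] by linarith
  have "vsize (left v) \<le> (n ^ (d - 1) * cu ^ (d - 1)) * (?C + 1) + 1"
    unfolding v left.simps by (rule size[OF le]) (use lb in simp_all)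
  moreover have "vsize (right v) \<le> ((n + 1) * (cu * cu)) * (?D + 1) + 1"
    unfolding v right.simps by (rule size[OF fe]) (use fb in simp_all)
  moreover have "vsize v = vsize (left v) + vsize (right v) + 1" unfolding v by simp
  ultimately show ?thesis unfolding rep_bound_def cu_def cb_def by linarith
qed

end

context smp_setting
begin

text \<open>The oracle may return any solution, and receiving it is charged by its size; so all
  solutions have to be short.\<close>

lemma CompactRep_solution_size:
  "\<exists>q :: nat poly. \<forall>x\<in>instances (CR). \<forall>y\<in>solutions (CR) x.
     vsize y \<le> poly q (vsize x)"
proof -
  have "poly_bounded (\<lambda>x. rep_bound (vsize x))" unfolding rep_bound_def by (intro pb)
  then obtain q where q: "\<And>x. rep_bound (vsize x) \<le> poly q (vsize x)" by (auto simp: poly_bounded_def)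
  have mono: "rep_bound i \<le> rep_bound j" if "i \<le> j" for i j
    unfolding rep_bound_def using that by (intro add_mono mult_mono power_mono) auto
  show ?thesis
  proof (intro exI[of _ q] ballI)
    fix x y assume "y \<in> solutions (CR) x"
    then obtain As as R r F u where x: "x = enc_gens ca ce As as" and v: "valid_gens K As as"
      and rep: "standardized_rep d P As (Sg L (prod_alg As) (set as)) R r F u"
      and enc: "encodes_rep ce d (length As) (Sg L (prod_alg As) (set as)) r F u y"
      unfolding CompactRep_def by auto
    interpret smp_instance L V K d P ca ce As as by (rule smp_instanceI[OF v])
    have "vsize y \<le> rep_bound (length As)" by (rule vsize_rep[OF rep enc])
    also have "\<dots> \<le> rep_bound (vsize x)"
      using length_dec_list[of "enc_list (map ca As)"] by (intro mono) (simp add: x enc_gens_def)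
    also note q
    finally show "vsize y \<le> poly q (vsize x)" .
  qed
qed

lemma decide_solution:
  assumes v: "valid_gens K As as" and b: "b \<in> univ (prod_alg As)" and dn: "d \<le> length As"
    and y: "y \<in> solutions (CR) (enc_gens ca ce As as)"
  shows "decide (Node (Node (enc_gens ca ce As as) (enc_tuple ce b)) y) =
    enc_bool (b \<in> Sg L (prod_alg As) (set as))"
proof -
  obtain As' as' R r F u where x: "enc_gens ca ce As as = enc_gens ca ce As' as'" and v': "valid_gens K As' as'"
    and rep: "standardized_rep d P As' (Sg L (prod_alg As') (set as')) R r F u"
    and enc: "encodes_rep ce d (length As') (Sg L (prod_alg As') (set as')) r F u y"
    using y unfolding CompactRep_def by auto
  have [simp]: "As' = As" "as' = as" using enc_gens_inj[OF v v' x] by auto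
  interpret smp_instance L V K d P ca ce As as by (rule smp_instanceI[OF v])
  show ?thesis using decide_correct[of R r F u y b] rep enc b dn by simp
qed

theorem SMP_from_one_call:
  "poly_time_solvable_with_calls {1} (SMP_from d L K ca ce) (CR)"
proof -
  obtain q :: "nat poly" where q: "\<And>x y. x \<in> instances (CR) \<Longrightarrow>
      y \<in> solutions (CR) x \<Longrightarrow> vsize y \<le> poly q (vsize x)"
    using CompactRep_solution_size by blast
  show ?thesis
  proof (rule poly_time_solvable_one_call[where pre = left and post = decide, OF _ fp_decide _ _ q])
    show "fp UNIV {} left" using fp_left[OF fp_id] .
    fix x assume "x \<in> instances (SMP_from d L K ca ce)"
    then obtain As as b where x: "x = Node (enc_gens ca ce As as) (enc_tuple ce b)"
      "valid_gens K As as" "b \<in> univ (prod_alg As)" "d \<le> length As" unfolding SMP_from_def by auto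
    show "left x \<in> instances (CR)"
      unfolding CompactRep_def using x by auto
    fix y assume "y \<in> solutions (CR) (left x)"
    then have "decide (Node x y) = enc_bool (b \<in> Sg L (prod_alg As) (set as))"
      using decide_solution[OF x(2-4), of y] x(1) by simp
    then show "decide (Node x y) \<in> solutions (SMP_from d L K ca ce) x"
      unfolding SMP_from_def using x by auto
  qed auto
qed

section \<open>Padding inputs with few coordinates\<close>

definition vpad :: "val \<Rightarrow> val" where
  "vpad v = enc_list (replicate d (left v) @ dec_list v)"

definition vpad_instance :: "val \<Rightarrow> val" where
  "vpad_instance x = Node (Node (vpad (left (left x))) (enc_list (map (\<lambda>g. vpad g) (dec_list (right (left x))))))
     (vpad (right x))"

lemma fp_vpad_instance: "fp Or Qs vpad_instance"
  unfolding vpad_instance_def vpad_def by (intro fps)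

lemma map_select_pad:
  assumes "length xs = n" "n > 0"
  shows "enc_list (map f (select (replicate d 0 @ [0..<n]) xs)) = vpad (enc_list (map f xs))"
proof -
  have "left (enc_list (map f xs)) = f (xs ! 0)" using assms by (cases xs) auto
  moreover have "map f (select [0..<n] xs) = map f xs" using select_upt[of xs] assms by simp
  ultimately show ?thesis by (simp add: vpad_def select_def o_def)
qed

text \<open>With \<open>d\<close> extra copies of the first coordinate the length is at least
  \<open>d\<close>. The answer does not change, because the padded index list still ends with all
  the old coordinates and the projection along it is injective.\<close>

theorem SMP_reducible: "poly_time_reducible (SMP L K ca ce) (CR)"
proof -
  obtain q :: "nat poly" where q: "\<And>x y. x \<in> instances (CR) \<Longrightarrow>
      y \<in> solutions (CR) x \<Longrightarrow> vsize y \<le> poly q (vsize x)"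
    using CompactRep_solution_size by blast
  have "poly_time_solvable_with_calls {1} (SMP L K ca ce) (CR)"
  proof (rule poly_time_solvable_one_call[where pre = "\<lambda>x. left (vpad_instance x)"
        and post = "\<lambda>z. decide (Node (vpad_instance (left z)) (right z))", OF _ _ _ _ q])
    show "fp UNIV {} (\<lambda>x. left (vpad_instance x))" by (intro fps fp_vpad_instance)
    have "fp UNIV {} (\<lambda>z. Node (vpad_instance (left z)) (right z))"
      by (intro fps fp_comp[OF _ fp_vpad_instance])
    then show "fp UNIV {} (\<lambda>z. decide (Node (vpad_instance (left z)) (right z)))"
      by (rule fp_comp[OF _ fp_decide])
    fix x assume "x \<in> instances (SMP L K ca ce)"
    then obtain As as b where x: "x = Node (enc_gens ca ce As as) (enc_tuple ce b)"
      "valid_gens K As as" "b \<in> univ (prod_alg As)" unfolding SMP_from_def by auto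
    interpret smp_instance L V K d P ca ce As as by (rule smp_instanceI[OF x(2)])
    define js where "js = replicate d 0 @ [0..<n]"
    have n0: "n > 0" using As(2) by simp
    have js: "set js \<subseteq> {..<n}" using n0 by (auto simp: js_def)
    define As' where "As' = select js As"
    define as' where "as' = map (select js) as"
    define b' where "b' = select js b"
    have v': "valid_gens K As' as'"
      using As as js select_in_univ[OF js] n0 AsK unfolding valid_gens_def As'_def as'_def
      by (auto simp: select_def js_def)
    have b'U: "b' \<in> univ (prod_alg As')" unfolding b'_def As'_def by (rule select_in_univ[OF js x(3)])
    have dn: "d \<le> length As'" by (simp add: As'_def js_def)
    have "map (enc_tuple ce) as' = map vpad (map (enc_tuple ce) as)"
      using as(2) univD(1) map_select_pad[OF _ n0] unfolding as'_def js_def enc_tuple_def by auto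
    then have pad: "vpad_instance x = Node (enc_gens ca ce As' as') (enc_tuple ce b')"
      unfolding vpad_instance_def x(1) enc_gens_def As'_def b'_def enc_tuple_def js_def
      using map_select_pad[OF refl n0, of ca] map_select_pad[OF univD(1)[OF x(3)] n0, of ce]
      by (simp add: enc_tuple_def)
    have "select js ` B = Sg L (prod_alg As') (set as')"
      unfolding As'_def as'_def using Sg_select[OF js, of L "set as"] by simp
    moreover have "select js b \<in> select js ` B \<longleftrightarrow> b \<in> B"
    proof
      assume "select js b \<in> select js ` B"
      then obtain t where t: "t \<in> B" "select js b = select js t" by auto
      have tU: "length t = n" using t(1) B_univ univD(1) by auto
      have "drop d (select js t) = t" if "length t = n" for t :: "'a list"
        using select_upt[of t] that by (simp add: js_def select_def)
      then show "b \<in> B" using t tU univD(1)[OF x(3)] by metis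
    qed auto
    ultimately have eqv: "b' \<in> Sg L (prod_alg As') (set as') \<longleftrightarrow> b \<in> B" unfolding b'_def by simp
    show "left (vpad_instance x) \<in> instances (CR)"
      unfolding pad CompactRep_def using v' dn by auto
    fix y assume "y \<in> solutions (CR) (left (vpad_instance x))"
    then have "decide (Node (vpad_instance x) y) = enc_bool (b \<in> B)"
      using decide_solution[OF v' b'U dn, of y] eqv unfolding pad by simp
    then show "decide (Node (vpad_instance (left (Node x y))) (right (Node x y))) \<in> solutions (SMP L K ca ce) x"
      unfolding SMP_from_def using x n0 by (auto simp: Suc_le_eq)
  qed auto
  then show ?thesis unfolding poly_time_solvable_with_calls_def by (meson UNIV_I)
qed

end

section \<open>Computing a standardized representation with membership queries\<close>

lemma distinct_concat_map:
  assumes "distinct l" and "\<And>x. x \<in> set l \<Longrightarrow> distinct (g x)"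
    and "\<And>x y z. x \<in> set l \<Longrightarrow> y \<in> set l \<Longrightarrow> z \<in> set (g x) \<Longrightarrow> z \<in> set (g y) \<Longrightarrow> x = y"
  shows "distinct (concat (map g l))"
  using assms
proof (induction l)
  case (Cons a l)
  have "distinct (concat (map g l))"
    by (rule Cons.IH) (use Cons.prems in auto)
  moreover have "set (g a) \<inter> set (concat (map g l)) = {}"
    using Cons.prems(1,3) by fastforce
  ultimately show ?case using Cons.prems(2) by simp
qed simp

text \<open>A solution lists every index set exactly once, so strictly increasing lists are
  enumerated here instead of arbitrary tuples.\<close>

fun increasing_lists :: "nat \<Rightarrow> nat \<Rightarrow> nat list list" where
  "increasing_lists 0 n = [[]]"
| "increasing_lists (Suc k) n =
     concat (map (\<lambda>S. map (\<lambda>i. i # S) (filter (\<lambda>i. S = [] \<or> i < hd S) [0..<n])) (increasing_lists k n))"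

lemma set_increasing_lists:
  "set (increasing_lists k n) = {S. sorted_wrt (<) S \<and> set S \<subseteq> {..<n} \<and> length S = k}"
proof (induction k)
  case (Suc k)
  have *: "(sorted_wrt (<) (i # S)) \<longleftrightarrow> (S = [] \<or> i < hd S) \<and> sorted_wrt (<) S" for i and S :: "nat list"
    by (cases S) auto
  show ?case
  proof (intro equalityI subsetI)
    fix T assume "T \<in> set (increasing_lists (Suc k) n)"
    then show "T \<in> {S. sorted_wrt (<) S \<and> set S \<subseteq> {..<n} \<and> length S = Suc k}"
      using Suc * by (auto simp del: sorted_wrt.simps)
  next
    fix T assume T: "T \<in> {S. sorted_wrt (<) S \<and> set S \<subseteq> {..<n} \<and> length S = Suc k}"
    then obtain i S where "T = i # S" by (cases T) auto
    then show "T \<in> set (increasing_lists (Suc k) n)"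
      using T Suc *[of i S] by (auto simp del: sorted_wrt.simps)
  qed
qed auto

lemma distinct_increasing_lists: "distinct (increasing_lists k n)"
proof (induction k)
  case (Suc k)
  show ?case unfolding increasing_lists.simps
    by (rule distinct_concat_map[OF Suc]) (auto simp: distinct_map inj_on_def)
qed simp

text \<open>The second test is comparison in unary: dropping \<open>i\<close> cells from the head of
  \<open>S\<close> leaves something exactly if \<open>i\<close> is smaller.\<close>

fun vincreasing :: "nat \<Rightarrow> val list \<Rightarrow> val list" where
  "vincreasing 0 l = [Leaf]"
| "vincreasing (Suc k) l =
     concat (map (\<lambda>S. map (\<lambda>i. Node i S) (filter (\<lambda>i. S = Leaf \<or> vdrop i (left S) \<noteq> Leaf) l))
       (vincreasing k l))"

lemma fp_vincreasing [fps]: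
  assumes "fp Or Qs (\<lambda>x. enc_list (l x))"
  shows "fp Or Qs (\<lambda>x. enc_list (vincreasing k (l x)))"
proof (induction k)
  case (Suc k)
  show ?case unfolding vincreasing.simps
    by (intro fps assms[THEN fp_comp[rotated]] Suc[THEN fp_comp[rotated]])
qed (simp add: fp_const)

lemma enc_list_Leaf [simp]: "enc_list xs = Leaf \<longleftrightarrow> xs = []"
  using enc_list_inject[of xs "[]"] by simp

lemma vincreasing_eq:
  "vincreasing k (map enc_nat [0..<n]) = map (\<lambda>S. enc_list (map enc_nat S)) (increasing_lists k n)"
proof (induction k)
  case (Suc k)
  have dr: "vdrop (enc_nat i) (enc_nat j) \<noteq> Leaf \<longleftrightarrow> i < j" for i j
    using vdrop_enc[of i "replicate j Leaf"] unfolding enc_nat_def[of j, symmetric]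
    by (simp add: not_le)
  have "map (\<lambda>i. Node i (enc_list (map enc_nat S)))
      (filter (\<lambda>i. enc_list (map enc_nat S) = Leaf \<or> vdrop i (left (enc_list (map enc_nat S))) \<noteq> Leaf)
         (map enc_nat [0..<n])) =
    map (\<lambda>S. enc_list (map enc_nat S)) (map (\<lambda>i. i # S) (filter (\<lambda>i. S = [] \<or> i < hd S) [0..<n]))" for S
    using dr by (cases S) (auto simp: filter_map o_def)
  then show ?case using Suc by (simp add: map_concat o_def)
qed simp

section \<open>Guarded membership queries on projections\<close>

context smp_setting
begin

text \<open>Pairs, because the admissible element codes depend on the algebra at the
  coordinate.\<close>

definition codes :: "val set" where
  "codes = (\<lambda>(A, a). Node (ca A) (ce a)) ` (SIGMA A:K. univ A)"

lemma finite_codes: "finite codes"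
  unfolding codes_def by (intro finite_imageI finite_SigmaI finK finA)

text \<open>Overwriting all entries by \<open>Leaf\<close> turns equality of lengths into equality
  of trees.\<close>

definition vtuple :: "val \<Rightarrow> val \<Rightarrow> bool" where
  "vtuple EA g \<longleftrightarrow>
     enc_list (map (\<lambda>_. Leaf) (dec_list EA)) = enc_list (map (\<lambda>_. Leaf) (dec_list g)) \<and>
     list_all (\<lambda>i. Node (vnth EA i) (vnth g i) \<in> codes) (indices EA)"

lemma fp_vtuple:
  assumes "fp Or Qs EA" "fp Or Qs g"
  shows "fp Or Qs (\<lambda>x. enc_bool (vtuple (EA x) (g x)))"
  unfolding vtuple_def by (intro fps finite_codes assms[THEN fp_comp[rotated]])

lemma vtuple_iff:
  assumes "set As \<subseteq> K"
  shows "vtuple (enc_list (map ca As)) g \<longleftrightarrow> g \<in> enc_tuple ce ` univ (prod_alg As)"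
proof
  let ?EA = "enc_list (map ca As)"
  assume v: "vtuple ?EA g"
  have len: "length (dec_list g) = length As"
    using v unfolding vtuple_def by (auto dest!: arg_cong[of _ _ length])
  have "\<exists>a\<in>univ (As ! i). dec_list g ! i = ce a" if i: "i < length As" for i
  proof -
    have "Node (vnth ?EA (enc_nat i)) (vnth (enc_list (dec_list g)) (enc_nat i)) \<in> codes"
      using v i unfolding vtuple_def by (auto simp: list_all_iff)
    then have "Node (ca (As ! i)) (dec_list g ! i) \<in> codes" using i len by (simp del: enc_dec_list)
    then obtain A a where "A \<in> K" "a \<in> univ A" "ca (As ! i) = ca A" "dec_list g ! i = ce a"
      unfolding codes_def by auto
    moreover have "As ! i \<in> K" using assms i by (meson nth_mem subsetD)
    ultimately show ?thesis using inja by (metis inj_onD)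
  qed
  then obtain a where a: "\<And>i. i < length As \<Longrightarrow> a i \<in> univ (As ! i) \<and> dec_list g ! i = ce (a i)"
    by metis
  have "map a [0..<length As] \<in> univ (prod_alg As)" using a by (simp add: prod_alg_def)
  moreover have "dec_list g = map ce (map a [0..<length As])"
    using a len by (intro nth_equalityI) auto
  then have "g = enc_tuple ce (map a [0..<length As])" unfolding enc_tuple_def by (metis enc_dec_list)
  ultimately show "g \<in> enc_tuple ce ` univ (prod_alg As)" by blast
next
  assume "g \<in> enc_tuple ce ` univ (prod_alg As)"
  then obtain t where t: "g = enc_tuple ce t" "length t = length As" "\<And>i. i < length As \<Longrightarrow> t ! i \<in> univ (As ! i)"
    by (auto simp: prod_alg_def)
  have "Node (ca (As ! i)) (ce (t ! i)) \<in> codes" if "i < length As" for i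
    using that t assms unfolding codes_def by (auto intro!: rev_image_eqI[of "(As ! i, t ! i)"])
  moreover have "map (\<lambda>_. Leaf) (map ca As) = map (\<lambda>_. Leaf) (map ce t)"
    using t(2) by (intro nth_equalityI) auto
  ultimately show "vtuple (enc_list (map ca As)) g"
    unfolding vtuple_def t(1) using t(2) by (auto simp: list_all_iff enc_tuple_def)
qed

text \<open>A computable test for being an instance of SMP: programs run on arbitrary trees, yet
  only instances may reach the oracle.\<close>

definition vvalid :: "val \<Rightarrow> bool" where
  "vvalid x \<longleftrightarrow> \<not> left (left x) = Leaf \<and> \<not> right (left x) = Leaf \<and>
     list_all (\<lambda>A. A \<in> ca ` K) (dec_list (left (left x))) \<and>
     list_all (\<lambda>g. vtuple (left (left x)) g) (dec_list (right (left x))) \<and>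
     vtuple (left (left x)) (right x)"

lemma fp_vvalid: "fp Or Qs (\<lambda>x. enc_bool (vvalid x))"
  unfolding vvalid_def by (intro fps fp_vtuple finite_imageI finK)

lemma list_in_imageE:
  assumes "set l \<subseteq> f ` X"
  obtains l' where "l = map f l'" "set l' \<subseteq> X"
proof
  show "l = map f (map (inv_into X f) l)"
    using assms by (auto simp: subset_iff f_inv_into_f intro!: map_idI[symmetric])
  show "set (map (inv_into X f) l) \<subseteq> X" using assms by (auto simp: subset_iff inv_into_into)
qed

lemma vvalid_iff: "vvalid x \<longleftrightarrow> (\<exists>As as b. x = Node (enc_gens ca ce As as) (enc_tuple ce b) \<and>
   valid_gens K As as \<and> b \<in> univ (prod_alg As))"
proof
  assume v: "vvalid x"
  obtain As where As: "dec_list (left (left x)) = map ca As" "set As \<subseteq> K"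
    using v list_in_imageE[of "dec_list (left (left x))" ca K] unfolding vvalid_def list_all_iff by blast
  have EA: "left (left x) = enc_list (map ca As)" using As(1) by (metis enc_dec_list)
  have "set (dec_list (right (left x))) \<subseteq> enc_tuple ce ` univ (prod_alg As)"
    using v vtuple_iff[OF As(2)] EA unfolding vvalid_def list_all_iff by auto
  then obtain as where as: "dec_list (right (left x)) = map (enc_tuple ce) as" "set as \<subseteq> univ (prod_alg As)"
    by (rule list_in_imageE)
  have G: "right (left x) = enc_list (map (enc_tuple ce) as)" using as(1) by (metis enc_dec_list)
  obtain b where b: "right x = enc_tuple ce b" "b \<in> univ (prod_alg As)"
    using v vtuple_iff[OF As(2)] EA unfolding vvalid_def by auto
  have ne: "left (left x) \<noteq> Leaf" "right (left x) \<noteq> Leaf" using v unfolding vvalid_def by auto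
  then obtain x1 x2 where x1: "left x = Node x1 x2" by (cases "left x") auto
  then obtain x3 where "x = Node (left x) x3" by (cases x) auto
  then have "x = Node (enc_gens ca ce As as) (enc_tuple ce b)"
    using EA G b(1) x1 unfolding enc_gens_def by (metis left.simps(2) right.simps(2))
  moreover have "valid_gens K As as"
    using ne EA G As(2) as(2) unfolding valid_gens_def by auto
  ultimately show "\<exists>As as b. x = Node (enc_gens ca ce As as) (enc_tuple ce b) \<and>
   valid_gens K As as \<and> b \<in> univ (prod_alg As)" using b(2) by blast
next
  assume "\<exists>As as b. x = Node (enc_gens ca ce As as) (enc_tuple ce b) \<and>
   valid_gens K As as \<and> b \<in> univ (prod_alg As)"
  then obtain As as b where x: "x = Node (enc_gens ca ce As as) (enc_tuple ce b)"
   "valid_gens K As as" "b \<in> univ (prod_alg As)" by blast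
  then show "vvalid x" using vtuple_iff[of As]
    unfolding vvalid_def x(1) enc_gens_def by (auto simp: valid_gens_def list_all_iff)
qed

lemma vvalid_instances: "vvalid x \<longleftrightarrow> x \<in> instances (SMP L K ca ce)"
  unfolding vvalid_iff SMP_from_def by (auto simp: valid_gens_def Suc_le_eq)

definition smp_answer :: "val \<Rightarrow> bool" where
  "smp_answer x \<longleftrightarrow> (\<exists>As as b. x = Node (enc_gens ca ce As as) (enc_tuple ce b) \<and>
     valid_gens K As as \<and> b \<in> univ (prod_alg As) \<and> b \<in> Sg L (prod_alg As) (set as))"

lemma smp_answer_eq:
  assumes "valid_gens K As as" "b \<in> univ (prod_alg As)"
  shows "smp_answer (Node (enc_gens ca ce As as) (enc_tuple ce b)) \<longleftrightarrow> b \<in> Sg L (prod_alg As) (set as)"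
proof
  assume "smp_answer (Node (enc_gens ca ce As as) (enc_tuple ce b))"
  then obtain As' as' b' where *: "enc_gens ca ce As as = enc_gens ca ce As' as'"
      "enc_tuple ce b = enc_tuple ce b'" "valid_gens K As' as'" "b' \<in> univ (prod_alg As')"
      "b' \<in> Sg L (prod_alg As') (set as')" unfolding smp_answer_def by auto
  interpret smp_instance L V K d P ca ce As as by (rule smp_instanceI) fact
  have "As' = As" "as' = as" using enc_gens_inj[OF assms(1) *(3,1)] by auto
  then show "b \<in> Sg L (prod_alg As) (set as)" using * en_inj[OF assms(2), of b'] by simp
qed (use assms in \<open>auto simp: smp_answer_def\<close>)

abbreviation Orc where "Orc \<equiv> {f. solves f (SMP L K ca ce)}"
abbreviation Ins where "Ins \<equiv> instances (SMP L K ca ce)"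

lemma fp_smp_query: "fp Orc Ins (\<lambda>x. if vvalid x then enc_bool (smp_answer x) else Leaf)"
proof (rule fp_query[OF fp_vvalid])
  show "vvalid x \<Longrightarrow> x \<in> Ins" for x using vvalid_instances by blast
  show "poly_bounded (\<lambda>x. vsize (enc_bool (smp_answer x)))"
  proof (rule poly_boundedI_le[OF poly_bounded_const[of 3]])
    show "vsize (enc_bool (smp_answer x)) \<le> 3" for x by (cases "smp_answer x") auto
  qed
  fix f x assume f: "f \<in> Orc" and v: "vvalid x"
  then have "f x \<in> solutions (SMP L K ca ce) x" using vvalid_instances by (auto simp: solves_def)
  then obtain As as b where "f x = enc_bool (b \<in> Sg L (prod_alg As) (set as))"
    "x = Node (enc_gens ca ce As as) (enc_tuple ce b)" "valid_gens K As as" "b \<in> univ (prod_alg As)"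
    unfolding SMP_from_def by auto
  then show "f x = enc_bool (smp_answer x)" using smp_answer_eq by simp
qed

definition vselect :: "val list \<Rightarrow> val \<Rightarrow> val" where
  "vselect js v = enc_list (map (\<lambda>j. vnth v j) js)"

definition query_at :: "val \<Rightarrow> val list \<Rightarrow> val list \<Rightarrow> val \<Rightarrow> val" where
  "query_at EA G js t = Node (Node (vselect js EA) (enc_list (map (\<lambda>g. vselect js g) G))) t"

definition member_at :: "val \<Rightarrow> val list \<Rightarrow> val list \<Rightarrow> val \<Rightarrow> bool" where
  "member_at EA G js t \<longleftrightarrow> vvalid (query_at EA G js t) \<and> smp_answer (query_at EA G js t)"

lemma fp_member_at:
  assumes "fp Orc Ins EA" "fp Orc Ins (\<lambda>x. enc_list (G x))" "fp Orc Ins (\<lambda>x. enc_list (js x))" "fp Orc Ins t"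
  shows "fp Orc Ins (\<lambda>x. enc_bool (member_at (EA x) (G x) (js x) (t x)))"
proof -
  have "fp Orc Ins (\<lambda>x. query_at (EA x) (G x) (js x) (t x))"
    unfolding query_at_def vselect_def by (intro fps assms[THEN fp_comp[rotated]])
  from fp_comp[OF this fp_smp_query]
  have "fp Orc Ins (\<lambda>x. if vvalid (query_at (EA x) (G x) (js x) (t x))
     then enc_bool (smp_answer (query_at (EA x) (G x) (js x) (t x))) else Leaf)" .
  moreover have "(if p then enc_bool q else Leaf) = enc_bool (p \<and> q)" for p q by simp
  ultimately show ?thesis unfolding member_at_def by simp
qed

definition elems :: "'a list" where
  "elems = (SOME l. set l = carriers \<and> distinct l)"

lemma elems: "set elems = carriers" "distinct elems"
  using someI_ex[OF finite_distinct_list[OF finite_carriers]] unfolding elems_def by auto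

text \<open>Coordinates are prepended from the last to the first, including those already in
  \<open>js\<close>. As membership is tested on the list with repetitions, a repeated coordinate is
  forced to its old value; the leading entries then form the element.\<close>

definition extend :: "val \<Rightarrow> val list \<Rightarrow> val list \<Rightarrow> val \<Rightarrow> val" where
  "extend EA G js t = vselect (indices EA) (right (
     foldl (\<lambda>st i. Node (Node i (left st))
         (Node (find_default (\<lambda>e. member_at EA G (i # dec_list (left st)) (Node e (right st))) Leaf (map ce elems))
           (right st)))
       (Node (enc_list js) t) (map enc_nat (rev [0..<length (dec_list EA)]))))"

lemma fp_extend:
  assumes "fp Orc Ins EA" "fp Orc Ins (\<lambda>x. enc_list (G x))" "fp Orc Ins (\<lambda>x. enc_list (js x))" "fp Orc Ins t"
  shows "fp Orc Ins (\<lambda>x. extend (EA x) (G x) (js x) (t x))"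
proof (cases "Orc = {}")
  case False
  let ?l = "\<lambda>x. map enc_nat (rev [0..<length (dec_list (EA x))])"
  have l: "fp Orc Ins (\<lambda>x. enc_list (?l x))" by (intro fps assms)
  let ?B = "\<lambda>x. vsize (enc_list (?l x)) + vsize (enc_list (map ce elems)) + 3"
  have fold: "fp Orc Ins (\<lambda>x. foldl (\<lambda>st i. Node (Node i (left st))
         (Node (find_default (\<lambda>e. member_at (EA x) (G x) (i # dec_list (left st)) (Node e (right st))) Leaf
            (map ce elems)) (right st)))
       (Node (enc_list (js x)) (t x)) (?l x))"
  proof (rule fp_foldl_list[OF _ l, where B = ?B])
    show "fp Orc Ins (\<lambda>x. Node (enc_list (js x)) (t x))" by (intro fps assms)
    show "fp Orc Ins (\<lambda>z. Node (Node (left (right z)) (left (left z)))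
         (Node (find_default (\<lambda>e. member_at (EA (right (right z))) (G (right (right z)))
             (left (right z) # dec_list (left (left z))) (Node e (right (left z)))) Leaf
            (map ce elems)) (right (left z))))"
      by (intro fps fp_member_at assms[THEN fp_comp[rotated]])
    show "poly_bounded ?B" by (intro pb fp_poly_bounded[OF l False])
    fix x st i assume i: "i \<in> set (?l x)"
    let ?e = "find_default (\<lambda>e. member_at (EA x) (G x) (i # dec_list (left st)) (Node e (right st))) Leaf
       (map ce elems)"
    have "?e = Leaf \<or> ?e \<in> set (map ce elems)" using find_default_cases by metis
    then have "vsize ?e \<le> vsize (enc_list (map ce elems))"
      using vsize_enc_list_in[of ?e "map ce elems"] vsize_pos[of "enc_list (map ce elems)"]
      by (auto simp: Suc_le_eq less_imp_le)
    moreover have "vsize (left st) + vsize (right st) \<le> vsize st + 1" by (cases st) auto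
    ultimately show "vsize (Node (Node i (left st)) (Node ?e (right st))) \<le> vsize st + ?B x"
      using vsize_enc_list_in[OF i] unfolding vsize.simps by linarith
  qed
  show ?thesis unfolding extend_def vselect_def
    by (intro fps assms[THEN fp_comp[rotated]] fold[THEN fp_comp[rotated]])
qed (simp only: fp_empty)

text \<open>For fixed \<open>d\<close> there are polynomially many index sets and a constant number
  of value tuples, so all combinations can be tested.\<close>

definition local_part :: "val \<Rightarrow> val list \<Rightarrow> val list" where
  "local_part EA G = concat (map (\<lambda>S. map (\<lambda>c.
       enc_list [enc_list (map (\<lambda>i. Node Leaf i) (dec_list S)), c, extend EA G (dec_list S) c])
     (filter (\<lambda>c. member_at EA G (dec_list S) c) (map (enc_tuple ce) (List.n_lists (d - 1) elems))))
     (vincreasing (d - 1) (indices EA)))"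

lemma fp_local_part:
  assumes "fp Orc Ins EA" "fp Orc Ins (\<lambda>x. enc_list (G x))"
  shows "fp Orc Ins (\<lambda>x. enc_list (local_part (EA x) (G x)))"
  unfolding local_part_def by (intro fps fp_extend fp_member_at assms[THEN fp_comp[rotated]])

definition prefix_of :: "val \<Rightarrow> val \<Rightarrow> val" where
  "prefix_of s m = vselect (indices m) s"

lemma fp_prefix_of:
  assumes "fp Or Qs s" "fp Or Qs m"
  shows "fp Or Qs (\<lambda>x. prefix_of (s x) (m x))"
  unfolding prefix_of_def vselect_def by (intro fps assms[THEN fp_comp[rotated]])

text \<open>Trying all prefixes would be exponential; one element with entry \<open>g\<close> at
  \<open>m\<close> supplies the only prefix, which \<open>fork'_subset\<close> justifies. In the
  index list of a query \<open>m\<close> precedes the prefix.\<close>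

definition fork_part :: "val \<Rightarrow> val list \<Rightarrow> val list" where
  "fork_part EA G = concat (map (\<lambda>m. concat (map (\<lambda>g. map (\<lambda>h.
       enc_list [Node Leaf m, g, h, extend EA G [m] (Node g Leaf),
         extend EA G (m # indices m)
           (Node h (prefix_of (extend EA G [m] (Node g Leaf)) m))])
      (filter (\<lambda>h. member_at EA G (m # indices m)
           (Node h (prefix_of (extend EA G [m] (Node g Leaf)) m))) (map ce elems)))
      (filter (\<lambda>g. member_at EA G [m] (Node g Leaf)) (map ce elems))))
    (dec_list (vdrop (enc_nat (d - 1)) (enc_list (indices EA)))))"

lemma fp_fork_part:
  assumes "fp Orc Ins EA" "fp Orc Ins (\<lambda>x. enc_list (G x))"
  shows "fp Orc Ins (\<lambda>x. enc_list (fork_part (EA x) (G x)))"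
  unfolding fork_part_def
  by (intro fps fp_extend fp_member_at fp_prefix_of assms[THEN fp_comp[rotated]])

definition compact :: "val \<Rightarrow> val" where
  "compact x = Node (enc_list (local_part (left x) (dec_list (right x))))
     (enc_list (fork_part (left x) (dec_list (right x))))"

lemma fp_compact: "fp Orc Ins compact"
  unfolding compact_def by (intro fps fp_local_part fp_fork_part)

end

section \<open>Correctness of the computed representation\<close>

context smp_instance
begin

abbreviation G where "G \<equiv> map en as"

lemma vselect_enc:
  "set js \<subseteq> {..<length xs} \<Longrightarrow> vselect (map enc_nat js) (enc_list xs) = enc_list (select js xs)"
  unfolding vselect_def select_def by (auto simp: subset_iff)

lemma select_map: "set js \<subseteq> {..<length xs} \<Longrightarrow> select js (map f xs) = map f (select js xs)"
  unfolding select_def by (auto simp: subset_iff)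

text \<open>The query is an instance over the projected algebras, and by \<open>Sg_select\<close>
  its subalgebra is the projection of \<open>B\<close>.\<close>

lemma member_at_iff:
  assumes js: "js \<noteq> []" "set js \<subseteq> {..<n}"
  shows "member_at EA G (map enc_nat js) t \<longleftrightarrow> t \<in> (\<lambda>s. en (select js s)) ` B"
proof -
  define As' where "As' = select js As"
  define as' where "as' = map (select js) as"
  have EA': "vselect (map enc_nat js) EA = enc_list (map ca As')"
    using vselect_enc[of js "map ca As"] select_map[of js As ca] js(2) by (simp add: As'_def)
  have "vselect (map enc_nat js) (en s) = en (select js s)" if "s \<in> set as" for s
    using vselect_enc[of js "map ce s"] select_map[of js s ce] js(2) univD(1) as(2) that
    by (auto simp: enc_tuple_def)
  then have G': "map (\<lambda>g. vselect (map enc_nat js) g) G = map en as'" by (simp add: as'_def)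
  have q: "query_at EA G (map enc_nat js) t = Node (enc_gens ca ce As' as') t"
    unfolding query_at_def enc_gens_def EA' G' ..
  have v': "valid_gens K As' as'"
    using js As as select_in_univ[OF js(2)] AsK unfolding valid_gens_def As'_def as'_def
    by (auto simp: select_def subset_iff)
  have Sg': "Sg L (prod_alg As') (set as') = select js ` B"
    unfolding As'_def as'_def using Sg_select[OF js(2), of L "set as"] by simp
  interpret i': smp_instance L V K d P ca ce As' as' by (rule smp_instanceI[OF v'])
  show ?thesis
  proof
    assume "member_at EA G (map enc_nat js) t"
    then obtain As'' as'' b where *: "enc_gens ca ce As' as' = enc_gens ca ce As'' as''" "t = en b"
      "valid_gens K As'' as''" "b \<in> univ (prod_alg As'')" "b \<in> Sg L (prod_alg As'') (set as'')"
      unfolding member_at_def q smp_answer_def by auto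
    have "As'' = As'" "as'' = as'" using enc_gens_inj[OF v' *(3,1)] by auto
    then show "t \<in> (\<lambda>s. en (select js s)) ` B" using * Sg' by auto
  next
    assume "t \<in> (\<lambda>s. en (select js s)) ` B"
    then obtain s where s: "s \<in> B" "t = en (select js s)" by auto
    have 1: "select js s \<in> Sg L (prod_alg As') (set as')" using s(1) Sg' by auto
    then have 2: "select js s \<in> univ (prod_alg As')" using i'.B_univ by auto
    have "vvalid (Node (enc_gens ca ce As' as') t)"
      unfolding vvalid_iff by (intro exI conjI) (rule s(2)[THEN arg_cong], rule v', rule 2)
    moreover have "smp_answer (Node (enc_gens ca ce As' as') t)"
      unfolding s(2) using smp_answer_eq[OF v' 2] 1 by simp
    ultimately show "member_at EA G (map enc_nat js) t" unfolding member_at_def q by blast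
  qed
qed

text \<open>Invariant: the partial tuple is a projection of some \<open>s\<close> in
  \<open>B\<close>. The next entry of \<open>s\<close> passes the test, so the search succeeds; the
  value found may belong to another element, which then replaces \<open>s\<close>.\<close>

lemma extend_correct:
  assumes js: "set js \<subseteq> {..<n}" and t: "t \<in> (\<lambda>s. en (select js s)) ` B"
  shows "\<exists>s\<in>B. extend EA G (map enc_nat js) t = en s \<and> en (select js s) = t"
proof -
  let ?f = "\<lambda>st i. Node (Node i (left st))
     (Node (find_default (\<lambda>e. member_at EA G (i # dec_list (left st)) (Node e (right st))) Leaf (map ce elems))
       (right st))"
  define inv where "inv i st \<longleftrightarrow> left st = enc_list (map enc_nat ([i..<n] @ js)) \<and>
    (\<exists>xs. length xs = n - i \<and> right st = enc_list (xs @ dec_list t)) \<and>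
    right st \<in> (\<lambda>s. en (select ([i..<n] @ js) s)) ` B" for i st
  have step: "inv i (?f st (enc_nat i))" if inv: "inv (Suc i) st" and i: "i < n" for i st
  proof -
    obtain xs s where l: "left st = enc_list (map enc_nat ([Suc i..<n] @ js))" and xs: "length xs = n - Suc i"
      and r: "right st = enc_list (xs @ dec_list t)" and s: "s \<in> B" "right st = en (select ([Suc i..<n] @ js) s)"
      using inv unfolding inv_def by auto
    have up: "[i..<n] @ js = i # [Suc i..<n] @ js" using i by (simp add: upt_conv_Cons)
    have sub: "set ([i..<n] @ js) \<subseteq> {..<n}" using js by auto
    let ?p = "\<lambda>e. member_at EA G (enc_nat i # dec_list (left st)) (Node e (right st))"
    have p: "?p e \<longleftrightarrow> Node e (right st) \<in> (\<lambda>s. en (select ([i..<n] @ js) s)) ` B" for e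
    proof -
      have "enc_nat i # dec_list (left st) = map enc_nat ([i..<n] @ js)" using l up by simp
      then show ?thesis using member_at_iff[OF _ sub, of "Node e (right st)"] up by simp
    qed
    have "Node (ce (s ! i)) (right st) = en (select ([i..<n] @ js) s)"
      unfolding s(2) up by (simp add: select_def enc_tuple_def)
    then have "?p (ce (s ! i))" unfolding p using s(1) by blast
    moreover have "s ! i \<in> set elems"
      using s(1) B_univ univD(2)[of s i] i AsK elems(1) by auto
    ultimately have "?p (find_default ?p Leaf (map ce elems))"
      using find_default_cases[of ?p Leaf "map ce elems"] by auto
    then have "Node (find_default ?p Leaf (map ce elems)) (right st) \<in> (\<lambda>s. en (select ([i..<n] @ js) s)) ` B"
      unfolding p .
    moreover have "length (find_default ?p Leaf (map ce elems) # xs) = n - i" using xs i by simp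
    moreover have "Node (find_default ?p Leaf (map ce elems)) (right st) =
       enc_list ((find_default ?p Leaf (map ce elems) # xs) @ dec_list t)" using r by simp
    moreover have "Node (enc_nat i) (left st) = enc_list (map enc_nat ([i..<n] @ js))" using l up by simp
    ultimately show ?thesis unfolding inv_def left.simps right.simps by blast
  qed
  have loop: "inv 0 (foldl ?f st (map enc_nat (rev [0..<i])))" if "inv i st" "i \<le> n" for i st
    using that
  proof (induction i arbitrary: st)
    case (Suc i)
    have *: "foldl ?f st (map enc_nat (rev [0..<Suc i])) =
        foldl ?f (?f st (enc_nat i)) (map enc_nat (rev [0..<i]))" by simp
    show ?case unfolding * by (rule Suc.IH[OF step]) (use Suc.prems in auto)
  qed simp
  define st where "st = foldl ?f (Node (enc_list (map enc_nat js)) t) (map enc_nat (rev [0..<n]))"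
  have "inv n (Node (enc_list (map enc_nat js)) t)" using t unfolding inv_def by auto
  from loop[OF this order_refl] have "inv 0 st" unfolding st_def .
  then obtain xs s where xs: "length xs = n" and r: "right st = enc_list (xs @ dec_list t)"
    and s: "s \<in> B" "right st = en (select ([0..<n] @ js) s)"
    unfolding inv_def by auto
  have ls: "length s = n" using s(1) B_univ univD(1) by auto
  have "select ([0..<n] @ js) s = s @ select js s"
    using select_upt[of s] ls by (simp add: select_def)
  then have "xs @ dec_list t = map ce s @ map ce (select js s)"
    using r s(2) by (simp add: enc_tuple_def)
  then have xs': "xs = map ce s" "dec_list t = map ce (select js s)" using xs ls by auto
  have "t = en (select js s)" unfolding enc_tuple_def xs'(2)[symmetric] by simp
  moreover have "extend EA G (map enc_nat js) t = en s"
  proof -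
    have "extend EA G (map enc_nat js) t = vselect idx (right st)"
      unfolding extend_def st_def by simp
    also have "\<dots> = enc_list (select [0..<n] (xs @ dec_list t))"
      unfolding r by (rule vselect_enc) (use xs in auto)
    also have "select [0..<n] (xs @ dec_list t) = xs"
      using xs by (intro nth_equalityI) (auto simp: nth_append)
    finally show ?thesis unfolding xs' enc_tuple_def .
  qed
  ultimately show ?thesis using s(1) by blast
qed

lemma select_in_carrier: "s \<in> B \<Longrightarrow> set js \<subseteq> {..<n} \<Longrightarrow> set (select js s) \<subseteq> carriers"
proof -
  assume s: "s \<in> B" and js: "set js \<subseteq> {..<n}"
  have sU: "s \<in> UA" using s B_univ by auto
  have "set (select js s) \<subseteq> set s" using js univD(1)[OF sU] by (auto simp: select_def subset_iff)
  then show ?thesis using univ_sub[OF sU] by auto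
qed

definition ext :: "nat list \<Rightarrow> 'a list \<Rightarrow> 'a list" where
  "ext js c = (SOME s. s \<in> B \<and> extend EA G (map enc_nat js) (en c) = en s \<and> select js s = c)"

lemma ext:
  assumes js: "set js \<subseteq> {..<n}" and c: "c \<in> select js ` B"
  shows "ext js c \<in> B" "extend EA G (map enc_nat js) (en c) = en (ext js c)" "select js (ext js c) = c"
proof -
  obtain s where s: "s \<in> B" "extend EA G (map enc_nat js) (en c) = en s" "en (select js s) = en c"
    using extend_correct[OF js, of "en c"] c by auto
  have "select js s = c" using enc_tuple_inj[OF _ _ s(3)] select_in_carrier[OF _ js] s(1) c by blast
  then have "\<exists>s. s \<in> B \<and> extend EA G (map enc_nat js) (en c) = en s \<and> select js s = c" using s by blast
  from someI_ex[OF this] show "ext js c \<in> B" "extend EA G (map enc_nat js) (en c) = en (ext js c)"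
    "select js (ext js c) = c" unfolding ext_def by auto
qed

lemma member_at_en:
  assumes "js \<noteq> []" "set js \<subseteq> {..<n}" "set c \<subseteq> carriers"
  shows "member_at EA G (map enc_nat js) (en c) \<longleftrightarrow> c \<in> select js ` B"
proof -
  have "en c \<in> (\<lambda>s. en (select js s)) ` B \<longleftrightarrow> c \<in> select js ` B"
    using enc_tuple_inj[OF assms(3) select_in_carrier[OF _ assms(2)]] by blast
  then show ?thesis using member_at_iff[OF assms(1,2)] by simp
qed

definition loc :: "nat set \<times> 'a list \<Rightarrow> 'a list" where
  "loc = (\<lambda>(I, c). ext (map (\<lambda>i. i - 1) (sorted_list_of_set I)) c)"

definition local_list :: "(nat set \<times> 'a list) list" where
  "local_list = concat (map (\<lambda>S. map (\<lambda>c. (Suc ` set S, c))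
     (filter (\<lambda>c. c \<in> select S ` B) (List.n_lists (d - 1) elems))) (increasing_lists (d - 1) n))"

lemma increasing_Suc:
  assumes "sorted_wrt (<) (S :: nat list)"
  shows "sorted_list_of_set (Suc ` set S) = map Suc S"
proof -
  have "sorted (map Suc S)" "distinct (map Suc S)"
    using assms strict_sorted_iff[of S] by (auto simp: sorted_map distinct_map sorted_wrt_iff_nth_less)
  then show ?thesis using sorted_list_of_set.idem_if_sorted_distinct[of "map Suc S"] by simp
qed

lemma proj_Suc: "sorted_wrt (<) S \<Longrightarrow> proj (Suc ` set S) = select S"
  by (simp add: fun_eq_iff proj_def increasing_Suc select_def)

lemma set_local_list: "set local_list = local_indices d n B"
proof (intro equalityI subsetI)
  fix x assume "x \<in> set local_list"
  then obtain S c where S: "sorted_wrt (<) S" "set S \<subseteq> {..<n}" "length S = d - 1"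
    and c: "c \<in> select S ` B" and x: "x = (Suc ` set S, c)"
    unfolding local_list_def by (auto simp: set_increasing_lists)
  have "distinct S" using S(1) strict_sorted_iff by blast
  then have "card (Suc ` set S) = d - 1" using S(3) by (simp add: card_image distinct_card)
  moreover have "Suc ` set S \<subseteq> {1..n}" using S(2) by auto
  moreover have "c \<in> proj (Suc ` set S) ` B" using c unfolding proj_Suc[OF S(1)] .
  ultimately show "x \<in> local_indices d n B" unfolding local_indices_def x by simp
next
  fix x assume "x \<in> local_indices d n B"
  then obtain I c where x: "x = (I, c)" "I \<subseteq> {1..n}" "card I = d - 1" "c \<in> proj I ` B"
    unfolding local_indices_def by auto
  define S where "S = map (\<lambda>i. i - 1) (sorted_list_of_set I)"
  have fin: "finite I" using x(2) finite_subset by blast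
  have I1: "Suc (i - 1) = i" if "i \<in> I" for i using that x(2) by auto
  have mS: "map Suc S = sorted_list_of_set I" using I1 fin by (auto simp: S_def intro!: map_idI)
  have "set (map Suc S) = I" unfolding mS using fin by simp
  then have I: "Suc ` set S = I" by simp
  have "sorted_wrt (<) (map Suc S)" unfolding mS by (rule strict_sorted_list_of_set)
  then have S: "sorted_wrt (<) S" by (simp add: sorted_wrt_map)
  have len: "length S = d - 1" using x(3) by (simp add: S_def)
  have sub: "set S \<subseteq> {..<n}" using I x(2) by auto
  have c: "c \<in> select S ` B" using x(4) unfolding I[symmetric] proj_Suc[OF S] .
  then have "set c \<subseteq> carriers" "length c = d - 1" using select_in_carrier[OF _ sub] len by auto
  then have "c \<in> set (List.n_lists (d - 1) elems)" using elems(1) by (simp add: set_n_lists)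
  moreover have "S \<in> set (increasing_lists (d - 1) n)" using S len sub by (simp add: set_increasing_lists)
  ultimately show "x \<in> set local_list" unfolding local_list_def x(1) using c I by fastforce
qed

lemma distinct_local_list: "distinct local_list"
  unfolding local_list_def
proof (rule distinct_concat_map[OF distinct_increasing_lists])
  fix S assume "S \<in> set (increasing_lists (d - 1) n)"
  have "distinct (List.n_lists (d - 1) elems)" using elems(2) by (rule distinct_n_lists)
  then show "distinct (map (\<lambda>c. (Suc ` set S, c))
     (filter (\<lambda>c. c \<in> select S ` B) (List.n_lists (d - 1) elems)))"
    by (auto simp: distinct_map inj_on_def)
next
  fix S T z assume S: "S \<in> set (increasing_lists (d - 1) n)" and T: "T \<in> set (increasing_lists (d - 1) n)"
    and "z \<in> set (map (\<lambda>c. (Suc ` set S, c)) (filter (\<lambda>c. c \<in> select S ` B) (List.n_lists (d - 1) elems)))"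
    and "z \<in> set (map (\<lambda>c. (Suc ` set T, c)) (filter (\<lambda>c. c \<in> select T ` B) (List.n_lists (d - 1) elems)))"
  then have "Suc ` set S = Suc ` set T" by auto
  then have "map Suc S = map Suc T"
    using S T increasing_Suc by (metis (mono_tags, lifting) mem_Collect_eq set_increasing_lists)
  then show "S = T" by (simp add: inj_map_eq_map)
qed

lemma local_part_eq:
  "local_part EA G = map (\<lambda>(I, c). enc_list
     [enc_list (map enc_nat (sorted_list_of_set I)), en c, en (loc (I, c))]) local_list"
proof -
  let ?N = "List.n_lists (d - 1) elems"
  have "map (\<lambda>c. enc_list [enc_list (map (\<lambda>i. Node Leaf i) (map enc_nat S)), c, extend EA G (map enc_nat S) c])
     (filter (\<lambda>c. member_at EA G (map enc_nat S) c) (map en ?N)) =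
    map (\<lambda>(I, c). enc_list [enc_list (map enc_nat (sorted_list_of_set I)), en c, en (loc (I, c))])
     (map (\<lambda>c. (Suc ` set S, c)) (filter (\<lambda>c. c \<in> select S ` B) ?N))"
    if "S \<in> set (increasing_lists (d - 1) n)" for S
  proof -
    have S: "sorted_wrt (<) S" "set S \<subseteq> {..<n}" "S \<noteq> []"
      using that d by (auto simp: set_increasing_lists)
    have f: "filter (\<lambda>c. member_at EA G (map enc_nat S) c) (map en ?N) = map en (filter (\<lambda>c. c \<in> select S ` B) ?N)"
    proof -
      have "member_at EA G (map enc_nat S) (en c) \<longleftrightarrow> c \<in> select S ` B" if "c \<in> set ?N" for c
        using that elems(1) S by (intro member_at_en) (auto simp: set_n_lists)
      then show ?thesis unfolding filter_map o_def by (intro arg_cong[of _ _ "map en"] filter_cong) auto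
    qed
    have e: "extend EA G (map enc_nat S) (en c) = en (loc (Suc ` set S, c))" if "c \<in> select S ` B" for c
      using ext(2)[OF S(2) that] increasing_Suc[OF S(1)] by (simp add: loc_def o_def)
    show ?thesis unfolding f using e increasing_Suc[OF S(1)] by (auto simp: o_def)
  qed
  then show ?thesis
    unfolding local_part_def local_list_def dec_enc_list length_map vincreasing_eq map_concat map_map o_def
    by (intro arg_cong[of _ _ concat] map_cong refl) (simp add: o_def)
qed

definition base :: "nat \<Rightarrow> 'a \<Rightarrow> 'a list" where
  "base m \<gamma> = ext [m] [\<gamma>]"

text \<open>The choice of \<open>F\<close>: only forks whose first witness is the selected
  \<open>base\<close> element, hence possibly fewer than all forks of \<open>B\<close>.\<close>

definition fork_set :: "nat \<Rightarrow> ('a \<times> 'a) set" where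
  "fork_set m = {(\<gamma>, \<delta>). [\<gamma>] \<in> select [m - 1] ` B \<and>
     \<delta> # take (m - 1) (base (m - 1) \<gamma>) \<in> select ((m - 1) # [0..<m - 1]) ` B}"

definition fork_wit :: "nat \<times> 'a \<times> 'a \<Rightarrow> 'a list \<times> 'a list" where
  "fork_wit = (\<lambda>(m, \<gamma>, \<delta>). (base (m - 1) \<gamma>,
     ext ((m - 1) # [0..<m - 1]) (\<delta> # take (m - 1) (base (m - 1) \<gamma>))))"

definition fork_list :: "(nat \<times> 'a \<times> 'a) list" where
  "fork_list = concat (map (\<lambda>m. concat (map (\<lambda>\<gamma>. map (\<lambda>\<delta>. (Suc m, \<gamma>, \<delta>))
      (filter (\<lambda>\<delta>. \<delta> # take m (base m \<gamma>) \<in> select (m # [0..<m]) ` B) elems))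
      (filter (\<lambda>\<gamma>. [\<gamma>] \<in> select [m] ` B) elems))) [d - 1..<n])"

lemma base:
  assumes "m < n" "[\<gamma>] \<in> select [m] ` B"
  shows "base m \<gamma> \<in> B" "base m \<gamma> ! m = \<gamma>" "extend EA G [enc_nat m] (Node (ce \<gamma>) Leaf) = en (base m \<gamma>)"
  using ext[of "[m]" "[\<gamma>]"] assms unfolding base_def by (auto simp: select_def enc_tuple_def)

lemma fork_wit:
  assumes m: "m < n" and g: "(\<gamma>, \<delta>) \<in> fork_set (Suc m)"
  shows "fst (fork_wit (Suc m, \<gamma>, \<delta>)) \<in> B" "snd (fork_wit (Suc m, \<gamma>, \<delta>)) \<in> B"
    "witnesses_fork (Suc m) (fork_wit (Suc m, \<gamma>, \<delta>)) (\<gamma>, \<delta>)"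
proof -
  have g1: "[\<gamma>] \<in> select [m] ` B" and g2: "\<delta> # take m (base m \<gamma>) \<in> select (m # [0..<m]) ` B"
    using g by (auto simp: fork_set_def)
  note b = base[OF m g1]
  have js: "set (m # [0..<m]) \<subseteq> {..<n}" using m by auto
  let ?s = "ext (m # [0..<m]) (\<delta> # take m (base m \<gamma>))"
  note e = ext[OF js g2]
  have lb: "length (base m \<gamma>) = n" and ls: "length ?s = n" using b(1) e(1) B_univ univD(1) by auto
  have s: "?s ! m = \<delta>" "select [0..<m] ?s = take m (base m \<gamma>)"
    using e(3) by (auto simp: select_def)
  have "take m ?s = select [0..<m] ?s" using ls m by (intro nth_equalityI) auto
  then show "fst (fork_wit (Suc m, \<gamma>, \<delta>)) \<in> B" "snd (fork_wit (Suc m, \<gamma>, \<delta>)) \<in> B"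
    "witnesses_fork (Suc m) (fork_wit (Suc m, \<gamma>, \<delta>)) (\<gamma>, \<delta>)"
    using b e s by (auto simp: fork_wit_def witnesses_fork_def)
qed

lemma fork_set_carrier:
  assumes "m < n" "(\<gamma>, \<delta>) \<in> fork_set (Suc m)"
  shows "\<gamma> \<in> carriers" "\<delta> \<in> carriers"
proof -
  have "[\<gamma>] \<in> select [m] ` B" "\<delta> # take m (base m \<gamma>) \<in> select (m # [0..<m]) ` B"
    using assms(2) by (auto simp: fork_set_def)
  then obtain s t where "s \<in> B" "[\<gamma>] = select [m] s" "t \<in> B" "\<delta> # take m (base m \<gamma>) = select (m # [0..<m]) t"
    by auto
  moreover have "set (select [m] s) \<subseteq> carriers" "set (select (m # [0..<m]) t) \<subseteq> carriers"
    using calculation assms(1) by (intro select_in_carrier; auto)+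
  ultimately show "\<gamma> \<in> carriers" "\<delta> \<in> carriers"
    by (metis list.set_intros(1) subsetD)+
qed

lemma set_fork_list: "set fork_list = fork_indices d n fork_set"
proof (intro equalityI subsetI)
  fix x assume "x \<in> set fork_list"
  then show "x \<in> fork_indices d n fork_set"
    using d by (auto simp: fork_list_def fork_indices_def fork_set_def)
next
  fix x assume "x \<in> fork_indices d n fork_set"
  then obtain m \<gamma> \<delta> where x: "x = (m, \<gamma>, \<delta>)" "d \<le> m" "m \<le> n" "(\<gamma>, \<delta>) \<in> fork_set m"
    by (auto simp: fork_indices_def)
  then obtain m' where m': "m = Suc m'" using d by (cases m) auto
  have "\<gamma> \<in> set elems" "\<delta> \<in> set elems" using fork_set_carrier[of m' \<gamma> \<delta>] x m' elems(1) by auto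
  then show "x \<in> set fork_list" using x m' d unfolding fork_list_def fork_set_def by fastforce
qed

lemma distinct_fork_list: "distinct fork_list"
  unfolding fork_list_def
proof (rule distinct_concat_map)
  fix m
  show "distinct (concat (map (\<lambda>\<gamma>. map (\<lambda>\<delta>. (Suc m, \<gamma>, \<delta>))
      (filter (\<lambda>\<delta>. \<delta> # take m (base m \<gamma>) \<in> select (m # [0..<m]) ` B) elems))
      (filter (\<lambda>\<gamma>. [\<gamma>] \<in> select [m] ` B) elems)))"
    by (rule distinct_concat_map) (use elems(2) in \<open>auto simp: distinct_map inj_on_def\<close>)
qed auto

lemma fork_part_eq:
  "fork_part EA G = map (\<lambda>(m, \<gamma>, \<delta>). enc_list [enc_nat m, ce \<gamma>, ce \<delta>,
     en (fst (fork_wit (m, \<gamma>, \<delta>))), en (snd (fork_wit (m, \<gamma>, \<delta>)))]) fork_list"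
proof -
  let ?E = "\<lambda>(m, \<gamma>, \<delta>). enc_list [enc_nat m, ce \<gamma>, ce \<delta>,
     en (fst (fork_wit (m, \<gamma>, \<delta>))), en (snd (fork_wit (m, \<gamma>, \<delta>)))]"
  let ?b = "\<lambda>m g. extend EA G [enc_nat m] (Node g Leaf)"
  let ?j = "\<lambda>m. enc_nat m # map enc_nat [0..<m]"
  have fg: "filter (\<lambda>g. member_at EA G [enc_nat m] (Node g Leaf)) (map ce elems) =
      map ce (filter (\<lambda>\<gamma>. [\<gamma>] \<in> select [m] ` B) elems)" if m: "m < n" for m
  proof -
    have "member_at EA G [enc_nat m] (Node (ce \<gamma>) Leaf) \<longleftrightarrow> [\<gamma>] \<in> select [m] ` B" if "\<gamma> \<in> set elems" for \<gamma>
      using member_at_en[of "[m]" "[\<gamma>]"] m that elems(1) by (simp add: enc_tuple_def)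
    then show ?thesis unfolding filter_map o_def by (intro arg_cong[of _ _ "map ce"] filter_cong) auto
  qed
  have inner: "map (\<lambda>h. enc_list [Node Leaf (enc_nat m), ce \<gamma>, h, ?b m (ce \<gamma>),
         extend EA G (?j m) (Node h (prefix_of (?b m (ce \<gamma>)) (enc_nat m)))])
      (filter (\<lambda>h. member_at EA G (?j m) (Node h (prefix_of (?b m (ce \<gamma>)) (enc_nat m)))) (map ce elems)) =
     map ?E (map (\<lambda>\<delta>. (Suc m, \<gamma>, \<delta>))
      (filter (\<lambda>\<delta>. \<delta> # take m (base m \<gamma>) \<in> select (m # [0..<m]) ` B) elems))"
    if m: "m < n" and g: "[\<gamma>] \<in> select [m] ` B" for m \<gamma>
  proof -
    note b = base[OF m g]
    have bU: "base m \<gamma> \<in> UA" using b(1) B_univ by auto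
    have lb: "length (base m \<gamma>) = n" using univD(1)[OF bU] .
    have "prefix_of (en (base m \<gamma>)) (enc_nat m) = enc_list (select [0..<m] (map ce (base m \<gamma>)))"
      unfolding prefix_of_def enc_tuple_def dec_enc_nat length_replicate
      by (rule vselect_enc) (use lb m in auto)
    also have "select [0..<m] (map ce (base m \<gamma>)) = map ce (take m (base m \<gamma>))"
      using lb m by (intro nth_equalityI) auto
    finally have pre: "Node (ce \<delta>) (prefix_of (?b m (ce \<gamma>)) (enc_nat m)) = en (\<delta> # take m (base m \<gamma>))" for \<delta>
      unfolding b(3) by (simp add: enc_tuple_def)
    have js: "set (m # [0..<m]) \<subseteq> {..<n}" using m by auto
    have tk: "set (take m (base m \<gamma>)) \<subseteq> carriers"
      using univ_sub[OF bU] set_take_subset[of m "base m \<gamma>"] by blast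
    have mem: "member_at EA G (?j m) (Node (ce \<delta>) (prefix_of (?b m (ce \<gamma>)) (enc_nat m))) \<longleftrightarrow>
        \<delta> # take m (base m \<gamma>) \<in> select (m # [0..<m]) ` B" if "\<delta> \<in> set elems" for \<delta>
      unfolding pre using member_at_en[of "m # [0..<m]" "\<delta> # take m (base m \<gamma>)"] js tk that elems(1) by simp
    have f: "filter (\<lambda>h. member_at EA G (?j m) (Node h (prefix_of (?b m (ce \<gamma>)) (enc_nat m)))) (map ce elems) =
       map ce (filter (\<lambda>\<delta>. \<delta> # take m (base m \<gamma>) \<in> select (m # [0..<m]) ` B) elems)"
      unfolding filter_map o_def using mem by (intro arg_cong[of _ _ "map ce"] filter_cong) auto
    have "extend EA G (?j m) (Node (ce \<delta>) (prefix_of (?b m (ce \<gamma>)) (enc_nat m))) =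
        en (snd (fork_wit (Suc m, \<gamma>, \<delta>)))" if "\<delta> # take m (base m \<gamma>) \<in> select (m # [0..<m]) ` B" for \<delta>
      unfolding pre using ext(2)[OF js that] by (simp add: fork_wit_def)
    moreover have "?b m (ce \<gamma>) = en (fst (fork_wit (Suc m, \<gamma>, \<delta>)))" for \<delta>
      using b(3) by (simp add: fork_wit_def)
    ultimately show ?thesis unfolding f map_map by (intro map_cong refl) auto
  qed
  have dr: "dec_list (vdrop (enc_nat (d - 1)) (enc_list idx)) = map enc_nat [d - 1..<n]"
    by (simp add: drop_map)
  have outer: "concat (map (\<lambda>g. map (\<lambda>h. enc_list [Node Leaf (enc_nat m), g, h, ?b m g,
         extend EA G (?j m) (Node h (prefix_of (?b m g) (enc_nat m)))])
      (filter (\<lambda>h. member_at EA G (?j m) (Node h (prefix_of (?b m g) (enc_nat m)))) (map ce elems)))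
      (filter (\<lambda>g. member_at EA G [enc_nat m] (Node g Leaf)) (map ce elems))) =
    map ?E (concat (map (\<lambda>\<gamma>. map (\<lambda>\<delta>. (Suc m, \<gamma>, \<delta>))
      (filter (\<lambda>\<delta>. \<delta> # take m (base m \<gamma>) \<in> select (m # [0..<m]) ` B) elems))
      (filter (\<lambda>\<gamma>. [\<gamma>] \<in> select [m] ` B) elems)))" if m: "m < n" for m
    unfolding fg[OF m] map_concat map_map
    by (intro arg_cong[of _ _ concat] map_cong refl) (use inner[OF m] in \<open>simp add: o_def\<close>)
  show ?thesis
    unfolding fork_part_def fork_list_def dec_enc_list length_map length_upt diff_zero dr
      map_concat[of ?E] map_map
    by (intro arg_cong[of _ _ concat] map_cong refl)
      (simp only: o_apply dec_enc_nat length_replicate, rule outer, simp)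
qed

text \<open>With \<open>r\<close> the \<open>base\<close> element, \<open>p(b', b, r)\<close> agrees
  with \<open>r\<close> before \<open>m\<close>, as \<open>b\<close> and \<open>b'\<close> coincide
  there, and has entry \<open>\<delta>\<^sup>\<gamma>\<close> at \<open>m\<close>. So every fork,
  once exponentiated, is realized over the single prefix of \<open>r\<close>.\<close>

lemma fork'_subset:
  assumes m: "d \<le> Suc m" "m < n"
  shows "fork' d P As (Suc m) B \<subseteq> fork_set (Suc m)"
proof
  fix x assume "x \<in> fork' d P As (Suc m) B"
  then obtain \<gamma> \<delta> b b' where x: "x = (\<gamma>, pow_op d P (As ! m) \<delta> \<gamma>)" and b: "b \<in> B" "b' \<in> B"
    and w: "take m b = take m b'" "b ! m = \<gamma>" "b' ! m = \<delta>"
    unfolding fork'_def fork_def witnesses_fork_def by auto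
  have g: "[\<gamma>] \<in> select [m] ` B" using b(1) w(2) by (auto simp: select_def)
  note s = base[OF m(2) g]
  let ?s = "base m \<gamma>"
  let ?ts = "[b', b, ?s, b'] @ replicate (d - 1) ?s"
  let ?t = "opA ?ts"
  have tB: "?t \<in> B"
    by (rule term_op_in_Sg[OF nary]) (use b s d in \<open>auto simp: set_replicate_conv_if\<close>)
  have nth: "?t ! i = term_op (As ! i) P ([b' ! i, b ! i, ?s ! i, b' ! i] @ replicate (d - 1) (?s ! i))"
    if "i < n" for i
    using term_op_prod_nth[OF nary _ that, of ?ts] d by simp
  have U: "t ! i \<in> univ (As ! i)" if "t \<in> B" "i < n" for t i using that univD(2) B_univ by blast
  have "?t ! i = ?s ! i" if i: "i < m" for i
  proof -
    have "b' ! i = b ! i" using w(1) i by (metis nth_take)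
    then show ?thesis
      using nth[of i] i m(2) parallelogram_first[OF AsK U[OF b(1)] U[OF s(1)] U[OF b(1)], of i] by simp
  qed
  moreover have "length ?s = n" using s(1) B_univ univD(1) by auto
  ultimately have "select [0..<m] ?t = take m ?s" using m by (intro nth_equalityI) auto
  moreover have "?t ! m = pow_op d P (As ! m) \<delta> \<gamma>" using nth[OF m(2)] w s(2) by (simp add: pow_op_eq)
  ultimately have "pow_op d P (As ! m) \<delta> \<gamma> # take m ?s = select (m # [0..<m]) ?t" by (simp add: select_def)
  then show "x \<in> fork_set (Suc m)" unfolding x fork_set_def using g tB by auto
qed

lemma compact_correct:
  assumes dn: "d \<le> n"
  shows "compact (enc_gens ca ce As as) \<in> solutions (CR) (enc_gens ca ce As as)"
proof -
  \<comment> \<open>\<open>R\<close> consists of the designated elements only, so the last condition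
    on a standardized representation holds by construction.\<close>
  define R where "R = loc ` local_indices d n B \<union>
     (\<lambda>h. fst (fork_wit h)) ` fork_indices d n fork_set \<union> (\<lambda>h. snd (fork_wit h)) ` fork_indices d n fork_set"
  have loc: "loc (I, c) \<in> B \<and> proj I (loc (I, c)) = c" if "(I, c) \<in> local_indices d n B" for I c
  proof -
    have "(I, c) \<in> set local_list" using that set_local_list by simp
    then obtain S where S: "sorted_wrt (<) S" "set S \<subseteq> {..<n}" "I = Suc ` set S" and c: "c \<in> select S ` B"
      unfolding local_list_def by (auto simp: set_increasing_lists)
    have "loc (I, c) = ext S c" using increasing_Suc[OF S(1)] S(3) by (simp add: loc_def o_def)
    then show ?thesis using ext[OF S(2) c] S(3) by (simp add: proj_Suc[OF S(1)])
  qed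
  have wit: "fst (fork_wit (m, g)) \<in> B \<and> snd (fork_wit (m, g)) \<in> B \<and> witnesses_fork m (fork_wit (m, g)) g"
    if "(m, g) \<in> fork_indices d n fork_set" for m g
  proof -
    obtain \<gamma> \<delta> where g: "g = (\<gamma>, \<delta>)" by (cases g)
    have m: "d \<le> m" "m \<le> n" "(\<gamma>, \<delta>) \<in> fork_set m" using that by (auto simp: fork_indices_def g)
    obtain m' where m': "m = Suc m'" using m(1) d by (cases m) auto
    show ?thesis using fork_wit[of m' \<gamma> \<delta>] m unfolding g m' by auto
  qed
  have RB: "R \<subseteq> B"
  proof -
    have "loc l \<in> B" if "l \<in> local_indices d n B" for l using loc[of "fst l" "snd l"] that by simp
    moreover have "fst (fork_wit h) \<in> B" "snd (fork_wit h) \<in> B" if "h \<in> fork_indices d n fork_set" for h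
      using wit[of "fst h" "snd h"] that by simp_all
    ultimately show ?thesis unfolding R_def by blast
  qed
  have inR: "fork_wit h \<in> R \<times> R" if "h \<in> fork_indices d n fork_set" for h
    using that unfolding R_def mem_Times_iff by blast
  have "standardized_rep d P As B R loc fork_set fork_wit"
    unfolding standardized_rep_def
  proof (intro conjI)
    show "\<forall>(I, c)\<in>local_indices d n B. loc (I, c) \<in> R \<and> proj I (loc (I, c)) = c"
      using loc unfolding R_def by blast
    show "\<forall>(m, g)\<in>fork_indices d n fork_set. fork_wit (m, g) \<in> R \<times> R \<and> witnesses_fork m (fork_wit (m, g)) g"
      using inR wit by blast
    show "\<forall>e\<in>R. (\<exists>l\<in>local_indices d n B. e = loc l) \<or>
        (\<exists>h\<in>fork_indices d n fork_set. e = fst (fork_wit h) \<or> e = snd (fork_wit h))"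
      unfolding R_def by blast
    show "\<forall>m. d \<le> m \<and> m \<le> n \<longrightarrow> fork' d P As m B \<subseteq> fork_set m \<and> fork_set m \<subseteq> fork m R"
    proof (intro allI impI conjI)
      fix m assume m: "d \<le> m \<and> m \<le> n"
      then obtain m' where m': "m = Suc m'" using d by (cases m) auto
      show "fork' d P As m B \<subseteq> fork_set m" using fork'_subset[of m'] m m' by simp
      show "fork_set m \<subseteq> fork m R"
      proof
        fix g assume g: "g \<in> fork_set m"
        have h: "(m, g) \<in> fork_indices d n fork_set" using g m by (cases g) (auto simp: fork_indices_def)
        have "witnesses_fork m (fst (fork_wit (m, g)), snd (fork_wit (m, g))) g" using wit[OF h] by simp
        moreover have "fst (fork_wit (m, g)) \<in> R" "snd (fork_wit (m, g)) \<in> R"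
          using inR[OF h] by (simp_all add: mem_Times_iff)
        ultimately show "g \<in> fork m R" unfolding fork_def by blast
      qed
    qed
  qed (rule RB)
  moreover have "encodes_rep ce d n B loc fork_set fork_wit (compact (enc_gens ca ce As as))"
    unfolding encodes_rep_def
  proof (intro exI conjI)
    show "compact (enc_gens ca ce As as) = Node
       (enc_list (map (\<lambda>(I, c). enc_list
          [enc_list (map enc_nat (sorted_list_of_set I)), en c, en (loc (I, c))]) local_list))
       (enc_list (map (\<lambda>(m, \<gamma>, \<delta>). enc_list
          [enc_nat m, ce \<gamma>, ce \<delta>, en (fst (fork_wit (m, \<gamma>, \<delta>))), en (snd (fork_wit (m, \<gamma>, \<delta>)))]) fork_list))"
      unfolding compact_def enc_gens_def left.simps right.simps dec_enc_list local_part_eq fork_part_eq ..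
  qed (rule distinct_local_list set_local_list distinct_fork_list set_fork_list)+
  ultimately show ?thesis
    unfolding CompactRep_def problem.select_convs mem_Collect_eq using valid dn by blast
qed

end

context smp_setting
begin

text \<open>Answers of SMP are determined by the instance, so \<open>compact\<close> is the same
  function for all its oracles and the class \<open>fp\<close> suffices.\<close>

theorem CompactRep_reducible: "poly_time_reducible (CR) (SMP L K ca ce)"
proof (rule poly_time_solvable_if_fp[OF fp_compact])
  fix x assume "x \<in> instances (CR)"
  then obtain As as where x: "x = enc_gens ca ce As as" "valid_gens K As as" "d \<le> length As"
    unfolding CompactRep_def by auto
  interpret smp_instance L V K d P ca ce As as by (rule smp_instanceI[OF x(2)])
  show "compact x \<in> solutions (CR) x"
    unfolding x(1) by (rule compact_correct[OF x(3)])
qed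

end

theorem theorem4p16:
  fixes L :: "'f language"
    and V :: "('f, 'a) alg set"
    and K :: "('f, 'a) alg set"
    and d :: nat
    and P :: "'f trm"
    and ca :: "('f, 'a) alg \<Rightarrow> val"
    and ce :: "'a \<Rightarrow> val"
  assumes "finite (syms L)"
    and "variety L V"
    and "d > 1"
    and "\<exists>t. cube_term L V d t"
    and "parallelogram_term L V d P"
    and "finite K"
    and "K \<subseteq> V"
    and "\<forall>A\<in>K. finite (univ A)"
    and "inj_on ca K"
    and "inj_on ce (\<Union>A\<in>K. univ A)"
  shows "poly_time_reducible (SMP L K ca ce) (CompactRep d P L K ca ce) \<and>
         poly_time_reducible (CompactRep d P L K ca ce) (SMP L K ca ce) \<and>
         poly_time_solvable_with_calls {1} (SMP_from d L K ca ce) (CompactRep d P L K ca ce)"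
proof -
  interpret smp_setting L V K d P ca ce
    by unfold_locales (use assms in auto)
  show ?thesis using SMP_reducible CompactRep_reducible SMP_from_one_call by blast
qed

end
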